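(* Let $\Gamma=\Gamma(S_{d_0},HF)$ be a finitely generated saturated directed group acting on $T_{\bar d}$ with $\bar d$ bounded and $F$ a nontrivial finite group, and let $Y_n$ be the random walk with step law $\mu$ (below) started at the identity. Then for every $\varepsilon>0$ and all $n$ large enough, $$\beta'(n)-\varepsilon\le\frac{\log\left(-\log P(Y_n=1)\right)}{\log n}\le\beta(n)+\varepsilon.$$
   Context: $\bar d=(d_j)_{j\ge0}$ is a bounded sequence of integers $d_j\ge2$, $\sigma\bar d=(d_1,d_2,\dots)$. $T_{\bar d}$ is the spherically homogeneous rooted tree with vertices the finite sequences $i_1\dots i_k$, $i_j\in\{1,\dots,d_{j-1}\}$; $\partial T_{\bar d}$ its boundary; $1^\infty=111\dots$. Products of automorphisms follow $(gf)(x)=f(g(x))$. Each $g\in\mathrm{Aut}(T_{\bar d})$ is written $g=(g_1,\dots,g_{d_0})\tau$ ($g_t\in\mathrm{Aut}(T_{\sigma\bar d})$, $\tau\in S_{d_0}$, $g(ty)=\tau(t)g_t(y)$); rooted automorphisms form a copy of $S_{d_0}$. $H_{\bar d}$ is defined recursively: $h\in H_{\bar d}$ iff $h=(h',\sigma_2,\dots,\sigma_{d_0})$ with $h'\in H_{\sigma\bar d}$ and $\sigma_2,\dots,\sigma_{d_0}$ rooted automorphisms of $T_{\sigma\bar d}$; thus $H_{\bar d}\cong\prod_{l\ge1}S_{d_l}^{\,d_{l-1}-1}$. For a finite group $F$, $F\wr_{\partial T_{\bar d}}\mathrm{Aut}(T_{\bar d})=\{\varphi:\partial T_{\bar d}\to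 F\}\rtimes\mathrm{Aut}(T_{\bar d})$ with $(g.\varphi)(x)=\varphi(g(x))$ and $(\varphi g)(\varphi'g')=\varphi(g.\varphi')gg'$; $\varphi_f$ equals $f$ at $1^\infty$ and is trivial elsewhere. $\Gamma(S_{d_0},HF)$ is the subgroup generated by the rooted group $S_{d_0}$, a finite subgroup $H\le H_{\bar d}$ such that the pushforward of the uniform measure on $H$ to each factor $S_{d_l}$ is uniform, and $\{\varphi_f:f\in F\}$; $HF\cong H\times F$. $\mu$ is the law of $sks'$ with $s,s'$ uniform on $S_{d_0}$, $k$ uniform on $HF$, independent. $p_i=\frac{d_i-1}{d_i^2}$, $k(n)=\min\{k\ge0:p_0\cdots p_kn\le1\}$, $\beta(n)=\frac{\log(d_0\cdots d_{k(n)})}{\log n}$; $l(n)=\max\{l:\prod_{i=0}^{l}\frac{d_i^3}{d_i-1}\le n\}$ and $\beta'(n)=\frac{\log(d_0\cdots d_{l(n)})}{\log n}$. *)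

theory Defs
  imports "HOL-Probability.Probability" "HOL-Algebra.Group" "HOL-Combinatorics.Permutations"
begin

text \<open>Boundary of the spherically homogeneous tree T_d: infinite sequences x with
  x j in {1..d j}.  Elements of the wreath product are represented extensionally:
  lamp configurations are trivial outside the boundary, tree automorphisms are the
  identity outside the boundary.\<close>

definition bd :: "(nat \<Rightarrow> nat) \<Rightarrow> (nat \<Rightarrow> nat) set" where
  "bd d = {x. \<forall>j. 1 \<le> x j \<and> x j \<le> d j}"

definition ones :: "nat \<Rightarrow> nat" where
  "ones = (\<lambda>_. 1)"

definition rootact :: "(nat \<Rightarrow> nat) \<Rightarrow> (nat \<Rightarrow> nat) \<Rightarrow> (nat \<Rightarrow> nat) \<Rightarrow> (nat \<Rightarrow> nat)" where
  "rootact d \<tau> x = (if x \<in> bd d then x(0 := \<tau> (x 0)) else x)"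

text \<open>Elements of H_d, parametrised by families pi l t (l \<ge> 1, t in {2..d(l-1)})
  of permutations of {1..d l}: the permutation pi l t acts on the subtree below the
  vertex 1^(l-1) t, as a rooted automorphism.\<close>
definition Hfam :: "(nat \<Rightarrow> nat) \<Rightarrow> (nat \<Rightarrow> nat \<Rightarrow> nat \<Rightarrow> nat) \<Rightarrow> bool" where
  "Hfam d \<pi> \<longleftrightarrow> (\<forall>t. \<pi> 0 t = id) \<and>
     (\<forall>l t. (t \<in> {2..d l} \<longrightarrow> \<pi> (Suc l) t permutes {1..d (Suc l)}) \<and>
            (t \<notin> {2..d l} \<longrightarrow> \<pi> (Suc l) t = id))"

definition hact :: "(nat \<Rightarrow> nat) \<Rightarrow> (nat \<Rightarrow> nat \<Rightarrow> nat \<Rightarrow> nat) \<Rightarrow> (nat \<Rightarrow> nat) \<Rightarrow> (nat \<Rightarrow> nat)" where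
  "hact d \<pi> x = (if x \<in> bd d \<and> (\<exists>m. x m \<noteq> 1)
      then (let m = (LEAST m. x m \<noteq> 1) in x(Suc m := \<pi> (Suc m) (x m) (x (Suc m))))
      else x)"

text \<open>Wreath product F wr_{boundary} Aut(T_d): pairs (phi, g), with
  (phi g)(phi' g') = phi (g.phi') g g', (g.phi)(x) = phi(g x), (g g')(x) = g'(g x).\<close>
type_synonym 'f welt = "((nat \<Rightarrow> nat) \<Rightarrow> 'f) \<times> ((nat \<Rightarrow> nat) \<Rightarrow> (nat \<Rightarrow> nat))"

definition wmul :: "('f, 'z) monoid_scheme \<Rightarrow> 'f welt \<Rightarrow> 'f welt \<Rightarrow> 'f welt" where
  "wmul F a b = (\<lambda>x. fst a x \<otimes>\<^bsub>F\<^esub> fst b (snd a x), snd b \<circ> snd a)"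

definition wone :: "('f, 'z) monoid_scheme \<Rightarrow> 'f welt" where
  "wone F = (\<lambda>_. \<one>\<^bsub>F\<^esub>, id)"

definition phi :: "('f, 'z) monoid_scheme \<Rightarrow> 'f \<Rightarrow> ((nat \<Rightarrow> nat) \<Rightarrow> 'f)" where
  "phi F f = (\<lambda>x. if x = ones then f else \<one>\<^bsub>F\<^esub>)"

definition rootel :: "('f, 'z) monoid_scheme \<Rightarrow> (nat \<Rightarrow> nat) \<Rightarrow> (nat \<Rightarrow> nat) \<Rightarrow> 'f welt" where
  "rootel F d \<tau> = (\<lambda>_. \<one>\<^bsub>F\<^esub>, rootact d \<tau>)"

definition kel :: "('f, 'z) monoid_scheme \<Rightarrow> (nat \<Rightarrow> nat) \<Rightarrow> (nat \<Rightarrow> nat \<Rightarrow> nat \<Rightarrow> nat) \<Rightarrow> 'f \<Rightarrow> 'f welt" where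
  "kel F d \<pi> f = wmul F (\<lambda>_. \<one>\<^bsub>F\<^esub>, hact d \<pi>) (phi F f, id)"

definition Sroot :: "(nat \<Rightarrow> nat) \<Rightarrow> (nat \<Rightarrow> nat) set" where
  "Sroot d = {\<tau>. \<tau> permutes {1..d 0}}"

definition mu :: "('f, 'z) monoid_scheme \<Rightarrow> (nat \<Rightarrow> nat) \<Rightarrow> (nat \<Rightarrow> nat \<Rightarrow> nat \<Rightarrow> nat) set \<Rightarrow> 'f welt pmf" where
  "mu F d H =
     bind_pmf (pmf_of_set (Sroot d)) (\<lambda>s.
     bind_pmf (pmf_of_set (H \<times> carrier F)) (\<lambda>(\<pi>, f).
     map_pmf (\<lambda>s'. wmul F (wmul F (rootel F d s) (kel F d \<pi> f)) (rootel F d s'))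
       (pmf_of_set (Sroot d))))"

primrec walk :: "('f, 'z) monoid_scheme \<Rightarrow> (nat \<Rightarrow> nat) \<Rightarrow> (nat \<Rightarrow> nat \<Rightarrow> nat \<Rightarrow> nat) set \<Rightarrow> nat \<Rightarrow> 'f welt pmf" where
  "walk F d H 0 = return_pmf (wone F)"
| "walk F d H (Suc n) = bind_pmf (walk F d H n) (\<lambda>y. map_pmf (\<lambda>z. wmul F y z) (mu F d H))"

definition pp :: "(nat \<Rightarrow> nat) \<Rightarrow> nat \<Rightarrow> real" where
  "pp d i = (real (d i) - 1) / (real (d i))^2"

definition kk :: "(nat \<Rightarrow> nat) \<Rightarrow> nat \<Rightarrow> nat" where
  "kk d n = (LEAST k. (\<Prod>i\<le>k. pp d i) * real n \<le> 1)"

definition beta :: "(nat \<Rightarrow> nat) \<Rightarrow> nat \<Rightarrow> real" where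
  "beta d n = ln (real (\<Prod>i\<le>kk d n. d i)) / ln (real n)"

definition ll :: "(nat \<Rightarrow> nat) \<Rightarrow> nat \<Rightarrow> nat" where
  "ll d n = (GREATEST l. (\<Prod>i\<le>l. (real (d i))^3 / (real (d i) - 1)) \<le> real n)"

definition beta' :: "(nat \<Rightarrow> nat) \<Rightarrow> nat \<Rightarrow> real" where
  "beta' d n = ln (real (\<Prod>i\<le>ll d n. d i)) / ln (real n)"

end

theory Submission
  imports Defs "HOL-Real_Asymp.Real_Asymp"
begin

text \<open>
  Both bounds rest on one computation: along a fixed vertex, a step \<open>s k s'\<close> of the walk at one
  level becomes, at the next level, a single letter that is uniform on the directed group with
  probability \<open>q = 1/d\<close> and uniform on the rooted group otherwise. Averaging over a finite group is
  idempotent, so a function that is almost invariant under \<open>S K\<close> at one level is turned into one at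
  the level above by mixing in its \<open>K\<close>-average, and its rate is multiplied by \<open>p = q (1 - q)\<close>.

  Applied to the word length, this yields a length function on the group whose expectation grows by
  at most \<open>d_0 \<dots> d_k p_0 \<dots> p_k\<close> per step, starting at \<open>O(d_0 \<dots> d_k)\<close>, and for which
  \<open>\<Sum> exp (- c len)\<close> is \<open>exp (O(d_0 \<dots> d_k))\<close>; by Cauchy--Schwarz and Jensen,
  \<open>P(Y_2n = 1) = \<Sum> P(Y_n = g)^2\<close> is then at least \<open>exp (- O(d_0 \<dots> d_k))\<close>.

  Applied to the process killed when a vertex of level \<open>l + 1\<close> is moved to the ray \<open>1^\<infinity>\<close>, it shows
  that the vertex survives \<open>n\<close> steps with probability at most \<open>3^(l+1) (1 - p_0 \<dots> p_l)^n\<close>. If no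
  vertex survives, at least \<open>d_0 \<dots> d_l\<close> lamps carry independent uniform elements of \<open>F\<close>, which are
  all trivial with probability at most \<open>2^(- d_0 \<dots> d_l)\<close>.
\<close>

section \<open>Averages over finite sets\<close>

text \<open>Why a mixture: the letters received one level down are independent, directed with
  probability q and rooted with probability 1 - q, and consecutive directed letters merge because
  they form a finite group. A good length therefore grows only when a rooted letter is followed by a
  directed one, at rate q (1 - q) = (d - 1) / d^2. Summing the lower length over the sections gives
  only the rate q, since a group element does not remember the type of its last letter. The
  K-average of the length stands in for this memory, and the weights 1 - q and q are the stationary
  law of the type.

  The length need not be subadditive or equal to a number of letters: only its drift, its value at
  the identity and an exponential sum enter, and all three pass through averages.

  For the survival of a vertex the chain is killed, so a decay factor 1 - eta has to be carried
  through the recursion and the weights are perturbed accordingly. Idempotence survives the killing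
  because directed elements preserve the subtree below every vertex 1^l.\<close>

definition av :: "'a set \<Rightarrow> ('a \<Rightarrow> real) \<Rightarrow> real" where
  "av A h = (\<Sum>a\<in>A. h a) / real (card A)"

lemma av_mono: "(\<And>a. a \<in> A \<Longrightarrow> f a \<le> g a) \<Longrightarrow> av A f \<le> av A g"
  unfolding av_def by (intro divide_right_mono sum_mono) auto

lemma av_cong: "(\<And>a. a \<in> A \<Longrightarrow> f a = g a) \<Longrightarrow> av A f = av A g"
  unfolding av_def by (simp cong: sum.cong)

lemma av_const: "finite A \<Longrightarrow> A \<noteq> {} \<Longrightarrow> av A (\<lambda>_. c) = c"
  unfolding av_def by simp

lemma av_add: "av A (\<lambda>a. f a + g a) = av A f + av A g"
  unfolding av_def by (simp add: sum.distrib add_divide_distrib)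

lemma av_cmult: "av A (\<lambda>a. c * f a) = c * av A f"
  unfolding av_def by (simp add: sum_distrib_left)

lemma av_sum: "av A (\<lambda>a. \<Sum>t\<in>T. f t a) = (\<Sum>t\<in>T. av A (f t))"
  unfolding av_def by (subst sum.swap) (simp add: sum_divide_distrib)

lemma av_swap: "av A (\<lambda>a. av B (f a)) = av B (\<lambda>b. av A (\<lambda>a. f a b))"
  unfolding av_def by (simp add: sum_divide_distrib [symmetric] sum.swap [of _ B] divide_divide_eq_left mult.commute)

lemma av_prod: "av (A \<times> B) f = av A (\<lambda>a. av B (\<lambda>b. f (a, b)))"
  unfolding av_def
  by (simp add: sum.cartesian_product sum_divide_distrib [symmetric] card_cartesian_product mult.commute)

lemma av_reindex: "bij_betw \<theta> A B \<Longrightarrow> av A (\<lambda>a. h (\<theta> a)) = av B h"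
  unfolding av_def by (simp add: sum.reindex_bij_betw bij_betw_same_card)

lemma av_pmf_of_set:
  assumes "finite A" "A \<noteq> {}"
  shows "av A h = measure_pmf.expectation (pmf_of_set A) h"
  using assms by (simp add: av_def integral_pmf_of_set)

lemma exp_av_le:
  assumes "finite A" "A \<noteq> {}"
  shows "exp (c * av A f) \<le> av A (\<lambda>a. exp (c * f a))"
proof -
  have n: "real (card A) > 0" using assms by (simp add: card_gt_0_iff)
  have "exp (\<Sum>a\<in>A. (1 / real (card A)) *\<^sub>R (c * f a)) \<le> (\<Sum>a\<in>A. (1 / real (card A)) * exp (c * f a))"
    by (rule convex_on_sum [OF \<open>finite A\<close> _ exp_convex]) (use assms n in auto)
  then show ?thesis
    by (simp add: av_def sum_divide_distrib [symmetric] sum_distrib_left [symmetric])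
qed

text \<open>Precomposition with a transposition shows that the average does not depend on the point;
  it may then be averaged over all points and the two averages exchanged.\<close>

lemma av_permutes_point:
  assumes i: "i \<in> {1..n}"
  shows "av {\<tau>. \<tau> permutes {1..n}} (\<lambda>\<tau>. h (\<tau> i)) = av {1..n::nat} h"
proof -
  let ?P = "{\<tau>. \<tau> permutes {1..n}}"
  have fin: "finite ?P" "?P \<noteq> {}"
    using finite_permutations [of "{1..n}"] permutes_id [of "{1..n}"] by blast+
  have eq: "av ?P (\<lambda>\<tau>. h (\<tau> j)) = av ?P (\<lambda>\<tau>. h (\<tau> i))" if j: "j \<in> {1..n}" for j
  proof -
    have "Transposition.transpose i j permutes {1..n}"
      using i j by (rule permutes_swap_id)
    then have "bij_betw (\<lambda>\<tau>. \<tau> \<circ> Transposition.transpose i j) ?P ?P"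
      by (intro bij_betwI [where g = "\<lambda>\<tau>. \<tau> \<circ> Transposition.transpose i j"])
        (simp_all add: comp_assoc permutes_compose Pi_iff)
    from av_reindex [OF this, of "\<lambda>\<tau>. h (\<tau> j)"] show ?thesis by simp
  qed
  have "av {1..n} (\<lambda>j. av ?P (\<lambda>\<tau>. h (\<tau> j))) = av {1..n} (\<lambda>_. av ?P (\<lambda>\<tau>. h (\<tau> i)))"
    by (rule av_cong) (rule eq)
  also have "\<dots> = av ?P (\<lambda>\<tau>. h (\<tau> i))"
    using i by (intro av_const) auto
  finally have "av ?P (\<lambda>\<tau>. h (\<tau> i)) = av {1..n} (\<lambda>j. av ?P (\<lambda>\<tau>. h (\<tau> j)))" ..
  also have "\<dots> = av ?P (\<lambda>\<tau>. av {1..n} (\<lambda>j. h (\<tau> j)))"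
    by (rule av_swap)
  also have "\<dots> = av ?P (\<lambda>_. av {1..n} h)"
    by (rule av_cong, rule av_reindex) (simp add: permutes_imp_bij)
  finally show ?thesis using fin by (simp add: av_const)
qed

text \<open>The letter 1 is set apart because a directed element acts as a directed element only
  below the vertex 1; below the others it acts as a rooted permutation.\<close>

lemma av_split_one:
  assumes "2 \<le> n"
  shows "av {1..n::nat} h = h 1 / real n + (\<Sum>u=2..n. h u) / real n"
proof -
  have "{1..n} = insert 1 {2..n}" using assms by auto
  then have "(\<Sum>u=1..n. h u) = h 1 + (\<Sum>u=2..n. h u)" by simp
  then show ?thesis by (simp add: av_def add_divide_distrib)
qed

section \<open>The action on the boundary\<close>

definition cn :: "nat \<Rightarrow> (nat \<Rightarrow> nat) \<Rightarrow> (nat \<Rightarrow> nat)" where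
  "cn t y = case_nat t y"

abbreviation (input) tail :: "(nat \<Rightarrow> 'a) \<Rightarrow> (nat \<Rightarrow> 'a)" where
  "tail x \<equiv> (\<lambda>i. x (Suc i))"

lemma cn_simps [simp]: "cn t y 0 = t" "cn t y (Suc i) = y i" "tail (cn t y) = y"
  by (simp_all add: cn_def)

lemma cn_collapse: "cn (x 0) (tail x) = x"
  by (auto simp: cn_def fun_eq_iff split: nat.split)

lemma cn_eq_iff: "cn t y = x \<longleftrightarrow> x 0 = t \<and> tail x = y"
  using cn_collapse [of x] by auto

lemma cn_upd [simp]: "(cn t y)(0 := u) = cn u y" "(cn t y)(Suc i := u) = cn t (y(i := u))"
  by (auto simp: cn_def fun_eq_iff split: nat.split)

lemma bd_cn: "cn t y \<in> bd d \<longleftrightarrow> t \<in> {1..d 0} \<and> y \<in> bd (tail d)"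
proof
  assume "cn t y \<in> bd d"
  then have *: "\<And>j. 1 \<le> cn t y j \<and> cn t y j \<le> d j" by (simp add: bd_def)
  show "t \<in> {1..d 0} \<and> y \<in> bd (tail d)"
    using *[of 0] *[of "Suc j" for j] by (auto simp: bd_def)
next
  assume "t \<in> {1..d 0} \<and> y \<in> bd (tail d)"
  then show "cn t y \<in> bd d" by (auto simp: bd_def cn_def split: nat.split)
qed

lemma bd_upd: "x \<in> bd d \<Longrightarrow> u \<in> {1..d i} \<Longrightarrow> x(i := u) \<in> bd d"
  by (auto simp: bd_def)

lemma ones_cn: "ones = cn 1 ones"
  by (auto simp: cn_def ones_def fun_eq_iff split: nat.split)

lemma hact_ones [simp]: "hact d \<pi> ones = ones"
  by (simp add: hact_def ones_def)

lemma hact_off: "x \<notin> bd d \<Longrightarrow> hact d \<pi> x = x"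
  by (simp add: hact_def)

lemma hact_first:
  assumes "x \<in> bd d" "x m \<noteq> 1" "\<And>i. i < m \<Longrightarrow> x i = 1"
  shows "hact d \<pi> x = x(Suc m := \<pi> (Suc m) (x m) (x (Suc m)))"
proof -
  have "(LEAST m. x m \<noteq> 1) = m"
    using assms by (intro Least_equality) (auto simp: not_less [symmetric])
  then show ?thesis using assms by (auto simp: hact_def Let_def)
qed

lemma first_non_one:
  assumes "x \<noteq> ones"
  obtains m where "x m \<noteq> 1" "\<And>i. i < m \<Longrightarrow> x i = 1"
proof -
  have "\<exists>m. x m \<noteq> 1" using assms by (auto simp: ones_def)
  then have "x (LEAST m. x m \<noteq> 1) \<noteq> 1" by (rule LeastI_ex)
  then show ?thesis by (rule that) (use not_less_Least in blast)
qed

text \<open>The case and the index \<open>m\<close> depend on \<open>x\<close> alone, so one case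
  distinction serves several families at once.\<close>

lemma hact_cases:
  obtains "x \<notin> bd d" "\<And>\<pi>. hact d \<pi> x = x"
  | "x = ones" "x \<in> bd d" "\<And>\<pi>. hact d \<pi> x = x"
  | m where "x \<in> bd d" "x m \<noteq> 1" "\<And>i. i < m \<Longrightarrow> x i = 1"
      "\<And>\<pi>. hact d \<pi> x = x(Suc m := \<pi> (Suc m) (x m) (x (Suc m)))"
proof (cases "x \<in> bd d \<and> x \<noteq> ones")
  case True
  then obtain m where "x m \<noteq> 1" "\<And>i. i < m \<Longrightarrow> x i = 1" using first_non_one by blast
  then show ?thesis using True hact_first that(3) by blast
next
  case False
  then show ?thesis using that(1,2) hact_off hact_ones by metis
qed

lemma Hfam_permutes:
  assumes "Hfam d \<pi>" "t \<in> {2..d l}"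
  shows "\<pi> (Suc l) t permutes {1..d (Suc l)}"
  using assms by (auto simp: Hfam_def)

lemma bd_two: "x \<in> bd d \<Longrightarrow> x m \<noteq> 1 \<Longrightarrow> x m \<in> {2..d m}"
proof -
  assume x: "x \<in> bd d" "x m \<noteq> 1"
  then have "1 \<le> x m \<and> x m \<le> d m" by (simp add: bd_def)
  then show ?thesis using x by auto
qed

lemma hact_bd:
  assumes "Hfam d \<pi>" "x \<in> bd d" shows "hact d \<pi> x \<in> bd d"
proof (cases d x rule: hact_cases)
  case (3 m)
  have "x (Suc m) \<in> {1..d (Suc m)}" using assms(2) by (simp add: bd_def)
  then have "\<pi> (Suc m) (x m) (x (Suc m)) \<in> {1..d (Suc m)}"
    using Hfam_permutes [OF assms(1) bd_two [OF 3(1,2)]] permutes_in_image by metis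
  then show ?thesis using bd_upd [OF assms(2)] unfolding 3(4) by blast
qed (use assms in auto)

text \<open>The first entry other than 1 is not moved, so the second family is read at the same
  \<open>m\<close> and \<open>x m\<close> as the first.\<close>

lemma hact_comp:
  assumes "Hfam d \<pi>1"
  shows "hact d \<pi>2 (hact d \<pi>1 x) = hact d (\<lambda>l t. \<pi>2 l t \<circ> \<pi>1 l t) x"
proof (cases d x rule: hact_cases)
  case (3 m)
  let ?x = "hact d \<pi>1 x"
  have x: "?x = x(Suc m := \<pi>1 (Suc m) (x m) (x (Suc m)))" by (rule 3(4))
  have "?x \<in> bd d" using hact_bd [OF assms 3(1)] .
  then have "hact d \<pi>2 ?x = ?x(Suc m := \<pi>2 (Suc m) (?x m) (?x (Suc m)))"
    by (rule hact_first) (use 3(2,3) x in simp_all)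
  then show ?thesis unfolding 3(4)[of "\<lambda>l t. \<pi>2 l t \<circ> \<pi>1 l t"] x by simp
qed auto

lemma hact_id: "hact d (\<lambda>l t. id) = id"
proof
  fix x show "hact d (\<lambda>l t. id) x = id x"
  proof (cases d x rule: hact_cases)
    case (3 m)
    show ?thesis by (simp add: 3(4))
  qed auto
qed

lemma hact_eq_ones_iff: "hact d \<pi> x = ones \<longleftrightarrow> x = ones"
proof (cases d x rule: hact_cases)
  case (3 m)
  have "hact d \<pi> x m \<noteq> 1" using 3(2) by (simp add: 3(4))
  then have "hact d \<pi> x \<noteq> ones" "x \<noteq> ones" using 3(2) by (metis ones_def)+
  then show ?thesis by simp
qed auto

text \<open>Together with \<open>hact_cn_other\<close> this recovers the recursive description of
  H_d from the flat family \<open>\<pi>\<close>.\<close>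

lemma hact_cn_one:
  assumes "1 \<le> d 0"
  shows "hact d \<pi> (cn 1 y) = cn 1 (hact (tail d) (\<lambda>l. \<pi> (Suc l)) y)"
proof (cases "tail d" y rule: hact_cases)
  case 1
  then show ?thesis by (simp add: hact_off bd_cn)
next
  case 2
  have "hact d \<pi> (cn 1 y) = cn 1 y"
    using hact_ones [of d \<pi>] unfolding 2(1) ones_cn [symmetric] .
  then show ?thesis by (simp only: 2(3))
next
  case (3 m)
  have "cn 1 y \<in> bd d" using 3(1) assms by (simp add: bd_cn)
  then have "hact d \<pi> (cn 1 y) = (cn 1 y)(Suc (Suc m) := \<pi> (Suc (Suc m)) (cn 1 y (Suc m)) (cn 1 y (Suc (Suc m))))"
    by (rule hact_first) (use 3(2,3) in \<open>auto simp: cn_def split: nat.split\<close>)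
  then show ?thesis unfolding 3(4) by simp
qed

lemma hact_cn_other:
  assumes "t \<in> {2..d 0}"
  shows "hact d \<pi> (cn t y) = cn t (rootact (tail d) (\<pi> 1 t) y)"
proof (cases "y \<in> bd (tail d)")
  case True
  have "cn t y \<in> bd d" using True assms by (simp add: bd_cn)
  then have "hact d \<pi> (cn t y) = (cn t y)(Suc 0 := \<pi> (Suc 0) (cn t y 0) (cn t y (Suc 0)))"
    by (rule hact_first) (use assms in auto)
  then show ?thesis using True by (simp add: rootact_def)
next
  case False
  then show ?thesis by (simp add: rootact_def hact_off bd_cn)
qed

lemma rootact_bd:
  assumes "\<tau> permutes {1..d 0}" "x \<in> bd d"
  shows "rootact d \<tau> x \<in> bd d"
proof -
  have "x 0 \<in> {1..d 0}" using assms(2) by (simp add: bd_def)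
  then have "\<tau> (x 0) \<in> {1..d 0}" using assms(1) permutes_in_image by metis
  then show ?thesis using assms bd_upd by (simp add: rootact_def)
qed

lemma rootact_comp:
  assumes "\<tau>1 permutes {1..d 0}"
  shows "rootact d \<tau>2 (rootact d \<tau>1 x) = rootact d (\<tau>2 \<circ> \<tau>1) x"
  using rootact_bd [of \<tau>1 d x, OF assms] by (auto simp: rootact_def)

lemma rootact_id: "rootact d id = id"
  by (auto simp: rootact_def fun_eq_iff)

lemma rootact_cn: "t \<in> {1..d 0} \<Longrightarrow> y \<in> bd (tail d) \<Longrightarrow> rootact d \<tau> (cn t y) = cn (\<tau> t) y"
  by (simp add: rootact_def bd_cn)

lemma rootact_off: "x \<notin> bd d \<Longrightarrow> rootact d \<tau> x = x"
  by (simp add: rootact_def)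

lemma rootact_bij:
  assumes "\<tau> permutes {1..d 0}"
  shows "bij (rootact d \<tau>)"
proof (rule o_bij)
  note p = permutes_inv [OF assms]
  show "rootact d (inv_into UNIV \<tau>) \<circ> rootact d \<tau> = id"
    using assms by (auto simp: fun_eq_iff rootact_comp permutes_inv_o rootact_id)
  show "rootact d \<tau> \<circ> rootact d (inv_into UNIV \<tau>) = id"
    using assms p by (auto simp: fun_eq_iff rootact_comp permutes_inv_o rootact_id)
qed

lemma hact_cong:
  assumes "\<And>l. \<pi> (Suc l) = \<pi>' (Suc l)"
  shows "hact d \<pi> = hact d \<pi>'"
  by (intro ext) (simp only: hact_def Let_def assms)

lemma Hfam_eqI:
  assumes fam: "Hfam d \<pi>" "Hfam d \<pi>'" and d: "\<And>j. 1 \<le> d j"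
    and eq: "\<And>x. hact d \<pi> x = hact d \<pi>' x"
  shows "\<pi> = \<pi>'"
proof -
  have "\<pi> l t u = \<pi>' l t u" for l t u
  proof (cases l)
    case 0
    then show ?thesis using fam by (simp add: Hfam_def)
  next
    case (Suc m)
    consider "t \<notin> {2..d m}" | "t \<in> {2..d m}" "u \<notin> {1..d l}" | "t \<in> {2..d m}" "u \<in> {1..d l}"
      by blast
    then show ?thesis
    proof cases
      case 1
      then show ?thesis using fam Suc by (simp add: Hfam_def)
    next
      case 2
      then show ?thesis
        using Hfam_permutes [OF fam(1) 2(1)] Hfam_permutes [OF fam(2) 2(1)] Suc
        by (metis permutes_not_in)
    next
      case 3
      \<comment> \<open>The image of the boundary point 1^m t u 1 1 ... displays the value
        \<open>\<pi> l t u\<close>.\<close>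
      define x where "x = ones(m := t, Suc m := u)"
      have x: "x m = t" "x (Suc m) = u" "\<And>i. i < m \<Longrightarrow> x i = 1"
        by (auto simp: x_def ones_def)
      have "x \<in> bd d"
        unfolding x_def using 3 Suc d by (intro bd_upd) (auto simp: bd_def ones_def)
      moreover have "x m \<noteq> 1" using x 3 by auto
      ultimately have "hact d \<rho> x = x(Suc m := \<rho> (Suc m) (x m) (x (Suc m)))" for \<rho>
        using x(3) by (rule hact_first)
      from this [of \<pi>] this [of \<pi>'] eq [of x] show ?thesis
        using x Suc by (metis fun_upd_same)
    qed
  qed
  then show ?thesis by blast
qed

section \<open>The ambient wreath product\<close>

definition wreath :: "('f, 'z) monoid_scheme \<Rightarrow> 'f welt monoid" where
  "wreath F = \<lparr>carrier = {a. (\<forall>x. fst a x \<in> carrier F) \<and> bij (snd a)}, mult = wmul F, one = wone F\<rparr>"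

lemma wreath_simps [simp]:
  "mult (wreath F) = wmul F" "one (wreath F) = wone F"
  "a \<in> carrier (wreath F) \<longleftrightarrow> (\<forall>x. fst a x \<in> carrier F) \<and> bij (snd a)"
  by (simp_all add: wreath_def)

lemma wreath_group:
  assumes "group F"
  shows "group (wreath F)"
proof -
  interpret F: group F by fact
  show ?thesis
  proof (rule groupI)
    fix a assume a: "a \<in> carrier (wreath F)"
    let ?g = "inv_into UNIV (snd a)"
    have g: "bij (snd a)" and f: "\<And>x. fst a x \<in> carrier F" using a by auto
    have "(\<lambda>x. m_inv F (fst a (?g x)), ?g) \<in> carrier (wreath F)"
      using f g by (auto intro: bij_imp_bij_inv)
    moreover have "wmul F (\<lambda>x. m_inv F (fst a (?g x)), ?g) a = wone F"
      using f bij_is_surj [OF g] by (auto simp: wmul_def wone_def fun_eq_iff surj_f_inv_f)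
    ultimately show "\<exists>b\<in>carrier (wreath F). b \<otimes>\<^bsub>wreath F\<^esub> a = \<one>\<^bsub>wreath F\<^esub>"
      by auto
  qed (auto simp: wmul_def wone_def fun_eq_iff F.m_assoc intro: bij_comp)
qed

definition sec :: "nat \<Rightarrow> 'f welt \<Rightarrow> 'f welt" where
  "sec t a = (\<lambda>y. fst a (cn t y), \<lambda>y. tail (snd a (cn t y)))"

text \<open>The continuation by ones is an arbitrary choice; \<open>splits\<close> says that every
  boundary continuation gives the same letter.\<close>

definition rt :: "nat \<Rightarrow> 'f welt \<Rightarrow> nat" where
  "rt t a = snd a (cn t ones) 0"

section \<open>Saturated directed groups\<close>

locale directed =
  fixes F :: "('f, 'z) monoid_scheme"
    and d :: "nat \<Rightarrow> nat"
    and H :: "(nat \<Rightarrow> nat \<Rightarrow> nat \<Rightarrow> nat) set"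
  assumes d_ge: "\<And>j. 2 \<le> d j"
    and d_bdd: "\<exists>B. \<forall>j. d j \<le> B"
    and F_group: "group F"
    and F_fin: "finite (carrier F)"
    and F_nontriv: "carrier F \<noteq> {\<one>\<^bsub>F\<^esub>}"
    and H_sub: "\<And>\<pi>. \<pi> \<in> H \<Longrightarrow> Hfam d \<pi>"
    and H_fin: "finite H"
    and H_one: "(\<lambda>l t. id) \<in> H"
    and H_mult: "\<And>\<pi>1 \<pi>2. \<pi>1 \<in> H \<Longrightarrow> \<pi>2 \<in> H \<Longrightarrow>
                   \<exists>\<pi>3\<in>H. \<forall>x. hact d \<pi>3 x = hact d \<pi>2 (hact d \<pi>1 x)"
    and H_unif: "\<And>l t. 1 \<le> l \<Longrightarrow> t \<in> {2..d (l - 1)} \<Longrightarrow>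
                   map_pmf (\<lambda>\<pi>. \<pi> l t) (pmf_of_set H) = pmf_of_set {\<sigma>. \<sigma> permutes {1..d l}}"
begin

sublocale F: group F by (rule F_group)

sublocale W: group "wreath F" by (rule wreath_group [OF F_group])

section \<open>The groups attached to the tails of the degree sequence\<close>

definition dl :: "nat \<Rightarrow> nat \<Rightarrow> nat" where
  "dl j = (\<lambda>i. d (j + i))"

text \<open>A plain shift would place the permutations of level \<open>j\<close> at index 0, where
  \<open>Hfam\<close> demands the identity.\<close>

definition sh :: "nat \<Rightarrow> (nat \<Rightarrow> nat \<Rightarrow> nat \<Rightarrow> nat) \<Rightarrow> (nat \<Rightarrow> nat \<Rightarrow> nat \<Rightarrow> nat)" where
  "sh j \<pi> = (\<lambda>l t. if l = 0 then id else \<pi> (j + l) t)"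

text \<open>The same index set serves every level, although \<open>K j\<close> forgets the first
  levels of a family and need not be injective. As \<open>K j\<close> is multiplicative, averages
  over \<open>I\<close> are uniform averages over its image, and multiplicities never have to be
  counted.\<close>

definition I :: "((nat \<Rightarrow> nat \<Rightarrow> nat \<Rightarrow> nat) \<times> 'f) set" where
  "I = H \<times> carrier F"

definition P :: "nat \<Rightarrow> (nat \<Rightarrow> nat) set" where
  "P j = {\<tau>. \<tau> permutes {1..d j}}"

definition R :: "nat \<Rightarrow> (nat \<Rightarrow> nat) \<Rightarrow> 'f welt" where
  "R j \<tau> = rootel F (dl j) \<tau>"

definition K :: "nat \<Rightarrow> (nat \<Rightarrow> nat \<Rightarrow> nat \<Rightarrow> nat) \<times> 'f \<Rightarrow> 'f welt" where
  "K j i = kel F (dl j) (sh j (fst i)) (snd i)"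

definition imul :: "(nat \<Rightarrow> nat \<Rightarrow> nat \<Rightarrow> nat) \<times> 'f \<Rightarrow> (nat \<Rightarrow> nat \<Rightarrow> nat \<Rightarrow> nat) \<times> 'f
    \<Rightarrow> (nat \<Rightarrow> nat \<Rightarrow> nat \<Rightarrow> nat) \<times> 'f" where
  "imul a b = (\<lambda>l t. fst b l t \<circ> fst a l t, snd a \<otimes>\<^bsub>F\<^esub> snd b)"

lemma dl_0 [simp]: "dl j 0 = d j" and dl_tail [simp]: "(\<lambda>i. dl j (Suc i)) = dl (Suc j)"
  and dl_zero: "dl 0 = d"
  by (simp_all add: dl_def)

lemma d_pos: "0 < d j" "1 \<le> d j" "Suc 0 \<le> d j"
  using d_ge [of j] by auto

lemma ones_bd [simp]: "ones \<in> bd (dl j)"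
  using d_pos by (simp add: bd_def ones_def dl_def)

lemma P_finite [simp]: "finite (P j)" and P_nonempty [simp]: "P j \<noteq> {}"
  and id_P [simp]: "id \<in> P j"
proof -
  show "finite (P j)" using finite_permutations [of "{1..d j}"] by (simp add: P_def)
  show "id \<in> P j" using permutes_id [of "{1..d j}"] by (simp add: P_def)
  then show "P j \<noteq> {}" by blast
qed

lemma I_finite [simp]: "finite I" and I_nonempty [simp]: "I \<noteq> {}"
  using H_fin F_fin H_one F.one_closed by (auto simp: I_def)

text \<open>\<open>H_mult\<close> only provides some family with the right action; since the action
  determines the family, it is the pointwise composite.\<close>

lemma H_comp:
  assumes "\<pi>1 \<in> H" "\<pi>2 \<in> H"
  shows "(\<lambda>l t. \<pi>2 l t \<circ> \<pi>1 l t) \<in> H"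
proof -
  obtain \<pi>3 where \<pi>3: "\<pi>3 \<in> H" "\<And>x. hact d \<pi>3 x = hact d \<pi>2 (hact d \<pi>1 x)"
    using H_mult [OF assms] by blast
  have "Hfam d (\<lambda>l t. \<pi>2 l t \<circ> \<pi>1 l t)"
    using H_sub [OF assms(1)] H_sub [OF assms(2)] by (auto simp: Hfam_def intro: permutes_compose)
  then have "\<pi>3 = (\<lambda>l t. \<pi>2 l t \<circ> \<pi>1 l t)"
    by (rule Hfam_eqI [OF H_sub [OF \<pi>3(1)]])
      (use d_pos \<pi>3(2) hact_comp [OF H_sub [OF assms(1)]] in simp_all)
  then show ?thesis using \<pi>3(1) by simp
qed

lemma H_bij: "\<pi> \<in> H \<Longrightarrow> bij (\<pi> l t)"
proof (cases l)
  case (Suc m)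
  assume "\<pi> \<in> H"
  then show ?thesis
    using H_sub [of \<pi>] Suc by (cases "t \<in> {2..d m}") (auto simp: Hfam_def intro: permutes_bij)
qed (use H_sub [of \<pi>] in \<open>auto simp: Hfam_def\<close>)

lemma imul_closed: "a \<in> I \<Longrightarrow> b \<in> I \<Longrightarrow> imul a b \<in> I"
  using H_comp by (auto simp: I_def imul_def)

text \<open>The source both of inverses and of the idempotence of averaging; finiteness of
  \<open>I\<close> turns injectivity into surjectivity.\<close>

lemma imul_bij:
  assumes a: "a \<in> I"
  shows "bij_betw (imul a) I I"
proof -
  have "inj_on (imul a) I"
  proof (rule inj_onI)
    fix b c assume bc: "b \<in> I" "c \<in> I" and eq: "imul a b = imul a c"
    have "fst b l t = fst c l t" for l t
    proof -
      have "fst b l t \<circ> fst a l t = fst c l t \<circ> fst a l t"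
        using eq by (metis (no_types, lifting) imul_def fst_conv)
      moreover have "surj (fst a l t)" using H_bij a by (auto simp: I_def bij_is_surj)
      ultimately show ?thesis by (metis surj_fun_eq)
    qed
    moreover have "snd b = snd c"
      using eq a bc by (auto simp: imul_def I_def)
    ultimately show "b = c" by (simp add: prod_eq_iff fun_eq_iff)
  qed
  moreover have "imul a ` I \<subseteq> I" using imul_closed a by blast
  ultimately show ?thesis
    by (simp add: bij_betw_def endo_inj_surj)
qed

definition ione :: "(nat \<Rightarrow> nat \<Rightarrow> nat \<Rightarrow> nat) \<times> 'f" where
  "ione = (\<lambda>l t. id, \<one>\<^bsub>F\<^esub>)"

lemma ione_I [simp]: "ione \<in> I"
  using H_one by (simp add: ione_def I_def)

lemma imul_inverse:
  assumes "a \<in> I"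
  obtains b where "b \<in> I" "imul a b = ione" "imul b a = ione"
proof -
  have "ione \<in> imul a ` I" using imul_bij [OF assms] by (simp add: bij_betw_def)
  then obtain b where b: "b \<in> I" "imul a b = ione" by auto
  have "fst a l t \<circ> fst b l t = id" for l t
  proof -
    have "fst b l t \<circ> fst a l t = id"
      using b(2) by (metis (no_types, lifting) imul_def ione_def fst_conv)
    then show ?thesis
      using H_bij [of "fst a" l t] assms bij_is_surj
      by (metis (no_types, lifting) I_def comp_assoc comp_id id_comp mem_Sigma_iff prod.collapse surj_fun_eq)
  qed
  moreover have "snd b \<otimes>\<^bsub>F\<^esub> snd a = \<one>\<^bsub>F\<^esub>"
    using b assms F.inv_comm by (auto simp: imul_def ione_def I_def)
  ultimately have "imul b a = ione" by (simp add: imul_def ione_def)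
  then show ?thesis using that b by blast
qed

lemma sh_fam: "\<pi> \<in> H \<Longrightarrow> Hfam (dl j) (sh j \<pi>)"
  using H_sub [of \<pi>] by (auto simp: Hfam_def sh_def dl_def)

lemma sh_zero: "\<pi> \<in> H \<Longrightarrow> sh 0 \<pi> = \<pi>"
  using H_sub [of \<pi>] by (auto simp: Hfam_def sh_def fun_eq_iff)

lemma K_eq:
  assumes "i \<in> I"
  shows "K j i = (\<lambda>x. if x = ones then snd i else \<one>\<^bsub>F\<^esub>, hact (dl j) (sh j (fst i)))"
  using assms by (auto simp: K_def kel_def wmul_def phi_def hact_eq_ones_iff I_def)

lemma R_eq: "R j \<tau> = (\<lambda>_. \<one>\<^bsub>F\<^esub>, rootact (dl j) \<tau>)"
  by (simp add: R_def rootel_def)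

lemma K_mult:
  assumes "a \<in> I" "b \<in> I"
  shows "wmul F (K j a) (K j b) = K j (imul a b)"
proof -
  have "hact (dl j) (sh j (fst b)) (hact (dl j) (sh j (fst a)) x)
      = hact (dl j) (sh j (\<lambda>l t. fst b l t \<circ> fst a l t)) x" for x
  proof -
    have "fst a \<in> H" using assms by (auto simp: I_def)
    from hact_comp [OF sh_fam [OF this]]
    have "hact (dl j) (sh j (fst b)) (hact (dl j) (sh j (fst a)) x)
        = hact (dl j) (\<lambda>l t. sh j (fst b) l t \<circ> sh j (fst a) l t) x" .
    also have "(\<lambda>l t. sh j (fst b) l t \<circ> sh j (fst a) l t) = sh j (\<lambda>l t. fst b l t \<circ> fst a l t)"
      by (simp add: sh_def fun_eq_iff)
    finally show ?thesis .
  qed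
  then show ?thesis
    using assms imul_closed [OF assms]
    by (auto simp: K_eq wmul_def imul_def o_def hact_eq_ones_iff I_def intro!: ext)
qed

lemma K_one: "K j ione = wone F"
proof -
  have "hact (dl j) (sh j (\<lambda>l t. id)) = id"
    by (subst hact_id [symmetric, of "dl j"], rule hact_cong) (simp add: sh_def)
  then show ?thesis by (simp add: K_eq) (auto simp: ione_def wone_def fun_eq_iff)
qed

lemma R_mult: "\<tau>1 \<in> P j \<Longrightarrow> wmul F (R j \<tau>1) (R j \<tau>2) = R j (\<tau>2 \<circ> \<tau>1)"
  by (auto simp: R_eq wmul_def fun_eq_iff P_def rootact_comp)

lemma R_one: "R j id = wone F"
  by (simp add: R_eq wone_def rootact_id)

lemma R_carrier [simp]: "\<tau> \<in> P j \<Longrightarrow> R j \<tau> \<in> carrier (wreath F)"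
  by (simp add: R_eq P_def rootact_bij)

text \<open>Bijectivity of the action comes from the inverse index, without inspecting
  \<open>hact\<close>.\<close>

lemma K_carrier [simp]:
  assumes "i \<in> I"
  shows "K j i \<in> carrier (wreath F)"
proof -
  obtain b where b: "b \<in> I" "imul i b = ione" "imul b i = ione"
    using imul_inverse [OF assms] by blast
  have "snd (K j b) \<circ> snd (K j i) = id" "snd (K j i) \<circ> snd (K j b) = id"
    using K_mult [OF assms b(1), of j] K_mult [OF b(1) assms, of j] b K_one [of j]
    by (simp_all add: wmul_def wone_def prod_eq_iff)
  then have "bij (snd (K j i))" by (rule o_bij)
  then show ?thesis using assms by (auto simp: K_eq I_def)
qed

lemma wmul_one [simp]:
  "g \<in> carrier (wreath F) \<Longrightarrow> wmul F g (wone F) = g"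
  "g \<in> carrier (wreath F) \<Longrightarrow> wmul F (wone F) g = g"
  using W.r_one [of g] W.l_one [of g] by simp_all

lemma wmul_carrier:
  "g \<in> carrier (wreath F) \<Longrightarrow> h \<in> carrier (wreath F) \<Longrightarrow> wmul F g h \<in> carrier (wreath F)"
  using W.m_closed [of g h] by simp

lemma wmul_assoc:
  "g \<in> carrier (wreath F) \<Longrightarrow> h \<in> carrier (wreath F) \<Longrightarrow> k \<in> carrier (wreath F)
    \<Longrightarrow> wmul F (wmul F g h) k = wmul F g (wmul F h k)"
  using W.m_assoc [of g h k] by simp

text \<open>The analogue of \<Gamma> for the tail of \<open>d\<close> from level \<open>j\<close>
  on. Only right multiplication is needed, as in the walk; the generators come from finite groups,
  so products already contain all inverses.\<close>

inductive_set G :: "nat \<Rightarrow> 'f welt set" for j where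
  G_one: "wone F \<in> G j"
| G_R: "g \<in> G j \<Longrightarrow> \<tau> \<in> P j \<Longrightarrow> wmul F g (R j \<tau>) \<in> G j"
| G_K: "g \<in> G j \<Longrightarrow> i \<in> I \<Longrightarrow> wmul F g (K j i) \<in> G j"

lemma G_carrier: "g \<in> G j \<Longrightarrow> g \<in> carrier (wreath F)"
proof (induction rule: G.induct)
  case G_one
  show ?case by (simp add: wone_def)
next
  case (G_R g \<tau>)
  then show ?case by (intro wmul_carrier R_carrier)
next
  case (G_K g i)
  then show ?case by (intro wmul_carrier K_carrier)
qed

lemma G_off:
  assumes "g \<in> G j" "x \<notin> bd (dl j)"
  shows "snd g x = x" "fst g x = \<one>\<^bsub>F\<^esub>"
proof -
  have [simp]: "x \<noteq> ones" using assms(2) by auto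
  have "snd g x = x \<and> fst g x = \<one>\<^bsub>F\<^esub>"
    using assms(1) assms(2) by (induction rule: G.induct) (auto simp: wone_def wmul_def R_eq K_eq rootact_off hact_off)
  then show "snd g x = x" "fst g x = \<one>\<^bsub>F\<^esub>" by auto
qed

lemma G_bd: "g \<in> G j \<Longrightarrow> x \<in> bd (dl j) \<Longrightarrow> snd g x \<in> bd (dl j)"
proof (induction rule: G.induct)
  case (G_R g \<tau>)
  then show ?case using rootact_bd [of \<tau> "dl j" "snd g x"] by (simp add: wmul_def R_eq P_def)
next
  case (G_K g i)
  then show ?case using hact_bd [of "dl j" _ "snd g x"] sh_fam by (auto simp: wmul_def K_eq I_def)
qed (simp add: wone_def)

text \<open>The decomposition \<open>g = (g_1, \<dots>, g_d)\<tau>\<close> restricted to one first-level vertex.\<close>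

definition splits :: "nat \<Rightarrow> nat \<Rightarrow> 'f welt \<Rightarrow> bool" where
  "splits j t g \<longleftrightarrow> rt t g \<in> {1..d j} \<and>
    (\<forall>y\<in>bd (dl (Suc j)). snd g (cn t y) = cn (rt t g) (snd (sec t g) y))"

lemma splits_R:
  assumes "splits j t g" "g \<in> G j" "\<tau> \<in> P j" "t \<in> {1..d j}"
  shows "splits j t (wmul F g (R j \<tau>))" "sec t (wmul F g (R j \<tau>)) = sec t g"
    "rt t (wmul F g (R j \<tau>)) = \<tau> (rt t g)"
proof -
  have sub: "snd (sec t g) y \<in> bd (dl (Suc j))" if "y \<in> bd (dl (Suc j))" for y
    using G_bd [OF assms(2), of "cn t y"] that assms(1,4) by (auto simp: splits_def bd_cn)
  have act: "snd (wmul F g (R j \<tau>)) (cn t y) = cn (\<tau> (rt t g)) (snd (sec t g) y)"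
    if "y \<in> bd (dl (Suc j))" for y
    using assms(1) that sub [OF that] by (simp add: splits_def wmul_def R_eq rootact_cn)
  show rt: "rt t (wmul F g (R j \<tau>)) = \<tau> (rt t g)"
    using act [of ones] by (simp add: rt_def)
  show sec: "sec t (wmul F g (R j \<tau>)) = sec t g"
  proof -
    have "fst g x \<in> carrier F" for x using G_carrier [OF assms(2)] by simp
    moreover have "tail (snd (wmul F g (R j \<tau>)) (cn t y)) = tail (snd g (cn t y))" for y
    proof (cases "y \<in> bd (dl (Suc j))")
      case True
      then show ?thesis using act [OF True] by (simp add: sec_def)
    next
      case False
      then have "cn t y \<notin> bd (dl j)" by (simp add: bd_cn)
      then show ?thesis using G_off [OF assms(2)] G_off [OF G_R [OF assms(2,3)]] by simp
    qed
    ultimately show ?thesis by (simp add: sec_def wmul_def R_eq)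
  qed
  have "\<tau> (rt t g) \<in> {1..d j}"
    using assms(1,3) permutes_in_image [of \<tau> "{1..d j}" "rt t g"] by (simp add: splits_def P_def)
  then show "splits j t (wmul F g (R j \<tau>))" using act rt sec by (simp add: splits_def)
qed

text \<open>What the section at a vertex is multiplied by when a directed element is applied while
  that vertex sits at \<open>r\<close>.\<close>

definition letter :: "nat \<Rightarrow> nat \<Rightarrow> (nat \<Rightarrow> nat \<Rightarrow> nat \<Rightarrow> nat) \<times> 'f \<Rightarrow> 'f welt" where
  "letter j r i = (if r = 1 then K (Suc j) i else R (Suc j) (fst i (Suc j) r))"

lemma K_cn:
  assumes "i \<in> I" "r \<in> {1..d j}"
  shows "snd (K j i) (cn r z) = cn r (snd (letter j r i) z)"
    "fst (K j i) (cn r z) = fst (letter j r i) z"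
proof -
  have "(\<lambda>l. sh j (fst i) (Suc l)) = (\<lambda>l. fst i (Suc j + l))" by (simp add: sh_def fun_eq_iff)
  \<comment> \<open>The two families differ at most at index 0, which \<open>hact\<close> never
    reads.\<close>
  then have "hact (dl (Suc j)) (\<lambda>l. sh j (fst i) (Suc l)) = hact (dl (Suc j)) (sh (Suc j) (fst i))"
    by (intro hact_cong) (simp add: sh_def)
  moreover have "r = 1 \<or> r \<in> {2..dl j 0}" using assms(2) by auto
  ultimately show "snd (K j i) (cn r z) = cn r (snd (letter j r i) z)"
    using hact_cn_one [of "dl j" "sh j (fst i)" z] hact_cn_other [of r "dl j" "sh j (fst i)" z] assms d_pos
    by (auto simp: K_eq letter_def R_eq sh_def)
  have "cn r z = ones \<longleftrightarrow> r = 1 \<and> z = ones" by (auto simp: cn_eq_iff ones_def)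
  then show "fst (K j i) (cn r z) = fst (letter j r i) z"
    using assms by (auto simp: K_eq letter_def R_eq)
qed

lemma splits_K:
  assumes "splits j t g" "g \<in> G j" "i \<in> I" "t \<in> {1..d j}"
  shows "splits j t (wmul F g (K j i))"
    "sec t (wmul F g (K j i)) = wmul F (sec t g) (letter j (rt t g) i)"
    "rt t (wmul F g (K j i)) = rt t g"
proof -
  have r: "rt t g \<in> {1..d j}" using assms(1) by (simp add: splits_def)
  have act: "snd (wmul F g (K j i)) (cn t y) = cn (rt t g) (snd (letter j (rt t g) i) (snd (sec t g) y))"
    if "y \<in> bd (dl (Suc j))" for y
    using assms(1) that K_cn [OF assms(3) r] by (simp add: splits_def wmul_def)
  show rt: "rt t (wmul F g (K j i)) = rt t g"
    using act [of ones] by (simp add: rt_def)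
  show sec: "sec t (wmul F g (K j i)) = wmul F (sec t g) (letter j (rt t g) i)"
  proof -
    have "fst (wmul F g (K j i)) (cn t y) = fst g (cn t y) \<otimes>\<^bsub>F\<^esub> fst (letter j (rt t g) i) (snd (sec t g) y)
      \<and> tail (snd (wmul F g (K j i)) (cn t y)) = snd (letter j (rt t g) i) (snd (sec t g) y)" for y
    proof (cases "y \<in> bd (dl (Suc j))")
      case True
      then show ?thesis using act [OF True] assms(1) K_cn [OF assms(3) r]
        by (simp add: splits_def wmul_def)
    next
      case False
      then have off: "cn t y \<notin> bd (dl j)" by (simp add: bd_cn)
      have "y \<noteq> ones" using False by auto
      then have "fst (letter j (rt t g) i) y = \<one>\<^bsub>F\<^esub>" "snd (letter j (rt t g) i) y = y"
        using False assms(3) by (auto simp: letter_def K_eq R_eq rootact_off hact_off)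
      moreover have "snd (sec t g) y = y" "fst g (cn t y) = \<one>\<^bsub>F\<^esub>"
        using G_off [OF assms(2) off] by (auto simp: sec_def)
      ultimately show ?thesis using G_off [OF G_K [OF assms(2,3)] off] by simp
    qed
    then show ?thesis by (simp add: sec_def wmul_def fun_eq_iff)
  qed
  show "splits j t (wmul F g (K j i))"
    using act r rt sec by (simp add: splits_def wmul_def)
qed

lemma splits_one: "t \<in> {1..d j} \<Longrightarrow> splits j t (wone F)" "sec t (wone F) = wone F" "rt t (wone F) = t"
  by (simp_all add: splits_def rt_def sec_def wone_def fun_eq_iff)

lemma letter_P: "i \<in> I \<Longrightarrow> r \<in> {2..d j} \<Longrightarrow> fst i (Suc j) r \<in> P (Suc j)"
  using H_sub [of "fst i"] by (auto simp: I_def P_def Hfam_def)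

lemma letter_G:
  assumes "g \<in> G (Suc j)" "i \<in> I" "r \<in> {1..d j}"
  shows "wmul F g (letter j r i) \<in> G (Suc j)"
proof (cases "r = 1")
  case False
  then have "r \<in> {2..d j}" using assms(3) by auto
  then show ?thesis using assms letter_P by (simp add: letter_def False G_R)
qed (use assms in \<open>simp add: letter_def G_K\<close>)

lemma G_splits:
  assumes "g \<in> G j" "t \<in> {1..d j}"
  shows "splits j t g \<and> sec t g \<in> G (Suc j)"
  using assms
proof (induction rule: G.induct)
  case G_one
  then show ?case by (simp add: splits_one G.G_one)
next
  case (G_R g \<tau>)
  then show ?case using splits_R by simp
next
  case (G_K g i)
  then have "rt t g \<in> {1..d j}" by (simp add: splits_def)
  then show ?case using G_K splits_K letter_G by simp
qed

lemma G_rt: "g \<in> G j \<Longrightarrow> t \<in> {1..d j} \<Longrightarrow> rt t g \<in> {1..d j}"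
  using G_splits by (simp add: splits_def)

lemma G_sec: "g \<in> G j \<Longrightarrow> t \<in> {1..d j} \<Longrightarrow> sec t g \<in> G (Suc j)"
  using G_splits by simp

lemma sec_R:
  assumes "g \<in> G j" "\<tau> \<in> P j" "t \<in> {1..d j}"
  shows "sec t (wmul F g (R j \<tau>)) = sec t g" "rt t (wmul F g (R j \<tau>)) = \<tau> (rt t g)"
  using splits_R [OF _ assms] G_splits [OF assms(1,3)] by simp_all

lemma sec_K:
  assumes "g \<in> G j" "i \<in> I" "t \<in> {1..d j}"
  shows "sec t (wmul F g (K j i)) = wmul F (sec t g) (letter j (rt t g) i)"
  using splits_K [OF _ assms] G_splits [OF assms(1,3)] by simp

text \<open>Off the boundary all elements of \<open>G j\<close> coincide, and a boundary point lies
  below exactly one first-level vertex. This makes the coding in \<open>exp_count\<close>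
  injective.\<close>

lemma G_eqI:
  assumes g: "g \<in> G j" "h \<in> G j"
    and eq: "\<And>t. t \<in> {1..d j} \<Longrightarrow> rt t g = rt t h \<and> sec t g = sec t h"
  shows "g = h"
proof -
  have "fst g x = fst h x \<and> snd g x = snd h x" for x
  proof (cases "x \<in> bd (dl j)")
    case True
    then have x: "x 0 \<in> {1..d j}" "tail x \<in> bd (dl (Suc j))" "cn (x 0) (tail x) = x"
      using bd_cn [of "x 0" "tail x" "dl j"] by (simp_all add: cn_collapse)
    have "fst g x = fst h x"
      using eq [OF x(1)] x(3) by (metis (no_types, lifting) fst_conv sec_def)
    moreover have "snd g (cn (x 0) (tail x)) = snd h (cn (x 0) (tail x))"
      using G_splits [OF g(1) x(1)] G_splits [OF g(2) x(1)] eq [OF x(1)] x(2) by (simp add: splits_def)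
    ultimately show ?thesis by (simp only: x(3))
  next
    case False
    then show ?thesis using G_off g by simp
  qed
  then show ?thesis by (simp add: prod_eq_iff fun_eq_iff)
qed


section \<open>A superharmonic length function\<close>

lemma av_P_point: "r \<in> {1..d j} \<Longrightarrow> av (P j) (\<lambda>\<tau>. h (\<tau> r)) = av {1..d j} h"
  unfolding P_def by (rule av_permutes_point)

lemma H_nonempty [simp]: "H \<noteq> {}"
  using H_one by auto

lemma av_I_fst: "av I (\<lambda>i. h (fst i)) = av H h"
proof -
  have "carrier F \<noteq> {}" using F.one_closed by blast
  then have "av (carrier F) (\<lambda>_. h a) = h a" for a using F_fin by (rule av_const [rotated])
  then show ?thesis by (simp add: I_def av_prod)
qed

text \<open>This is where saturation of \<open>H\<close> enters: away from 1, the letter passed to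
  the next level is a uniform rooted permutation.\<close>

lemma av_I_uniform:
  assumes "r \<in> {2..d j}"
  shows "av I (\<lambda>i. h (fst i (Suc j) r)) = av (P (Suc j)) h"
proof -
  have "av I (\<lambda>i. h (fst i (Suc j) r)) = av H (\<lambda>\<pi>. h (\<pi> (Suc j) r))"
    by (rule av_I_fst)
  also have "\<dots> = measure_pmf.expectation (map_pmf (\<lambda>\<pi>. \<pi> (Suc j) r) (pmf_of_set H)) h"
    using H_fin by (simp add: av_pmf_of_set)
  also have "map_pmf (\<lambda>\<pi>. \<pi> (Suc j) r) (pmf_of_set H) = pmf_of_set (P (Suc j))"
    using H_unif [of "Suc j" r] assms by (simp add: P_def)
  finally show ?thesis by (simp add: av_pmf_of_set)
qed

definition TK :: "nat \<Rightarrow> ('f welt \<Rightarrow> real) \<Rightarrow> 'f welt \<Rightarrow> real" where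
  "TK j \<phi> g = av I (\<lambda>i. \<phi> (wmul F g (K j i)))"

definition TS :: "nat \<Rightarrow> ('f welt \<Rightarrow> real) \<Rightarrow> 'f welt \<Rightarrow> real" where
  "TS j \<phi> g = av (P j) (\<lambda>\<tau>. \<phi> (wmul F g (R j \<tau>)))"

lemma av_letter:
  assumes "r \<in> {1..d j}"
  shows "av I (\<lambda>i. \<phi> (wmul F x (letter j r i))) = (if r = 1 then TK (Suc j) \<phi> x else TS (Suc j) \<phi> x)"
proof (cases "r = 1")
  case False
  then have "r \<in> {2..d j}" using assms by auto
  from av_I_uniform [OF this, of "\<lambda>\<tau>. \<phi> (wmul F x (R (Suc j) \<tau>))"] False
  show ?thesis by (simp add: letter_def TS_def)
qed (simp add: letter_def TK_def)

text \<open>Left translation by \<open>a\<close> permutes \<open>I\<close>, so the inner average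
  does not depend on \<open>a\<close>.\<close>

lemma TK_idem:
  assumes "x \<in> carrier (wreath F)"
  shows "TK j (TK j \<phi>) x = TK j \<phi> x"
proof -
  have "TK j (TK j \<phi>) x = av I (\<lambda>a. av I (\<lambda>b. \<phi> (wmul F x (K j (imul a b)))))"
    unfolding TK_def using assms
    by (intro av_cong) (simp only: wmul_assoc [OF assms K_carrier K_carrier] K_mult)
  also have "\<dots> = av I (\<lambda>a. av I (\<lambda>b. \<phi> (wmul F x (K j b))))"
    by (intro av_cong av_reindex [OF imul_bij, where h = "\<lambda>b. \<phi> (wmul F x (K j b))"])
  finally show ?thesis by (simp add: TK_def av_const)
qed

text \<open>Balls for the length that counts directed factors only. The identity is both a rooted
  and a directed factor, so products with fewer than \<open>m\<close> directed factors are
  included.\<close>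

primrec B :: "nat \<Rightarrow> nat \<Rightarrow> 'f welt set" where
  "B j 0 = R j ` P j"
| "B j (Suc m) = (\<lambda>(g, i, \<tau>). wmul F (wmul F g (K j i)) (R j \<tau>)) ` (B j m \<times> I \<times> P j)"

lemma B_carrier: "g \<in> B j m \<Longrightarrow> g \<in> carrier (wreath F)"
proof (induction m arbitrary: g)
  case 0
  then show ?case using R_carrier by auto
next
  case (Suc m)
  then obtain h i \<tau> where "h \<in> B j m" "i \<in> I" "\<tau> \<in> P j" "g = wmul F (wmul F h (K j i)) (R j \<tau>)"
    by auto
  then show ?case using Suc.IH by (simp only: wmul_carrier K_carrier R_carrier)
qed

lemma P_comp: "\<tau> \<in> P j \<Longrightarrow> \<tau>' \<in> P j \<Longrightarrow> \<tau>' \<circ> \<tau> \<in> P j"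
  by (simp add: P_def permutes_compose)

lemma B_R:
  assumes "g \<in> B j m" "\<tau> \<in> P j"
  shows "wmul F g (R j \<tau>) \<in> B j m"
proof (cases m)
  case 0
  then obtain \<tau>' where "\<tau>' \<in> P j" "g = R j \<tau>'" using assms by auto
  then show ?thesis using 0 assms(2) P_comp by (auto simp: R_mult)
next
  case (Suc n)
  then obtain h i \<tau>' where h: "h \<in> B j n" "i \<in> I" "\<tau>' \<in> P j" "g = wmul F (wmul F h (K j i)) (R j \<tau>')"
    using assms by auto
  have "wmul F g (R j \<tau>) = wmul F (wmul F h (K j i)) (R j (\<tau> \<circ> \<tau>'))"
    unfolding h(4) R_mult [OF h(3), symmetric]
    by (rule wmul_assoc [OF wmul_carrier [OF B_carrier [OF h(1)] K_carrier [OF h(2)]]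
          R_carrier [OF h(3)] R_carrier [OF assms(2)]])
  moreover have "(h, i, \<tau> \<circ> \<tau>') \<in> B j n \<times> I \<times> P j" using h(1,2) P_comp [OF h(3) assms(2)] by auto
  ultimately show ?thesis unfolding Suc B.simps by (intro image_eqI [where x = "(h, i, \<tau> \<circ> \<tau>')"]) simp_all
qed

lemma B_K:
  assumes "g \<in> B j m" "i \<in> I"
  shows "wmul F g (K j i) \<in> B j (Suc m)"
proof -
  have "wmul F g (K j i) = wmul F (wmul F g (K j i)) (R j id)"
    unfolding R_one
    by (rule wmul_one(1) [OF wmul_carrier [OF B_carrier [OF assms(1)] K_carrier [OF assms(2)]], symmetric])
  then show ?thesis using assms id_P by force
qed

lemma one_B: "wone F \<in> B j 0"
  using R_one [of j] id_P by (metis B.simps(1) image_eqI)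

lemma G_B: "g \<in> G j \<Longrightarrow> \<exists>m. g \<in> B j m"
proof (induction rule: G.induct)
  case G_one
  then show ?case using one_B by blast
qed (use B_R B_K in blast)+

lemma B_finite [simp]: "finite (B j m)"
  by (induction m) auto

lemma B_card: "real (card (B j m)) \<le> real (card (P j)) * (real (card I) * real (card (P j))) ^ m"
proof (induction m)
  case 0
  then show ?case using card_image_le [of "P j" "R j"] by simp
next
  case (Suc m)
  have "card (B j (Suc m)) \<le> card (B j m \<times> I \<times> P j)"
    unfolding B.simps by (intro card_image_le) auto
  then have "real (card (B j (Suc m))) \<le> real (card (B j m)) * (real (card I) * real (card (P j)))"
    by (simp add: card_cartesian_product flip: of_nat_mult)
  also have "\<dots> \<le> (real (card (P j)) * (real (card I) * real (card (P j))) ^ m) * (real (card I) * real (card (P j)))"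
    by (intro mult_right_mono Suc) auto
  finally show ?case by (simp add: mult_ac)
qed

text \<open>The weights are the probabilities of the two kinds of letter that a section receives.
  The number \<open>m\<close> of unfolded levels stays free and is matched to the number of steps at
  the end.\<close>

primrec len :: "nat \<Rightarrow> nat \<Rightarrow> 'f welt \<Rightarrow> real" where
  "len 0 j g = real (LEAST m. g \<in> B j m)"
| "len (Suc m) j g = (\<Sum>t=1..d j. (1 - 1 / real (d j)) * len m (Suc j) (sec t g)
      + 1 / real (d j) * TK (Suc j) (len m (Suc j)) (sec t g))"

lemma Least_B: "g \<in> G j \<Longrightarrow> g \<in> B j (LEAST m. g \<in> B j m)"
  using G_B by (rule LeastI_ex)

text \<open>A rooted factor on the right is absorbed by the last factor of a word, and further up it
  changes no section. The final letter of a step is thus invisible to the length.\<close>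

lemma len_R:
  assumes "g \<in> G j" "\<tau> \<in> P j"
  shows "len m j (wmul F g (R j \<tau>)) = len m j g"
proof (cases m)
  case 0
  have le: "(LEAST m. wmul F h (R j \<rho>) \<in> B j m) \<le> (LEAST m. h \<in> B j m)" if "h \<in> G j" "\<rho> \<in> P j" for h \<rho>
    by (rule Least_le) (rule B_R [OF Least_B [OF that(1)] that(2)])
  have inv: "inv_into UNIV \<tau> \<in> P j" using assms(2) by (simp add: P_def permutes_inv)
  have "wmul F (wmul F g (R j \<tau>)) (R j (inv_into UNIV \<tau>)) = wmul F g (R j (inv_into UNIV \<tau> \<circ> \<tau>))"
    unfolding R_mult [OF assms(2), symmetric]
    by (rule wmul_assoc [OF G_carrier [OF assms(1)] R_carrier [OF assms(2)] R_carrier [OF inv]])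
  also have "inv_into UNIV \<tau> \<circ> \<tau> = id" using assms(2) by (simp add: P_def permutes_inv_o)
  finally have "wmul F (wmul F g (R j \<tau>)) (R j (inv_into UNIV \<tau>)) = g"
    using wmul_one(1) [OF G_carrier [OF assms(1)]] by (simp only: R_one)
  then show ?thesis using le [OF assms] le [OF G_R [OF assms] inv] 0 by simp
next
  case (Suc n)
  then show ?thesis by (simp add: sec_R [OF assms])
qed

text \<open>Rate of growth: each of the \<open>d j\<close> sections contributes
  \<open>pp d j\<close> times the rate one level below.\<close>

primrec \<alpha> :: "nat \<Rightarrow> nat \<Rightarrow> real" where
  "\<alpha> 0 j = 1"
| "\<alpha> (Suc m) j = real (d j) * pp d j * \<alpha> m (Suc j)"

lemma \<alpha>_bounds: "0 \<le> \<alpha> m j" "\<alpha> m j \<le> 1"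
proof -
  have "0 \<le> \<alpha> m j \<and> \<alpha> m j \<le> 1"
  proof (induction m arbitrary: j)
    case (Suc m)
    have d: "real (d j) \<ge> 1" using d_pos(1) [of j] by simp
    have "real (d j) * pp d j = (real (d j) - 1) / real (d j)"
      using d by (simp add: pp_def power2_eq_square)
    then have "0 \<le> real (d j) * pp d j" "real (d j) * pp d j \<le> 1" using d by auto
    then show ?case using Suc [of "Suc j"] by (simp add: mult_le_one)
  qed simp
  then show "0 \<le> \<alpha> m j" "\<alpha> m j \<le> 1" by auto
qed

lemma TS_len: "x \<in> G j \<Longrightarrow> TS j (len m j) x = len m j x"
  unfolding TS_def by (subst av_cong [where g = "\<lambda>_. len m j x"]) (simp_all add: len_R av_const)

text \<open>Idempotence of \<open>TK\<close> sends the mixture \<open>(1 - q) len + q TK len\<close> to \<open>TK len\<close>; for \<open>q = 1/d_j\<close>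
  the weighted sum of the two averages below is therefore the mixture itself plus \<open>q (1 - q) a\<close>.\<close>

lemma mixture_TS:
  assumes "x \<in> G j" "0 \<le> q"
    and "TS j (TK j (len m j)) x \<le> len m j x + a"
  shows "TS j (\<lambda>y. (1 - q) * len m j y + q * TK j (len m j) y) x \<le> len m j x + q * a"
proof -
  have "TS j (\<lambda>y. (1 - q) * len m j y + q * TK j (len m j) y) x
      = (1 - q) * TS j (len m j) x + q * TS j (TK j (len m j)) x"
    by (simp add: TS_def av_add av_cmult)
  also have "\<dots> \<le> (1 - q) * len m j x + q * (len m j x + a)"
    using assms by (simp add: TS_len mult_left_mono)
  finally show ?thesis by (simp add: algebra_simps)
qed

lemma mixture_TK:
  assumes "x \<in> G j"
  shows "TK j (\<lambda>y. (1 - q) * len m j y + q * TK j (len m j) y) x = TK j (len m j) x"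
proof -
  have "TK j (\<lambda>y. (1 - q) * len m j y + q * TK j (len m j) y) x
      = (1 - q) * TK j (len m j) x + q * TK j (TK j (len m j)) x"
    by (simp add: TK_def av_add av_cmult)
  then show ?thesis using TK_idem [OF G_carrier [OF assms]] by (simp add: algebra_simps)
qed

lemma len_drift:
  assumes "g \<in> G j"
  shows "TS j (TK j (len m j)) g \<le> len m j g + \<alpha> m j"
  using assms
proof (induction m arbitrary: j g)
  case 0
  have K: "len 0 j (wmul F h (K j i)) \<le> len 0 j h + 1" if "h \<in> G j" "i \<in> I" for h i
  proof -
    have "(LEAST m. wmul F h (K j i) \<in> B j m) \<le> Suc (LEAST m. h \<in> B j m)"
      by (rule Least_le) (rule B_K [OF Least_B [OF that(1)] that(2)])
    then show ?thesis by simp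
  qed
  have "TK j (len 0 j) h \<le> len 0 j h + 1" if "h \<in> G j" for h
    using av_mono [of I "\<lambda>i. len 0 j (wmul F h (K j i))" "\<lambda>_. len 0 j h + 1"] K [OF that]
    by (simp add: TK_def av_const)
  then have "TS j (TK j (len 0 j)) g \<le> TS j (\<lambda>h. len 0 j h + 1) g"
    unfolding TS_def using 0 by (intro av_mono) (blast intro: G_R)
  also have "\<dots> = TS j (len 0 j) g + 1" by (simp add: TS_def av_add av_const)
  finally show ?case using TS_len [OF 0, of 0] by (simp del: len.simps)
next
  case (Suc m)
  let ?q = "1 / real (d j)"
  let ?\<psi> = "\<lambda>y. (1 - ?q) * len m (Suc j) y + ?q * TK (Suc j) (len m (Suc j)) y"
  let ?h = "\<lambda>t r. av I (\<lambda>i. ?\<psi> (wmul F (sec t g) (letter j r i)))"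
  have d: "real (d j) \<ge> 2" using d_ge [of j] by simp
  have "TS j (TK j (len (Suc m) j)) g
      = av (P j) (\<lambda>\<tau>. av I (\<lambda>i. \<Sum>t=1..d j. ?\<psi> (wmul F (sec t g) (letter j (\<tau> (rt t g)) i))))"
    unfolding TS_def TK_def [of j] len.simps
  proof (intro av_cong sum.cong refl)
    fix \<tau> i t assume *: "\<tau> \<in> P j" "i \<in> I" "t \<in> {1..d j}"
    have "sec t (wmul F (wmul F g (R j \<tau>)) (K j i)) = wmul F (sec t g) (letter j (\<tau> (rt t g)) i)"
      using sec_K [OF G_R [OF Suc.prems *(1)] *(2,3)] sec_R [OF Suc.prems *(1,3)] by simp
    then show "(1 - ?q) * len m (Suc j) (sec t (wmul F (wmul F g (R j \<tau>)) (K j i)))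
        + ?q * TK (Suc j) (len m (Suc j)) (sec t (wmul F (wmul F g (R j \<tau>)) (K j i)))
      = ?\<psi> (wmul F (sec t g) (letter j (\<tau> (rt t g)) i))" by simp
  qed
  \<comment> \<open>Linearity is enough: the sections at different vertices receive dependent
    letters.\<close>
  also have "\<dots> = (\<Sum>t=1..d j. av (P j) (\<lambda>\<tau>. ?h t (\<tau> (rt t g))))"
    by (simp only: av_sum)
  also have "\<dots> = (\<Sum>t=1..d j. av {1..d j} (?h t))"
    by (rule sum.cong [OF refl]) (rule av_P_point [OF G_rt [OF Suc.prems]])
  also have "\<dots> \<le> (\<Sum>t=1..d j. ?\<psi> (sec t g) + pp d j * \<alpha> m (Suc j))"
  proof (rule sum_mono)
    fix t assume t: "t \<in> {1..d j}"
    let ?x = "sec t g"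
    have x: "?x \<in> G (Suc j)" using G_sec [OF Suc.prems t] .
    have "av {1..d j} (?h t) = ?h t 1 / real (d j) + (\<Sum>u=2..d j. ?h t u) / real (d j)"
      by (rule av_split_one [OF d_ge])
    also have "?h t 1 = TK (Suc j) (len m (Suc j)) ?x"
      using av_letter [of 1 j ?\<psi> ?x] d_pos mixture_TK [OF x, of ?q m] by simp
    also have "(\<Sum>u=2..d j. ?h t u) = (\<Sum>u=2..d j. TS (Suc j) ?\<psi> ?x)"
      by (rule sum.cong [OF refl], subst av_letter) auto
    also have "\<dots> = (real (d j) - 1) * TS (Suc j) ?\<psi> ?x"
      using d_pos by (simp add: of_nat_diff)
    also have "TK (Suc j) (len m (Suc j)) ?x / real (d j) + (real (d j) - 1) * TS (Suc j) ?\<psi> ?x / real (d j)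
        \<le> TK (Suc j) (len m (Suc j)) ?x / real (d j)
          + (real (d j) - 1) * (len m (Suc j) ?x + ?q * \<alpha> m (Suc j)) / real (d j)"
      using d by (intro add_left_mono divide_right_mono mult_left_mono mixture_TS [OF x _ Suc.IH [OF x]]) auto
    also have "\<dots> = ?\<psi> ?x + pp d j * \<alpha> m (Suc j)"
      using d by (simp add: pp_def field_simps power2_eq_square)
    finally show "av {1..d j} (?h t) \<le> ?\<psi> ?x + pp d j * \<alpha> m (Suc j)" .
  qed
  also have "\<dots> = len (Suc m) j g + \<alpha> (Suc m) j"
    by (simp add: sum.distrib)
  finally show ?case .
qed

definition D :: "nat \<Rightarrow> nat \<Rightarrow> real" where
  "D m j = (\<Prod>i<m. real (d (j + i)))"

lemma D_0 [simp]: "D 0 j = 1" and D_Suc: "D (Suc m) j = real (d j) * D m (Suc j)"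
  by (simp_all add: D_def prod.lessThan_Suc_shift del: prod.lessThan_Suc)

lemma D_ge: "1 \<le> D m j"
  unfolding D_def using d_pos by (intro prod_ge_1) simp

text \<open>The length of the identity involves its K-average one level below, so the two are
  bounded together.\<close>

lemma len_one:
  "len m j (wone F) \<le> 2 * D m j - 1 \<and> TK j (len m j) (wone F) \<le> 2 * D m j - 1"
proof (induction m arbitrary: j)
  case 0
  have 1: "len 0 j (wone F) = 0" using one_B Least_eq_0 [of "\<lambda>m. wone F \<in> B j m"] by simp
  moreover have "TK j (len 0 j) (wone F) \<le> 1"
  proof -
    have "len 0 j (wmul F (wone F) (K j i)) \<le> 1" if "i \<in> I" for i
      using Least_le [of "\<lambda>m. wmul F (wone F) (K j i) \<in> B j m" 1] B_K [OF one_B that] by simp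
    then show ?thesis
      using av_mono [of I "\<lambda>i. len 0 j (wmul F (wone F) (K j i))" "\<lambda>_. 1"] by (simp add: TK_def av_const)
  qed
  ultimately show ?case by (simp del: len.simps)
next
  case (Suc m)
  let ?q = "1 / real (d j)"
  let ?M = "2 * D m (Suc j) - 1"
  let ?\<psi> = "\<lambda>y. (1 - ?q) * len m (Suc j) y + ?q * TK (Suc j) (len m (Suc j)) y"
  have d: "real (d j) \<ge> 2" using d_ge [of j] by simp
  have q: "0 \<le> ?q" "?q \<le> 1" using d by auto
  have M: "len m (Suc j) (wone F) \<le> ?M" "TK (Suc j) (len m (Suc j)) (wone F) \<le> ?M"
    using Suc [of "Suc j"] by auto
  have \<psi>1: "?\<psi> (wone F) \<le> ?M"
  proof -
    have "?\<psi> (wone F) \<le> (1 - ?q) * ?M + ?q * ?M"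
      by (intro add_mono mult_left_mono M) (use q in auto)
    then show ?thesis by (simp add: algebra_simps)
  qed
  \<comment> \<open>The -1 in the bound pays for ?q here: d (2 D' - 1 + 1/d) = 2 d D' - d + 1, and d
    >= 2.\<close>
  have *: "real (d j) * (?M + ?q) \<le> 2 * D (Suc m) j - 1"
    using d by (simp add: D_Suc field_simps)
  have "len (Suc m) j (wone F) = real (d j) * ?\<psi> (wone F)"
    by (simp add: splits_one)
  also have "\<dots> \<le> real (d j) * (?M + ?q)"
    by (rule mult_left_mono) (use \<psi>1 q in linarith, simp)
  finally have 1: "len (Suc m) j (wone F) \<le> 2 * D (Suc m) j - 1" using * by simp
  have "TK j (len (Suc m) j) (wone F) = av I (\<lambda>i. \<Sum>t=1..d j. ?\<psi> (wmul F (wone F) (letter j t i)))"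
    unfolding TK_def [of j] len.simps
    by (intro av_cong sum.cong refl) (simp add: sec_K [OF G_one] splits_one)
  also have "\<dots> = (\<Sum>t=1..d j. av I (\<lambda>i. ?\<psi> (wmul F (wone F) (letter j t i))))"
    by (rule av_sum)
  also have "\<dots> \<le> (\<Sum>t=1..d j. ?M + ?q)"
  proof (rule sum_mono)
    fix t assume t: "t \<in> {1..d j}"
    have "TS (Suc j) ?\<psi> (wone F) \<le> len m (Suc j) (wone F) + ?q * \<alpha> m (Suc j)"
      by (rule mixture_TS [OF G_one q(1) len_drift [OF G_one]])
    also have "\<dots> \<le> ?M + ?q * 1"
      by (intro add_mono mult_left_mono M \<alpha>_bounds q)
    finally have "TS (Suc j) ?\<psi> (wone F) \<le> ?M + ?q" by simp
    moreover have "TK (Suc j) ?\<psi> (wone F) \<le> ?M + ?q"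
      using mixture_TK [OF G_one, of "Suc j" ?q m] M(2) q(1) by linarith
    ultimately show "av I (\<lambda>i. ?\<psi> (wmul F (wone F) (letter j t i))) \<le> ?M + ?q"
      by (subst av_letter [OF t]) simp
  qed
  also have "\<dots> = real (d j) * (?M + ?q)" by simp
  finally show ?case using 1 * by linarith
qed

end

section \<open>Random words\<close>

definition words :: "'a set \<Rightarrow> nat \<Rightarrow> 'a list set" where
  "words Q n = {w. set w \<subseteq> Q \<and> length w = n}"

lemma words_finite: "finite Q \<Longrightarrow> finite (words Q n)"
  unfolding words_def by (rule finite_lists_length_eq)

lemma words_nonempty: "Q \<noteq> {} \<Longrightarrow> words Q n \<noteq> {}"
proof -
  assume "Q \<noteq> {}"
  then obtain q where "q \<in> Q" by blast
  then have "replicate n q \<in> words Q n" by (auto simp: words_def)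
  then show ?thesis by blast
qed

lemma words_subset: "w \<in> words Q n \<Longrightarrow> set w \<subseteq> Q"
  by (simp add: words_def)

lemma bij_words_Cons: "bij_betw (\<lambda>(q, w). q # w) (Q \<times> words Q n) (words Q (Suc n))"
  by (rule bij_betwI [where g = "\<lambda>w. (hd w, List.tl w)"]) (auto simp: words_def length_Suc_conv)

lemma bij_words_snoc: "bij_betw (\<lambda>(w, q). w @ [q]) (words Q n \<times> Q) (words Q (Suc n))"
  by (rule bij_betwI [where g = "\<lambda>w. (butlast w, last w)"])
    (auto simp: words_def length_Suc_conv_rev)

lemma av_words_0: "av (words Q 0) h = h []"
proof -
  have "words Q 0 = {[]}" by (auto simp: words_def)
  then show ?thesis by (simp add: av_def)
qed

lemma av_words_Cons: "av (words Q (Suc n)) h = av Q (\<lambda>q. av (words Q n) (\<lambda>w. h (q # w)))"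
  using av_reindex [OF bij_words_Cons [of Q n], of h] av_prod [of Q "words Q n" "\<lambda>p. h (fst p # snd p)"]
  by (simp add: case_prod_beta)

lemma av_words_snoc: "av (words Q (Suc n)) h = av (words Q n) (\<lambda>w. av Q (\<lambda>q. h (w @ [q])))"
  using av_reindex [OF bij_words_snoc [of Q n], of h] av_prod [of "words Q n" Q "\<lambda>p. h (fst p @ [snd p])"]
  by (simp add: case_prod_beta)

lemma av_words_append: "av (words Q (m + n)) h = av (words Q m) (\<lambda>u. av (words Q n) (\<lambda>w. h (u @ w)))"
  by (induction m arbitrary: h) (simp_all add: av_words_0 av_words_Cons)

lemma bind_pmf_of_set_Times:
  assumes "finite A" "A \<noteq> {}" "finite B" "B \<noteq> {}"
  shows "bind_pmf (pmf_of_set A) (\<lambda>a. bind_pmf (pmf_of_set B) (f a))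
    = bind_pmf (pmf_of_set (A \<times> B)) (\<lambda>(a, b). f a b)"
proof (rule pmf_eqI)
  fix x
  have "pmf (bind_pmf (pmf_of_set A) (\<lambda>a. bind_pmf (pmf_of_set B) (f a))) x
      = (\<Sum>a\<in>A. (\<Sum>b\<in>B. pmf (f a b) x) / real (card B)) / real (card A)"
    using assms by (simp add: pmf_bind_pmf_of_set)
  also have "\<dots> = (\<Sum>(a, b)\<in>A \<times> B. pmf (f a b) x) / real (card (A \<times> B))"
    by (simp add: sum_divide_distrib [symmetric] sum.cartesian_product card_cartesian_product mult.commute)
  also have "\<dots> = pmf (bind_pmf (pmf_of_set (A \<times> B)) (\<lambda>(a, b). f a b)) x"
    using assms by (simp add: pmf_bind_pmf_of_set case_prod_beta)
  finally show "pmf (bind_pmf (pmf_of_set A) (\<lambda>a. bind_pmf (pmf_of_set B) (f a))) x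
    = pmf (bind_pmf (pmf_of_set (A \<times> B)) (\<lambda>(a, b). f a b)) x" .
qed

lemma pmf_map_pmf_of_set:
  assumes "finite A" "A \<noteq> {}"
  shows "pmf (map_pmf f (pmf_of_set A)) x = av A (\<lambda>a. of_bool (f a = x))"
  using assms by (simp add: map_pmf_def pmf_bind_pmf_of_set av_def indicator_def)

context directed
begin

text \<open>Steps are kept as triples of factors, not as group elements: the walk becomes the image
  of a uniform word, and every probability a finite average.\<close>

definition Q :: "((nat \<Rightarrow> nat) \<times> ((nat \<Rightarrow> nat \<Rightarrow> nat \<Rightarrow> nat) \<times> 'f) \<times> (nat \<Rightarrow> nat)) set" where
  "Q = P 0 \<times> I \<times> P 0"

fun gen :: "(nat \<Rightarrow> nat) \<times> ((nat \<Rightarrow> nat \<Rightarrow> nat \<Rightarrow> nat) \<times> 'f) \<times> (nat \<Rightarrow> nat) \<Rightarrow> 'f welt" where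
  "gen (s, i, s') = wmul F (wmul F (R 0 s) (K 0 i)) (R 0 s')"

primrec ev :: "((nat \<Rightarrow> nat) \<times> ((nat \<Rightarrow> nat \<Rightarrow> nat \<Rightarrow> nat) \<times> 'f) \<times> (nat \<Rightarrow> nat)) list \<Rightarrow> 'f welt" where
  "ev [] = wone F"
| "ev (q # w) = wmul F (gen q) (ev w)"

lemma Q_finite [simp]: "finite Q" and Q_nonempty [simp]: "Q \<noteq> {}"
  by (simp_all add: Q_def)

lemma words_Q [simp]: "finite (words Q n)" "words Q n \<noteq> {}"
  by (simp_all add: words_finite words_nonempty)

lemma gen_carrier: "q \<in> Q \<Longrightarrow> gen q \<in> carrier (wreath F)"
  by (cases q) (auto simp only: Q_def gen.simps mem_Sigma_iff intro!: wmul_carrier R_carrier K_carrier)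

lemma one_carrier: "wone F \<in> carrier (wreath F)"
  using W.one_closed by (simp only: wreath_simps(2))

lemma ev_carrier: "set w \<subseteq> Q \<Longrightarrow> ev w \<in> carrier (wreath F)"
  by (induction w) (simp_all only: ev.simps one_carrier set_simps insert_subset wmul_carrier gen_carrier)

lemma ev_append: "set u \<subseteq> Q \<Longrightarrow> set w \<subseteq> Q \<Longrightarrow> ev (u @ w) = wmul F (ev u) (ev w)"
proof (induction u)
  case Nil
  then show ?case using wmul_one(2) [OF ev_carrier [of w]] by simp
next
  case (Cons q u)
  then show ?case using wmul_assoc [OF gen_carrier ev_carrier ev_carrier, of q u w] by simp
qed

lemma ev_snoc: "set w \<subseteq> Q \<Longrightarrow> q \<in> Q \<Longrightarrow> ev (w @ [q]) = wmul F (ev w) (gen q)"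
  using wmul_one(1) [OF gen_carrier, of q] by (simp add: ev_append)

lemma gen_G:
  assumes "g \<in> G 0" "q \<in> Q"
  shows "wmul F g (gen q) \<in> G 0"
    "q = (s, i, s') \<Longrightarrow> wmul F g (gen q) = wmul F (wmul F (wmul F g (R 0 s)) (K 0 i)) (R 0 s')"
proof -
  obtain s i s' where q: "q = (s, i, s')" by (cases q)
  have mem: "s \<in> P 0" "i \<in> I" "s' \<in> P 0" using assms(2) q by (auto simp: Q_def)
  note c = R_carrier [OF mem(1)] K_carrier [OF mem(2), of 0] R_carrier [OF mem(3)] G_carrier [OF assms(1)]
  have eq: "wmul F g (gen q) = wmul F (wmul F (wmul F g (R 0 s)) (K 0 i)) (R 0 s')"
    unfolding q gen.simps
    by (simp only: wmul_assoc [OF c(4) wmul_carrier [OF c(1,2)] c(3), symmetric] wmul_assoc [OF c(4,1,2)])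
  then show "wmul F g (gen q) \<in> G 0" using assms(1) mem by (simp only: G_R G_K)
  show "q = (s, i, s') \<Longrightarrow> wmul F g (gen q) = wmul F (wmul F (wmul F g (R 0 s)) (K 0 i)) (R 0 s')" for s i s'
    using eq q by simp
qed

lemma ev_G: "set w \<subseteq> Q \<Longrightarrow> ev w \<in> G 0"
  by (induction w rule: rev_induct) (auto simp: G_one ev_snoc gen_G(1))

lemma KR_zero: "i \<in> I \<Longrightarrow> K 0 i = kel F d (fst i) (snd i)" "R 0 \<tau> = rootel F d \<tau>"
  by (auto simp: I_def K_def R_def dl_zero sh_zero)

lemma mu_eq: "mu F d H = map_pmf gen (pmf_of_set Q)"
proof -
  have S: "Sroot d = P 0" by (simp add: Sroot_def P_def)
  have "mu F d H = bind_pmf (pmf_of_set (P 0)) (\<lambda>s. bind_pmf (pmf_of_set I) (\<lambda>i.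
      bind_pmf (pmf_of_set (P 0)) (\<lambda>s'. return_pmf (gen (s, i, s')))))"
    unfolding mu_def S I_def [symmetric] map_pmf_def
    by (intro bind_pmf_cong refl) (auto simp: KR_zero)
  also have "\<dots> = map_pmf gen (pmf_of_set Q)"
    by (simp add: bind_pmf_of_set_Times Q_def map_pmf_def split_def del: gen.simps)
  finally show ?thesis .
qed

lemma walk_eq: "walk F d H n = map_pmf ev (pmf_of_set (words Q n))"
proof (induction n)
  case 0
  have "words Q 0 = {[]}" by (auto simp: words_def)
  then show ?case by (simp add: pmf_of_set_singleton)
next
  case (Suc n)
  have "walk F d H (Suc n) = bind_pmf (pmf_of_set (words Q n)) (\<lambda>w. bind_pmf (pmf_of_set Q)
      (\<lambda>q. return_pmf (wmul F (ev w) (gen q))))"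
    by (simp add: Suc mu_eq map_pmf_def bind_assoc_pmf bind_return_pmf)
  also have "\<dots> = bind_pmf (pmf_of_set (words Q n)) (\<lambda>w. bind_pmf (pmf_of_set Q)
      (\<lambda>q. return_pmf (ev (w @ [q]))))"
    by (intro bind_pmf_cong refl) (simp add: words_subset ev_snoc)
  also have "\<dots> = map_pmf ev (map_pmf (\<lambda>(w, q). w @ [q]) (pmf_of_set (words Q n \<times> Q)))"
    by (simp add: bind_pmf_of_set_Times map_pmf_def bind_assoc_pmf bind_return_pmf split_def)
  also have "map_pmf (\<lambda>(w, q). w @ [q]) (pmf_of_set (words Q n \<times> Q)) = pmf_of_set (words Q (Suc n))"
    by (rule map_pmf_of_set_bij_betw [OF bij_words_snoc]) auto
  finally show ?case .
qed

definition pr :: "nat \<Rightarrow> 'f welt \<Rightarrow> real" where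
  "pr n g = av (words Q n) (\<lambda>w. of_bool (ev w = g))"

lemma pmf_walk: "pmf (walk F d H n) g = pr n g"
  by (simp add: walk_eq pmf_map_pmf_of_set pr_def)

lemma av_words_ev: "av (words Q n) (\<lambda>w. h (ev w)) = (\<Sum>g\<in>ev ` words Q n. pr n g * h g)"
proof -
  have "(\<Sum>w\<in>words Q n. h (ev w)) = (\<Sum>g\<in>ev ` words Q n. \<Sum>w | w \<in> words Q n \<and> ev w = g. h (ev w))"
    by (rule sum.image_gen) simp
  also have "\<dots> = (\<Sum>g\<in>ev ` words Q n. (\<Sum>w\<in>words Q n. of_bool (ev w = g)) * h g)"
  proof (rule sum.cong [OF refl])
    fix g
    have "(\<Sum>w | w \<in> words Q n \<and> ev w = g. h (ev w)) = (\<Sum>w | w \<in> words Q n \<and> ev w = g. h g)"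
      by (rule sum.cong) auto
    also have "\<dots> = (\<Sum>w\<in>words Q n. of_bool (ev w = g)) * h g"
      by (simp add: Int_def)
    finally show "(\<Sum>w | w \<in> words Q n \<and> ev w = g. h (ev w)) = (\<Sum>w\<in>words Q n. of_bool (ev w = g)) * h g" .
  qed
  finally show ?thesis by (simp add: av_def pr_def sum_divide_distrib)
qed

text \<open>By \<open>len_R\<close> the last rooted factor of a step drops out, so averaging over a
  step is \<open>TS\<close> applied to \<open>TK\<close> and \<open>len_drift\<close> gives the
  increment.\<close>

lemma expected_len: "av (words Q n) (\<lambda>w. len m 0 (ev w)) \<le> len m 0 (wone F) + real n * \<alpha> m 0"
proof (induction n)
  case 0
  show ?case by (simp add: av_words_0)
next
  case (Suc n)
  have step: "av Q (\<lambda>q. len m 0 (wmul F g (gen q))) \<le> len m 0 g + \<alpha> m 0" if g: "g \<in> G 0" for g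
  proof -
    have "len m 0 (wmul F g (gen (s, i, s'))) = len m 0 (wmul F (wmul F g (R 0 s)) (K 0 i))"
      if "s \<in> P 0" "i \<in> I" "s' \<in> P 0" for s i s'
      using gen_G(2) [OF g, of "(s, i, s')" s i s'] that g
      by (simp add: Q_def len_R G_R G_K)
    then have "av Q (\<lambda>q. len m 0 (wmul F g (gen q))) = TS 0 (TK 0 (len m 0)) g"
      unfolding Q_def av_prod TS_def TK_def
      by (intro av_cong) (simp add: av_const cong: av_cong)
    then show ?thesis using len_drift [OF g] by simp
  qed
  have "av (words Q (Suc n)) (\<lambda>w. len m 0 (ev w)) \<le> av (words Q n) (\<lambda>w. len m 0 (ev w) + \<alpha> m 0)"
    unfolding av_words_snoc
  proof (rule av_mono)
    fix w assume "w \<in> words Q n"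
    then have w: "set w \<subseteq> Q" by (simp add: words_def)
    have "av Q (\<lambda>q. len m 0 (ev (w @ [q]))) = av Q (\<lambda>q. len m 0 (wmul F (ev w) (gen q)))"
      by (rule av_cong) (simp add: ev_snoc w)
    then show "av Q (\<lambda>q. len m 0 (ev (w @ [q]))) \<le> len m 0 (ev w) + \<alpha> m 0"
      using step [OF ev_G [OF w]] by simp
  qed
  also have "\<dots> = av (words Q n) (\<lambda>w. len m 0 (ev w)) + \<alpha> m 0"
    by (simp add: av_add av_const)
  finally show ?case using Suc by (simp add: algebra_simps)
qed

section \<open>Symmetry of the step law\<close>

lemma P_inv:
  assumes "s \<in> P j"
  shows "inv_into UNIV s \<in> P j" "s \<circ> inv_into UNIV s = id" "inv_into UNIV (inv_into UNIV s) = s"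
  using assms by (simp_all add: P_def permutes_inv permutes_inv_o permutes_inv_inv)

lemma R_inv:
  assumes s: "s \<in> P j"
  shows "inv\<^bsub>wreath F\<^esub> (R j s) = R j (inv_into UNIV s)"
proof (rule W.inv_equality [OF _ R_carrier [OF s] R_carrier [OF P_inv(1) [OF s]]])
  show "R j (inv_into UNIV s) \<otimes>\<^bsub>wreath F\<^esub> R j s = \<one>\<^bsub>wreath F\<^esub>"
    by (simp only: wreath_simps R_mult [OF P_inv(1) [OF s]] P_inv(2) [OF s] R_one)
qed

definition iinv :: "(nat \<Rightarrow> nat \<Rightarrow> nat \<Rightarrow> nat) \<times> 'f \<Rightarrow> (nat \<Rightarrow> nat \<Rightarrow> nat \<Rightarrow> nat) \<times> 'f" where
  "iinv a = (SOME b. b \<in> I \<and> imul a b = ione \<and> imul b a = ione)"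

lemma iinv:
  assumes "a \<in> I"
  shows "iinv a \<in> I" "imul a (iinv a) = ione" "imul (iinv a) a = ione"
proof -
  have "\<exists>b. b \<in> I \<and> imul a b = ione \<and> imul b a = ione"
    by (rule imul_inverse [OF assms]) blast
  from someI_ex [OF this] show "iinv a \<in> I" "imul a (iinv a) = ione" "imul (iinv a) a = ione"
    by (simp_all only: iinv_def)
qed

lemma iinv_inj:
  assumes "a \<in> I" "b \<in> I" "iinv a = iinv b"
  shows "a = b"
proof (rule inj_onD [OF bij_betw_imp_inj_on [OF imul_bij [OF iinv(1) [OF assms(1)]]]])
  show "imul (iinv a) a = imul (iinv a) b"
    using iinv(3) [OF assms(1)] iinv(3) [OF assms(2)] by (simp only: assms(3))
qed (rule assms)+

lemma K_inv:
  assumes i: "i \<in> I"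
  shows "inv\<^bsub>wreath F\<^esub> (K j i) = K j (iinv i)"
proof (rule W.inv_equality [OF _ K_carrier [OF i] K_carrier [OF iinv(1) [OF i]]])
  show "K j (iinv i) \<otimes>\<^bsub>wreath F\<^esub> K j i = \<one>\<^bsub>wreath F\<^esub>"
    by (simp only: wreath_simps K_mult [OF iinv(1) [OF i] i] iinv(3) [OF i] K_one)
qed

text \<open>Inversion on triples: reversing a word and inverting each letter permutes
  \<open>words Q n\<close>, which gives the symmetry of the law of Y_n without counting
  representations of a group element.\<close>

definition qinv :: "(nat \<Rightarrow> nat) \<times> ((nat \<Rightarrow> nat \<Rightarrow> nat \<Rightarrow> nat) \<times> 'f) \<times> (nat \<Rightarrow> nat)
    \<Rightarrow> (nat \<Rightarrow> nat) \<times> ((nat \<Rightarrow> nat \<Rightarrow> nat \<Rightarrow> nat) \<times> 'f) \<times> (nat \<Rightarrow> nat)" where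
  "qinv = (\<lambda>(s, i, s'). (inv_into UNIV s', iinv i, inv_into UNIV s))"

lemma qinv_Q: "q \<in> Q \<Longrightarrow> qinv q \<in> Q"
  by (auto simp: qinv_def Q_def P_inv(1) iinv(1))

lemma qinv_inj: "inj_on qinv Q"
proof (rule inj_onI)
  fix p q assume pq: "p \<in> Q" "q \<in> Q" "qinv p = qinv q"
  obtain s i s' where p: "p = (s, i, s')" by (cases p)
  obtain t k t' where q: "q = (t, k, t')" by (cases q)
  have *: "iinv i = iinv k" "inv_into UNIV s = inv_into UNIV t" "inv_into UNIV s' = inv_into UNIV t'"
    and mem: "s \<in> P 0" "s' \<in> P 0" "t \<in> P 0" "t' \<in> P 0" "i \<in> I" "k \<in> I"
    using pq unfolding p q by (simp_all add: qinv_def Q_def)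
  have "i = k" by (rule iinv_inj [OF mem(5,6) *(1)])
  moreover have "s = t" using P_inv(3) [OF mem(1)] P_inv(3) [OF mem(3)] *(2) by argo
  moreover have "s' = t'" using P_inv(3) [OF mem(2)] P_inv(3) [OF mem(4)] *(3) by argo
  ultimately show "p = q" unfolding p q by blast
qed

lemma gen_qinv:
  assumes q: "q \<in> Q"
  shows "gen (qinv q) = inv\<^bsub>wreath F\<^esub> gen q"
proof -
  obtain s i s' where q': "q = (s, i, s')" by (cases q)
  have mem: "s \<in> P 0" "i \<in> I" "s' \<in> P 0" using q q' by (auto simp: Q_def)
  note c = R_carrier [OF mem(1)] K_carrier [OF mem(2), of 0] R_carrier [OF mem(3)]
  note c' = R_carrier [OF P_inv(1) [OF mem(1)]] K_carrier [OF iinv(1) [OF mem(2)], of 0]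
    R_carrier [OF P_inv(1) [OF mem(3)]]
  have "inv\<^bsub>wreath F\<^esub> (wmul F (wmul F (R 0 s) (K 0 i)) (R 0 s'))
      = wmul F (inv\<^bsub>wreath F\<^esub> (R 0 s')) (wmul F (inv\<^bsub>wreath F\<^esub> (K 0 i)) (inv\<^bsub>wreath F\<^esub> (R 0 s)))"
    using W.inv_mult_group [OF wmul_carrier [OF c(1,2)] c(3)] W.inv_mult_group [OF c(1,2)]
    by (simp only: wreath_simps(1))
  also have "\<dots> = gen (qinv q)"
    unfolding R_inv [OF mem(1)] R_inv [OF mem(3)] K_inv [OF mem(2)] q' qinv_def prod.case gen.simps
    by (rule wmul_assoc [OF c'(3,2,1), symmetric])
  finally show ?thesis unfolding q' gen.simps ..
qed

lemma ev_rev_qinv: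
  "set w \<subseteq> Q \<Longrightarrow> set (map qinv w) \<subseteq> Q \<and> ev (rev (map qinv w)) = inv\<^bsub>wreath F\<^esub> (ev w)"
proof (induction w)
  case Nil
  show ?case using W.inv_one by simp
next
  case (Cons q w)
  then have q: "q \<in> Q" and w: "set w \<subseteq> Q" by auto
  have IH: "set (map qinv w) \<subseteq> Q" "ev (rev (map qinv w)) = inv\<^bsub>wreath F\<^esub> (ev w)"
    using Cons.IH [OF w] by blast+
  have "ev (rev (map qinv w) @ [qinv q]) = wmul F (ev (rev (map qinv w))) (gen (qinv q))"
    by (rule ev_snoc) (use IH(1) qinv_Q [OF q] in simp_all)
  also have "\<dots> = inv\<^bsub>wreath F\<^esub> (ev (q # w))"
    using W.inv_mult_group [OF gen_carrier [OF q] ev_carrier [OF w]]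
    by (simp only: IH(2) gen_qinv [OF q] wreath_simps(1) ev.simps)
  finally show ?case using IH(1) qinv_Q [OF q] by simp
qed

lemma bij_rev_qinv: "bij_betw (\<lambda>w. rev (map qinv w)) (words Q n) (words Q n)"
proof -
  have "inj_on (\<lambda>w. rev (map qinv w)) (words Q n)"
  proof (rule inj_onI)
    fix u w assume "u \<in> words Q n" "w \<in> words Q n" "rev (map qinv u) = rev (map qinv w)"
    then show "u = w"
      using inj_on_map_eq_map [of qinv u w] inj_on_subset [OF qinv_inj, of "set u \<union> set w"]
      by (simp add: words_def)
  qed
  moreover have "(\<lambda>w. rev (map qinv w)) ` words Q n \<subseteq> words Q n"
  proof (rule image_subsetI)
    fix w assume "w \<in> words Q n"
    then show "rev (map qinv w) \<in> words Q n"
      using ev_rev_qinv [of w] by (simp add: words_def)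
  qed
  ultimately show ?thesis by (simp add: bij_betw_def endo_inj_surj)
qed

lemma pr_inv:
  assumes g: "g \<in> carrier (wreath F)"
  shows "pr n (inv\<^bsub>wreath F\<^esub> g) = pr n g"
proof -
  have "pr n (inv\<^bsub>wreath F\<^esub> g) = av (words Q n) (\<lambda>w. of_bool (ev (rev (map qinv w)) = inv\<^bsub>wreath F\<^esub> g))"
    unfolding pr_def by (rule av_reindex [OF bij_rev_qinv, symmetric])
  also have "\<dots> = pr n g"
    unfolding pr_def
  proof (rule av_cong)
    fix w assume "w \<in> words Q n"
    then have w: "set w \<subseteq> Q" by (simp add: words_def)
    have "inv\<^bsub>wreath F\<^esub> (ev w) = inv\<^bsub>wreath F\<^esub> g \<longleftrightarrow> ev w = g"
      using W.inv_inv [OF ev_carrier [OF w]] W.inv_inv [OF g] by metis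
    then show "(of_bool (ev (rev (map qinv w)) = inv\<^bsub>wreath F\<^esub> g) :: real) = of_bool (ev w = g)"
      using ev_rev_qinv [OF w] by simp
  qed
  finally show ?thesis .
qed

text \<open>A closed word is cut in the middle: the second half must represent the inverse of the
  first, which by symmetry has the same probability as the first.\<close>

lemma return_probability_double: "pr (n + n) (wone F) = (\<Sum>g\<in>ev ` words Q n. (pr n g)\<^sup>2)"
proof -
  have "pr (n + n) (wone F) = av (words Q n) (\<lambda>u. pr n (ev u))"
    unfolding pr_def [of "n + n"] av_words_append
  proof (rule av_cong)
    fix u assume "u \<in> words Q n"
    then have u: "set u \<subseteq> Q" by (simp add: words_def)
    have "av (words Q n) (\<lambda>w. of_bool (ev (u @ w) = wone F)) = pr n (inv\<^bsub>wreath F\<^esub> (ev u))"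
      unfolding pr_def
    proof (rule av_cong)
      fix w assume "w \<in> words Q n"
      then have w: "set w \<subseteq> Q" by (simp add: words_def)
      have "wmul F (ev u) (ev w) = wone F \<longleftrightarrow> ev w = inv\<^bsub>wreath F\<^esub> (ev u)"
        using W.inv_equality [OF _ ev_carrier [OF w] ev_carrier [OF u]] W.inv_inv [OF ev_carrier [OF w]]
          W.r_inv [OF ev_carrier [OF u]] unfolding wreath_simps by metis
      then show "(of_bool (ev (u @ w) = wone F) :: real) = of_bool (ev w = inv\<^bsub>wreath F\<^esub> (ev u))"
        by (simp add: ev_append u w)
    qed
    then show "av (words Q n) (\<lambda>w. of_bool (ev (u @ w) = wone F)) = pr n (ev u)"
      using pr_inv [OF ev_carrier [OF u]] by simp
  qed
  then show ?thesis by (simp add: av_words_ev power2_eq_square)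
qed


section \<open>Lower bound for the return probability\<close>

text \<open>At most N (|I| N)^k elements have length k, and c is chosen so that exp (- c) makes the
  series geometric with ratio 1/2.\<close>

lemma exp_count_base:
  assumes N: "real (card (P j)) \<le> N" and c: "2 * (real (card I) * N) \<le> exp c"
    and A: "finite A" "A \<subseteq> G j"
  shows "(\<Sum>g\<in>A. exp (- c * len 0 j g)) \<le> 2 * N"
proof -
  let ?L = "\<lambda>g. LEAST m. g \<in> B j m"
  let ?M = "Max (insert 0 (?L ` A))"
  have N0: "0 < N" using N card_gt_0_iff [of "P j"] by (simp add: less_le_trans)
  have I0: "0 < real (card I)" by (simp add: card_gt_0_iff)
  have "(\<Sum>g\<in>A. exp (- c * len 0 j g)) = (\<Sum>k\<le>?M. \<Sum>g | g \<in> A \<and> ?L g = k. exp (- c * len 0 j g))"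
    by (rule sum.group [symmetric]) (use A in auto)
  also have "\<dots> \<le> (\<Sum>k\<le>?M. N * (1 / 2) ^ k)"
  proof (rule sum_mono)
    fix k
    have "(\<Sum>g | g \<in> A \<and> ?L g = k. exp (- c * len 0 j g)) = real (card {g \<in> A. ?L g = k}) * exp (- c * real k)"
      by simp
    also have "\<dots> \<le> (N * (real (card I) * N) ^ k) * exp (- c * real k)"
    proof (rule mult_right_mono)
      have "{g \<in> A. ?L g = k} \<subseteq> B j k" using Least_B A by blast
      then have "real (card {g \<in> A. ?L g = k}) \<le> real (card (B j k))" by (simp add: card_mono)
      also have "\<dots> \<le> real (card (P j)) * (real (card I) * real (card (P j))) ^ k" by (rule B_card)
      also have "\<dots> \<le> N * (real (card I) * N) ^ k"
        using N N0 by (intro mult_mono power_mono mult_left_mono) auto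
      finally show "real (card {g \<in> A. ?L g = k}) \<le> N * (real (card I) * N) ^ k" .
    qed simp
    also have "\<dots> = N * ((real (card I) * N) * exp (- c)) ^ k"
      by (simp add: power_mult_distrib exp_of_nat_mult [symmetric] mult.commute)
    also have "\<dots> \<le> N * (1 / 2) ^ k"
    proof (intro mult_left_mono power_mono)
      show "real (card I) * N * exp (- c) \<le> 1 / 2"
        using c by (simp add: exp_minus field_simps)
    qed (use N0 I0 in auto)
    finally show "(\<Sum>g | g \<in> A \<and> ?L g = k. exp (- c * len 0 j g)) \<le> N * (1 / 2) ^ k" .
  qed
  also have "\<dots> = N * (\<Sum>k\<le>?M. (1 / 2) ^ k)" by (simp add: sum_distrib_left)
  also have "\<dots> \<le> N * 2"
  proof (rule mult_left_mono)
    have "(\<Sum>k\<le>M. (1 / 2) ^ k) = 2 - (1 / 2 :: real) ^ M" for M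
      by (induction M) auto
    then show "(\<Sum>k\<le>?M. (1 / 2) ^ k) \<le> (2 :: real)" by simp
  qed (use N0 in simp)
  finally show ?thesis by simp
qed

text \<open>Coding an element by the positions and sections of the first-level vertices bounds the
  sum by a power of a sum over sections. Jensen takes the mixture out of the exponential and turns
  the K-average into an average of sums over right translates. Right multiplication is injective and
  the claim is made for every finite set, so each translate satisfies the same bound and the
  averaging costs nothing.\<close>

lemma exp_count:
  assumes N: "\<And>j. real (card (P j)) \<le> N" and c: "2 * (real (card I) * N) \<le> exp c"
    and C: "2 * N \<le> exp C" "\<And>j. real (d j ^ d j) \<le> exp C"
    and A: "finite A" "A \<subseteq> G j"
  shows "(\<Sum>g\<in>A. exp (- c * len m j g)) \<le> exp (C * (2 * D m j - 1))"
  using A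
proof (induction m arbitrary: j A)
  case 0
  then show ?case using exp_count_base [OF N c] C(1) by fastforce
next
  case (Suc m)
  let ?q = "1 / real (d j)"
  let ?T = "{1..d j}"
  let ?\<psi> = "\<lambda>y. (1 - ?q) * len m (Suc j) y + ?q * TK (Suc j) (len m (Suc j)) y"
  let ?Z = "exp (C * (2 * D m (Suc j) - 1))"
  define A' where "A' = (\<Union>t\<in>?T. sec t ` A)"
  have A': "finite A'" "A' \<subseteq> G (Suc j)"
    using Suc.prems G_sec by (auto simp: A'_def)
  have d: "real (d j) \<ge> 2" using d_ge [of j] by simp
  have q: "0 \<le> ?q" "?q \<le> 1" using d by auto
  have \<psi>: "(\<Sum>x\<in>A'. exp (- c * ?\<psi> x)) \<le> ?Z"
  proof -
    have "exp (- c * ?\<psi> x) \<le> (1 - ?q) * exp (- c * len m (Suc j) x)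
        + ?q * av I (\<lambda>i. exp (- c * len m (Suc j) (wmul F x (K (Suc j) i))))" for x
    proof -
      have "exp (- c * ?\<psi> x) = exp ((1 - ?q) *\<^sub>R (- c * len m (Suc j) x) + ?q *\<^sub>R (- c * TK (Suc j) (len m (Suc j)) x))"
        by (simp add: algebra_simps)
      also have "\<dots> \<le> (1 - ?q) * exp (- c * len m (Suc j) x) + ?q * exp (- c * TK (Suc j) (len m (Suc j)) x)"
        using convex_onD [OF exp_convex q, of "- c * len m (Suc j) x" "- c * TK (Suc j) (len m (Suc j)) x"]
        by simp
      also have "\<dots> \<le> (1 - ?q) * exp (- c * len m (Suc j) x)
        + ?q * av I (\<lambda>i. exp (- c * len m (Suc j) (wmul F x (K (Suc j) i))))"
        using q unfolding TK_def by (intro add_left_mono mult_left_mono exp_av_le) auto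
      finally show ?thesis .
    qed
    then have "(\<Sum>x\<in>A'. exp (- c * ?\<psi> x)) \<le> (\<Sum>x\<in>A'. (1 - ?q) * exp (- c * len m (Suc j) x)
        + ?q * av I (\<lambda>i. exp (- c * len m (Suc j) (wmul F x (K (Suc j) i)))))"
      by (rule sum_mono)
    also have "\<dots> = (1 - ?q) * (\<Sum>x\<in>A'. exp (- c * len m (Suc j) x))
        + ?q * av I (\<lambda>i. \<Sum>x\<in>A'. exp (- c * len m (Suc j) (wmul F x (K (Suc j) i))))"
      by (simp add: sum.distrib sum_distrib_left [symmetric] sum_divide_distrib [symmetric] av_sum)
    also have "\<dots> \<le> (1 - ?q) * ?Z + ?q * av I (\<lambda>i. ?Z)"
    proof (intro add_mono mult_left_mono av_mono)
      show "(\<Sum>x\<in>A'. exp (- c * len m (Suc j) x)) \<le> ?Z" by (rule Suc.IH [OF A'])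
      fix i assume i: "i \<in> I"
      have "inj_on (\<lambda>x. wmul F x (K (Suc j) i)) A'"
        using W.right_cancel [OF K_carrier [OF i] G_carrier G_carrier] A' unfolding wreath_simps
        by (intro inj_onI) blast
      then have "(\<Sum>x\<in>A'. exp (- c * len m (Suc j) (wmul F x (K (Suc j) i))))
          = (\<Sum>x\<in>(\<lambda>x. wmul F x (K (Suc j) i)) ` A'. exp (- c * len m (Suc j) x))"
        by (simp add: sum.reindex)
      also have "\<dots> \<le> ?Z"
      proof (rule Suc.IH)
        show "(\<lambda>x. wmul F x (K (Suc j) i)) ` A' \<subseteq> G (Suc j)"
          by (rule image_subsetI) (use A' i G_K in blast)
      qed (use A' in simp)
      finally show "(\<Sum>x\<in>A'. exp (- c * len m (Suc j) (wmul F x (K (Suc j) i)))) \<le> ?Z" .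
    qed (use q in auto)
    also have "\<dots> = ?Z" by (simp add: av_const algebra_simps)
    finally show ?thesis .
  qed
  define code where "code g = (\<lambda>t\<in>?T. (rt t g, sec t g))" for g :: "'f welt"
  have inj: "inj_on code A"
  proof (rule inj_onI)
    fix g h assume gh: "g \<in> A" "h \<in> A" "code g = code h"
    have "rt t g = rt t h \<and> sec t g = sec t h" if "t \<in> ?T" for t
      using fun_cong [OF gh(3), of t] that by (simp add: code_def)
    then show "g = h" using G_eqI gh Suc.prems by blast
  qed
  have "(\<Sum>g\<in>A. exp (- c * len (Suc m) j g)) = (\<Sum>g\<in>A. \<Prod>t\<in>?T. exp (- c * ?\<psi> (snd (code g t))))"
  proof (rule sum.cong [OF refl])
    fix g
    have "exp (- c * len (Suc m) j g) = exp (\<Sum>t\<in>?T. - c * ?\<psi> (sec t g))"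
      unfolding len.simps sum_distrib_left ..
    also have "\<dots> = (\<Prod>t\<in>?T. exp (- c * ?\<psi> (sec t g)))" by (rule exp_sum) simp
    also have "\<dots> = (\<Prod>t\<in>?T. exp (- c * ?\<psi> (snd (code g t))))"
      by (rule prod.cong) (simp_all add: code_def)
    finally show "exp (- c * len (Suc m) j g) = (\<Prod>t\<in>?T. exp (- c * ?\<psi> (snd (code g t))))" .
  qed
  also have "\<dots> = (\<Sum>v\<in>code ` A. \<Prod>t\<in>?T. exp (- c * ?\<psi> (snd (v t))))"
    by (simp add: sum.reindex [OF inj])
  also have "\<dots> \<le> (\<Sum>v\<in>PiE ?T (\<lambda>_. ?T \<times> A'). \<Prod>t\<in>?T. exp (- c * ?\<psi> (snd (v t))))"
  proof (rule sum_mono2)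
    show "finite (PiE ?T (\<lambda>_. ?T \<times> A'))" using A' by (intro finite_PiE) auto
    have "rt t g \<in> ?T \<and> sec t g \<in> A'" if "g \<in> A" "t \<in> ?T" for g t
      using G_rt [of g j t] that Suc.prems by (auto simp: A'_def)
    then show "code ` A \<subseteq> PiE ?T (\<lambda>_. ?T \<times> A')" by (auto simp: code_def)
  qed (simp add: prod_nonneg)
  also have "\<dots> = (\<Prod>t\<in>?T. \<Sum>v\<in>?T \<times> A'. exp (- c * ?\<psi> (snd v)))"
    using A' by (intro prod_sum_PiE [symmetric]) auto
  also have "\<dots> = (real (d j) * (\<Sum>x\<in>A'. exp (- c * ?\<psi> x))) ^ d j"
    using sum.cartesian_product [of "\<lambda>_ x. exp (- c * ?\<psi> x)" A' ?T] by (simp add: case_prod_beta)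
  also have "\<dots> \<le> (real (d j) * ?Z) ^ d j"
    using \<psi> by (intro power_mono mult_left_mono mult_nonneg_nonneg sum_nonneg) auto
  also have "\<dots> \<le> exp C * ?Z ^ d j"
    using C(2) [of j] by (simp add: power_mult_distrib)
  also have "\<dots> = exp (C + real (d j) * (C * (2 * D m (Suc j) - 1)))"
    by (simp add: exp_add exp_of_nat_mult)
  \<comment> \<open>As in \<open>len_one\<close>, the -1 absorbs the additional \<open>C\<close> per
    level because d >= 2.\<close>
  also have "\<dots> \<le> exp (C * (2 * D (Suc m) j - 1))"
  proof -
    have "1 \<le> card (P j)" using card_gt_0_iff [of "P j"] by (simp add: Suc_le_eq)
    then have "1 \<le> exp C" using N [of j] C(1) by linarith
    then have "0 \<le> C" by simp
    then have "2 * C \<le> real (d j) * C" using d by (intro mult_right_mono)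
    then show ?thesis by (simp add: D_Suc algebra_simps)
  qed
  finally show ?case .
qed

lemma \<alpha>_eq: "\<alpha> m j = D m j * (\<Prod>i<m. pp d (j + i))"
  by (induction m arbitrary: j) (simp_all add: D_Suc prod.lessThan_Suc_shift del: prod.lessThan_Suc)

lemma pr_lower:
  assumes N: "\<And>j. real (card (P j)) \<le> N" and c: "2 * (real (card I) * N) \<le> exp c" "0 \<le> c"
    and C: "2 * N \<le> exp C" "\<And>j. real (d j ^ d j) \<le> exp C" "0 \<le> C"
    and n: "(\<Prod>i<m. pp d i) * real n \<le> 1"
  shows "exp (- (3 * c + 2 * C) * D m 0) \<le> pr (n + n) (wone F)"
proof -
  let ?A = "ev ` words Q n"
  let ?e = "\<lambda>g. exp (- (c / 2) * len m 0 g)"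
  have D: "1 \<le> D m 0" by (rule D_ge)
  have "av (words Q n) (\<lambda>w. len m 0 (ev w)) \<le> len m 0 (wone F) + real n * \<alpha> m 0"
    by (rule expected_len)
  also have "\<dots> \<le> 2 * D m 0 + D m 0 * ((\<Prod>i<m. pp d i) * real n)"
    using len_one [of m 0] by (simp add: \<alpha>_eq)
  \<comment> \<open>The start contributes 2 D and the n steps at most D, because n p_0 ... p_(m-1)
    <= 1.\<close>
  also have "\<dots> \<le> 3 * D m 0" using n D mult_left_mono [OF n, of "D m 0"] by simp
  finally have E: "av (words Q n) (\<lambda>w. len m 0 (ev w)) \<le> 3 * D m 0" .
  \<comment> \<open>Half of \<open>c\<close> is used so that the squared weight is the one summed in
    \<open>exp_count\<close>.\<close>
  have "exp (- (c / 2) * (3 * D m 0)) \<le> exp (- (c / 2) * av (words Q n) (\<lambda>w. len m 0 (ev w)))"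
    using mult_left_mono [OF E c(2)] by simp
  also have "\<dots> \<le> av (words Q n) (\<lambda>w. ?e (ev w))"
    by (rule exp_av_le) auto
  also have "\<dots> = (\<Sum>g\<in>?A. pr n g * ?e g)"
    by (rule av_words_ev)
  finally have "(exp (- (c / 2) * (3 * D m 0)))\<^sup>2 \<le> (\<Sum>g\<in>?A. pr n g * ?e g)\<^sup>2"
    by (rule power_mono) simp
  also have "\<dots> \<le> (\<Sum>g\<in>?A. (pr n g)\<^sup>2) * (\<Sum>g\<in>?A. (?e g)\<^sup>2)"
    by (rule Cauchy_Schwarz_ineq_sum)
  also have "(\<Sum>g\<in>?A. (?e g)\<^sup>2) = (\<Sum>g\<in>?A. exp (- c * len m 0 g))"
    by (simp add: exp_double [symmetric])
  also have "(\<Sum>g\<in>?A. (pr n g)\<^sup>2) * \<dots> \<le> (\<Sum>g\<in>?A. (pr n g)\<^sup>2) * exp (C * (2 * D m 0))"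
  proof (rule mult_left_mono)
    have "(\<Sum>g\<in>?A. exp (- c * len m 0 g)) \<le> exp (C * (2 * D m 0 - 1))"
    proof (rule exp_count [OF N c(1) C(1,2)])
      show "?A \<subseteq> G 0" by (rule image_subsetI) (rule ev_G [OF words_subset])
    qed simp
    also have "\<dots> \<le> exp (C * (2 * D m 0))" using C(3) by (simp add: algebra_simps)
    finally show "(\<Sum>g\<in>?A. exp (- c * len m 0 g)) \<le> exp (C * (2 * D m 0))" .
  qed (simp add: sum_nonneg)
  finally have "(exp (- (c / 2) * (3 * D m 0)))\<^sup>2 \<le> pr (n + n) (wone F) * exp (C * (2 * D m 0))"
    by (simp add: return_probability_double)
  also have "(exp (- (c / 2) * (3 * D m 0)))\<^sup>2 = exp (- (3 * c + 2 * C) * D m 0) * exp (C * (2 * D m 0))"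
    by (simp add: exp_double [symmetric] exp_add [symmetric] algebra_simps)
  finally show ?thesis by simp
qed

lemma pr_nonneg: "0 \<le> pr n g"
  by (simp add: pr_def av_def sum_nonneg)

text \<open>A trivial letter has probability at least 1/|Q|, so a return can be prolonged by one
  step. This reaches the odd times.\<close>

lemma pr_Suc: "pr n (wone F) / real (card Q) \<le> pr (Suc n) (wone F)"
proof -
  have "pr n (wone F) / real (card Q) = av Q (\<lambda>q. if q = (id, ione, id) then pr n (wone F) else 0)"
    by (simp add: av_def Q_def)
  also have "\<dots> \<le> av Q (\<lambda>q. av (words Q n) (\<lambda>w. of_bool (ev (q # w) = wone F)))"
  proof (rule av_mono)
    fix q assume "q \<in> Q"
    have gen: "gen (id, ione, id) = wone F"
      using wmul_one(1) [OF one_carrier] by (simp add: R_one K_one)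
    have "pr n (wone F) = av (words Q n) (\<lambda>w. of_bool (ev ((id, ione, id) # w) = wone F))"
      unfolding pr_def
    proof (rule av_cong)
      fix w assume "w \<in> words Q n"
      then have "wmul F (wone F) (ev w) = ev w" by (intro wmul_one(2) ev_carrier words_subset)
      then show "(of_bool (ev w = wone F) :: real) = of_bool (ev ((id, ione, id) # w) = wone F)"
        by (simp only: ev.simps gen)
    qed
    moreover have "0 \<le> av (words Q n) (\<lambda>w. of_bool (ev (q # w) = wone F))"
      by (simp add: av_def sum_nonneg)
    ultimately show "(if q = (id, ione, id) then pr n (wone F) else 0)
        \<le> av (words Q n) (\<lambda>w. of_bool (ev (q # w) = wone F))" by auto
  qed
  also have "\<dots> = pr (Suc n) (wone F)"
    unfolding pr_def by (rule av_words_Cons [symmetric])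
  finally show ?thesis .
qed

text \<open>Here \<open>m = k(n) + 1\<close>.\<close>

lemma return_probability_ge:
  "\<exists>C>0. \<forall>n m. (\<Prod>i<m. pp d i) * real n \<le> 1 \<longrightarrow> exp (- C * D m 0) \<le> pr n (wone F)"
proof -
  obtain b where b: "\<And>j. d j \<le> b" using d_bdd by blast
  \<comment> \<open>Boundedness of \<open>d\<close> makes all constants independent of the
    level.\<close>
  define N where "N = real (fact b)"
  have N: "real (card (P j)) \<le> N" for j
    using b [of j] by (simp add: N_def P_def card_permutations fact_mono)
  have "1 \<le> N" by (simp add: N_def)
  have I1: "1 \<le> real (card I)" using card_gt_0_iff [of I] by (simp add: Suc_le_eq)
  define c where "c = ln (2 * (real (card I) * N))"
  have *: "1 \<le> real (card I) * N" using I1 \<open>1 \<le> N\<close> mult_mono [of 1 _ 1 N] by simp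
  then have c: "2 * (real (card I) * N) \<le> exp c" "0 \<le> c" by (simp_all add: c_def)
  define C where "C = ln (2 * N + real (b ^ b))"
  have "1 \<le> b" using b [of 0] d_pos [of 0] by linarith
  have dd: "d j ^ d j \<le> b ^ b" for j
    by (rule order_trans [OF power_mono power_increasing]) (use b [of j] \<open>1 \<le> b\<close> in auto)
  have C: "2 * N \<le> exp C" "real (d j ^ d j) \<le> exp C" "0 \<le> C" for j
    using \<open>1 \<le> N\<close> dd [of j] by (simp_all add: C_def flip: of_nat_power)
  have Qp: "1 \<le> real (card Q)" using card_gt_0_iff [of Q] by (simp add: Suc_le_eq)
  \<comment> \<open>The first two terms are the cost in \<open>pr_lower\<close>, the logarithm pays
    for the extra step at odd times, and the 1 ensures positivity.\<close>
  define E where "E = 3 * c + 2 * C + ln (real (card Q)) + 1"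
  have "0 < E" using c C(3) Qp by (simp add: E_def add_nonneg_pos)
  moreover have "exp (- E * D m 0) \<le> pr n (wone F)" if n: "(\<Prod>i<m. pp d i) * real n \<le> 1" for n m
  proof -
    have p: "0 \<le> (\<Prod>i<m. pp d i)" using d_pos by (intro prod_nonneg) (simp add: pp_def)
    let ?h = "n div 2"
    have "(\<Prod>i<m. pp d i) * real ?h \<le> (\<Prod>i<m. pp d i) * real n"
      using p by (intro mult_left_mono) auto
    then have "(\<Prod>i<m. pp d i) * real ?h \<le> 1" using n by linarith
    then have ge: "exp (- (3 * c + 2 * C) * D m 0) \<le> pr (?h + ?h) (wone F)"
      by (rule pr_lower [OF N c C])
    have D: "1 \<le> D m 0" by (rule D_ge)
    have "ln (real (card Q)) \<le> (ln (real (card Q)) + 1) * D m 0"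
      using mult_mono [of "ln (real (card Q))" "ln (real (card Q)) + 1" 1 "D m 0"] D Qp by simp
    then have "- E * D m 0 \<le> - (3 * c + 2 * C) * D m 0 - ln (real (card Q))"
      by (simp add: E_def algebra_simps)
    then have "exp (- E * D m 0) \<le> exp (- (3 * c + 2 * C) * D m 0 - ln (real (card Q)))" by simp
    also have "\<dots> = exp (- (3 * c + 2 * C) * D m 0) / real (card Q)" using Qp by (simp add: exp_diff)
    also have "\<dots> \<le> pr (?h + ?h) (wone F) / real (card Q)"
      using ge by (intro divide_right_mono) auto
    also have "\<dots> \<le> pr n (wone F)"
    proof (cases "even n")
      case True
      then have "n = ?h + ?h" by presburger
      moreover have "pr (?h + ?h) (wone F) / real (card Q) \<le> pr (?h + ?h) (wone F)"
        using mult_left_mono [OF Qp pr_nonneg [of "?h + ?h" "wone F"]] Qp by (simp add: divide_le_eq)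
      ultimately show ?thesis by simp
    next
      case False
      then have "n = Suc (?h + ?h)" by presburger
      then show ?thesis using pr_Suc [of "?h + ?h"] by simp
    qed
    finally show ?thesis .
  qed
  ultimately show ?thesis by blast
qed

end

section \<open>Subtrees below 1^l and agreement to finite depth\<close>

definition pre :: "nat \<Rightarrow> (nat \<Rightarrow> nat) \<Rightarrow> bool" where
  "pre l x \<longleftrightarrow> (\<forall>i<l. x i = 1)"

lemma pre_cn: "pre (Suc l) (cn t y) \<longleftrightarrow> t = 1 \<and> pre l y"
  by (simp add: pre_def All_less_Suc2)

text \<open>Only the entry after the first one different from 1 can change, so a point can neither
  enter nor leave the subtree below 1^l.\<close>

lemma pre_hact: "pre l (hact d \<pi> x) \<longleftrightarrow> pre l x"
proof (cases d x rule: hact_cases)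
  case (3 m)
  show ?thesis
  proof (cases "m < l")
    case True
    moreover have "x m \<noteq> 1" "(x(Suc m := \<pi> (Suc m) (x m) (x (Suc m)))) m \<noteq> 1" using 3(2) by simp_all
    ultimately have "\<not> pre l x" "\<not> pre l (hact d \<pi> x)" unfolding 3(4) pre_def by blast+
    then show ?thesis by simp
  next
    case False
    then show ?thesis unfolding 3(4) by (simp add: pre_def)
  qed
qed simp_all

definition agree :: "nat \<Rightarrow> (nat \<Rightarrow> nat) \<Rightarrow> (nat \<Rightarrow> nat) \<Rightarrow> bool" where
  "agree l x y \<longleftrightarrow> (\<forall>i<l. x i = y i)"

lemma agree_rootact: "agree l x y \<Longrightarrow> x \<in> bd d \<Longrightarrow> y \<in> bd d \<Longrightarrow> agree l (rootact d \<tau> x) (rootact d \<tau> y)"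
  by (auto simp: agree_def rootact_def)

text \<open>If the common prefix consists of ones, neither point changes inside it. Otherwise the
  first entry other than 1 lies in the prefix, so both points are changed at the same place by the
  same permutation.\<close>

lemma agree_hact:
  assumes "agree l x y" "x \<in> bd d" "y \<in> bd d"
  shows "agree l (hact d \<pi> x) (hact d \<pi> y)"
proof -
  have pre: "agree l (hact d \<pi> z) z" if "pre l z" for z
  proof (cases d z rule: hact_cases)
    case (3 m)
    have "\<not> m < l" using that 3(2) by (auto simp: pre_def)
    then show ?thesis unfolding 3(4) by (simp add: agree_def)
  qed (simp_all add: agree_def)
  show ?thesis
  proof (cases "pre l x")
    case True
    moreover from this have "pre l y" using assms(1) by (auto simp: pre_def agree_def)
    ultimately show ?thesis using pre [of x] pre [of y] assms(1) by (simp add: agree_def)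
  next
    case False
    then have "x \<noteq> ones" by (auto simp: pre_def ones_def)
    then obtain m where m: "x m \<noteq> 1" "\<And>i. i < m \<Longrightarrow> x i = 1" using first_non_one by blast
    have "m < l"
    proof (rule ccontr)
      assume "\<not> m < l"
      then have "pre l x" using m(2) by (simp add: pre_def)
      then show False using False by simp
    qed
    have eq: "y i = x i" if "i < l" for i using assms(1) that by (simp add: agree_def)
    have y: "y m \<noteq> 1" "\<And>i. i < m \<Longrightarrow> y i = 1"
      using m eq \<open>m < l\<close> by simp_all
    have "hact d \<pi> x = x(Suc m := \<pi> (Suc m) (x m) (x (Suc m)))"
      by (rule hact_first [OF assms(2) m])
    moreover have "hact d \<pi> y = y(Suc m := \<pi> (Suc m) (y m) (y (Suc m)))"
      by (rule hact_first [OF assms(3) y])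
    ultimately show ?thesis unfolding agree_def using \<open>m < l\<close> eq by simp
  qed
qed

context directed
begin

section \<open>The orbit of a vertex\<close>

lemma K_snd: "i \<in> I \<Longrightarrow> snd (K j i) = hact (dl j) (sh j (fst i))"
  by (simp add: K_eq)

lemma R_snd: "snd (R j \<tau>) = rootact (dl j) \<tau>"
  by (simp add: R_eq)

lemma K_bd: "i \<in> I \<Longrightarrow> y \<in> bd (dl j) \<Longrightarrow> snd (K j i) y \<in> bd (dl j)"
  using hact_bd [OF sh_fam [of "fst i" j]] by (auto simp: K_snd I_def)

text \<open>The K-average killed below the vertex 1^l. For \<open>l\<close> = 0 every point is
  killed, which is why \<open>eta\<close> and \<open>hf\<close> start at 1.\<close>

definition kf :: "nat \<Rightarrow> nat \<Rightarrow> ((nat \<Rightarrow> nat) \<Rightarrow> real) \<Rightarrow> (nat \<Rightarrow> nat) \<Rightarrow> real" where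
  "kf l j f y = (if pre l y then 0 else av I (\<lambda>i. f (snd (K j i) y)))"

primrec eta :: "nat \<Rightarrow> nat \<Rightarrow> real" where
  "eta 0 j = 1"
| "eta (Suc l) j = pp d j * eta l (Suc j)"

text \<open>Without the factor containing \<open>eta\<close> this is q / (1 - q), the ratio of the
  weights in \<open>len\<close>; that factor corrects for the decay of the killed chain.\<close>

definition cc :: "nat \<Rightarrow> nat \<Rightarrow> real" where
  "cc l j = (1 / real (d j)) / ((1 - 1 / real (d j)) * (1 - 1 / real (d j) * eta l (Suc j)))"

text \<open>A supersolution for the killed chain. The weights are not normalised to sum 1:
  \<open>kf\<close> vanishes at killed points, and \<open>hf\<close> has to stay at least 1 to
  dominate the survival probability.\<close>

primrec hf :: "nat \<Rightarrow> nat \<Rightarrow> (nat \<Rightarrow> nat) \<Rightarrow> real" where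
  "hf 0 j x = 1"
| "hf (Suc l) j x = hf l (Suc j) (tail x) + cc l j * kf l (Suc j) (hf l (Suc j)) (tail x)"

lemma pp_eq: "pp d j = 1 / real (d j) * (1 - 1 / real (d j))"
  using d_pos(1) [of j] by (simp add: pp_def field_simps power2_eq_square)

lemma q_bounds: "0 < 1 / real (d j)" "1 / real (d j) \<le> 1 / 2"
  using d_ge [of j] by (auto simp: field_simps)

lemma pp_bounds: "0 < pp d j" "pp d j \<le> 1 / 4"
proof -
  let ?q = "1 / real (d j)"
  show "0 < pp d j" unfolding pp_eq using q_bounds [of j] by (intro mult_pos_pos) linarith+
  have "0 \<le> (1 / 2 - ?q)\<^sup>2" by simp
  then show "pp d j \<le> 1 / 4" unfolding pp_eq by (simp add: power2_eq_square algebra_simps)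
qed

lemma eta_bounds: "0 < eta l j" "eta l j \<le> 1"
proof -
  have "0 < eta l j \<and> eta l j \<le> 1"
  proof (induction l arbitrary: j)
    case (Suc l)
    have "pp d j * eta l (Suc j) \<le> 1 * 1"
      using Suc [of "Suc j"] pp_bounds [of j] by (intro mult_mono) auto
    then show ?case using Suc [of "Suc j"] pp_bounds [of j] by simp
  qed simp
  then show "0 < eta l j" "eta l j \<le> 1" by auto
qed

lemma eta_eq: "eta l j = (\<Prod>i<l. pp d (j + i))"
  by (induction l arbitrary: j) (simp_all add: prod.lessThan_Suc_shift del: prod.lessThan_Suc)

lemma cc_bounds: "0 \<le> cc l j" "cc l j \<le> 2"
proof -
  let ?q = "1 / real (d j)"
  note q = q_bounds [of j] and e = eta_bounds [of l "Suc j"]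
  have "?q * eta l (Suc j) \<le> 1 / 2 * 1" using q e by (intro mult_mono) auto
  then have *: "1 / 2 * (1 / 2) \<le> (1 - ?q) * (1 - ?q * eta l (Suc j))"
    using q by (intro mult_mono) auto
  then show "0 \<le> cc l j" unfolding cc_def using q by (intro divide_nonneg_nonneg) linarith+
  have "cc l j \<le> (1 / 2) / (1 / 2 * (1 / 2))"
    unfolding cc_def using q * by (intro frac_le) auto
  then show "cc l j \<le> 2" by simp
qed

text \<open>Killing does not disturb the idempotence of the average, since by
  \<open>pre_hact\<close> a directed element sends surviving points to surviving points.\<close>

lemma kf_idem:
  assumes "y \<in> bd (dl j)"
  shows "kf l j (kf l j f) y = kf l j f y"
proof (cases "pre l y")
  case False
  have "av I (\<lambda>a. kf l j f (snd (K j a) y)) = av I (\<lambda>a. av I (\<lambda>b. f (snd (K j (imul a b)) y)))"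
  proof (rule av_cong)
    fix a assume a: "a \<in> I"
    have "\<not> pre l (snd (K j a) y)" using False by (simp add: K_snd [OF a] pre_hact)
    moreover have "snd (K j b) (snd (K j a) y) = snd (K j (imul a b)) y" if "b \<in> I" for b
      unfolding K_mult [OF a that, symmetric] by (simp add: wmul_def)
    ultimately show "kf l j f (snd (K j a) y) = av I (\<lambda>b. f (snd (K j (imul a b)) y))"
      by (simp add: kf_def cong: av_cong)
  qed
  also have "\<dots> = av I (\<lambda>a. av I (\<lambda>b. f (snd (K j b) y)))"
    by (intro av_cong av_reindex [OF imul_bij, where h = "\<lambda>b. f (snd (K j b) y)"])
  finally show ?thesis using False by (simp add: kf_def av_const)
qed (simp add: kf_def)

lemma kf_mono:
  assumes "\<And>y. y \<in> bd (dl j) \<Longrightarrow> f y \<le> b" "0 \<le> b" "y \<in> bd (dl j)"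
  shows "kf l j f y \<le> b"
proof -
  have "av I (\<lambda>i. f (snd (K j i) y)) \<le> av I (\<lambda>_. b)"
    using assms K_bd by (intro av_mono) auto
  then show ?thesis using assms by (simp add: kf_def av_const)
qed

lemma kf_nonneg:
  assumes "\<And>y. y \<in> bd (dl j) \<Longrightarrow> 0 \<le> f y" "y \<in> bd (dl j)"
  shows "0 \<le> kf l j f y"
proof -
  have "av I (\<lambda>_. 0) \<le> av I (\<lambda>i. f (snd (K j i) y))"
    using assms K_bd by (intro av_mono) auto
  then show ?thesis by (simp add: kf_def av_const)
qed

lemma tail_bd: "x \<in> bd (dl j) \<Longrightarrow> tail x \<in> bd (dl (Suc j))"
  using bd_cn [of "x 0" "tail x" "dl j"] by (simp add: cn_collapse)

text \<open>The bound 2 on \<open>cc\<close> yields the factor 1 + 2 per level.\<close>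

lemma hf_bounds: "x \<in> bd (dl j) \<Longrightarrow> 1 \<le> hf l j x \<and> hf l j x \<le> 3 ^ l"
proof (induction l arbitrary: j x)
  case (Suc l)
  note y = tail_bd [OF Suc.prems]
  let ?k = "kf l (Suc j) (hf l (Suc j)) (tail x)"
  have k: "0 \<le> ?k" "?k \<le> 3 ^ l"
    using Suc.IH by (intro kf_nonneg kf_mono y; force)+
  have "0 \<le> cc l j * ?k" "cc l j * ?k \<le> 2 * 3 ^ l"
    using k cc_bounds [of l j] by (auto intro: mult_mono)
  then show ?case using Suc.IH [OF y] by simp
qed simp

lemma hf_R: "\<tau> \<in> P j \<Longrightarrow> x \<in> bd (dl j) \<Longrightarrow> hf l j (snd (R j \<tau>) x) = hf l j x"
  by (cases l) (simp_all add: R_snd rootact_def)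

text \<open>The recursion for \<open>hf\<close> is dictated by the two inequalities on \<open>cc\<close> here; the first is an equality.\<close>

lemma cc_ineqs:
  fixes j l
  defines "q \<equiv> 1 / real (d j)" and "\<eta> \<equiv> eta l (Suc j)"
  shows "q * (1 + cc l j) \<le> (1 - pp d j * \<eta>) * cc l j"
    "(1 - q) * (1 + cc l j * (1 - \<eta>)) \<le> 1 - pp d j * \<eta>"
proof -
  have q: "0 < q" "q \<le> 1 / 2" and \<eta>: "0 < \<eta>" "\<eta> \<le> 1"
    using q_bounds [of j] eta_bounds [of l "Suc j"] by (simp_all add: q_def \<eta>_def)
  have "q * \<eta> \<le> 1 / 2 * 1" using q \<eta> by (intro mult_mono) auto
  then have *: "0 < 1 - q * \<eta>" by simp
  have c: "cc l j * ((1 - q) * (1 - q * \<eta>)) = q"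
    using * q by (simp add: cc_def q_def [symmetric] \<eta>_def [symmetric])
  have p: "pp d j = q * (1 - q)" by (simp add: pp_eq q_def)
  have "(1 - pp d j * \<eta>) * cc l j = q * cc l j + cc l j * ((1 - q) * (1 - q * \<eta>))"
    unfolding p by (simp add: algebra_simps)
  then show "q * (1 + cc l j) \<le> (1 - pp d j * \<eta>) * cc l j"
    unfolding c by (simp add: algebra_simps)
  have "cc l j * (1 - q) * (1 - \<eta>) * (1 - q * \<eta>) = (cc l j * ((1 - q) * (1 - q * \<eta>))) * (1 - \<eta>)"
    by (simp only: mult_ac)
  also have "\<dots> = q * (1 - \<eta>)" by (simp only: c)
  also have "\<dots> \<le> q * (1 - (1 - q) * \<eta>) * (1 - q * \<eta>)"
  proof -
    have "q * (1 - (1 - q) * \<eta>) * (1 - q * \<eta>) - q * (1 - \<eta>) = q * q * (1 - q) * \<eta> * \<eta>"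
      by (simp add: algebra_simps)
    also have "\<dots> \<ge> 0" using q \<eta> by simp
    finally show ?thesis by simp
  qed
  finally have "cc l j * (1 - q) * (1 - \<eta>) \<le> q * (1 - (1 - q) * \<eta>)"
    using * by (rule mult_right_le_imp_le)
  then show "(1 - q) * (1 + cc l j * (1 - \<eta>)) \<le> 1 - pp d j * \<eta>"
    unfolding p by (simp add: algebra_simps)
qed

text \<open>With probability q the first coordinate is sent to 1; the tail then receives a directed
  letter and is killed one level further down. Otherwise it receives a rooted letter and nothing is
  killed. The coefficients of \<open>kf\<close> and of \<open>hf\<close> one level below are then
  compared separately by \<open>cc_ineqs\<close>.\<close>

lemma hf_drift:
  assumes "x \<in> bd (dl j)"
  shows "av (P j) (\<lambda>\<tau>. kf l j (hf l j) (snd (R j \<tau>) x)) \<le> (1 - eta l j) * hf l j x"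
  using assms
proof (induction l arbitrary: j x)
  case 0
  show ?case by (simp add: kf_def pre_def av_def)
next
  case (Suc l)
  let ?q = "1 / real (d j)"
  let ?\<eta> = "eta l (Suc j)"
  let ?f = "hf l (Suc j)"
  let ?c = "cc l j"
  let ?k = "kf l (Suc j) ?f"
  let ?g = "\<lambda>y. ?f y + ?c * ?k y"
  let ?y = "tail x"
  let ?h = "\<lambda>r. if pre (Suc l) (cn r ?y) then 0 else av I (\<lambda>i. ?g (snd (letter j r i) ?y))"
  note y = tail_bd [OF Suc.prems]
  have x0: "x 0 \<in> {1..d j}" using bd_cn [of "x 0" ?y "dl j"] Suc.prems by (simp add: cn_collapse)
  have d: "real (d j) \<ge> 2" using d_ge [of j] by simp
  have "av (P j) (\<lambda>\<tau>. kf (Suc l) j (hf (Suc l) j) (snd (R j \<tau>) x)) = av (P j) (\<lambda>\<tau>. ?h (\<tau> (x 0)))"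
  proof (rule av_cong)
    fix \<tau> assume \<tau>: "\<tau> \<in> P j"
    have r: "\<tau> (x 0) \<in> {1..d j}" using x0 \<tau> permutes_in_image [of \<tau> "{1..d j}" "x 0"] by (simp add: P_def)
    have "snd (R j \<tau>) x = cn (\<tau> (x 0)) ?y"
      using rootact_cn [of "x 0" "dl j" ?y \<tau>] x0 y by (simp add: R_snd cn_collapse)
    moreover have "hf (Suc l) j (snd (K j i) (cn (\<tau> (x 0)) ?y)) = ?g (snd (letter j (\<tau> (x 0)) i) ?y)" if "i \<in> I" for i
      using K_cn(1) [OF that r] by simp
    ultimately show "kf (Suc l) j (hf (Suc l) j) (snd (R j \<tau>) x) = ?h (\<tau> (x 0))"
      by (simp add: kf_def cong: av_cong)
  qed
  also have "\<dots> = av {1..d j} ?h" by (rule av_P_point [OF x0])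
  also have "\<dots> = ?h 1 / real (d j) + (\<Sum>u=2..d j. ?h u) / real (d j)"
    by (rule av_split_one [OF d_ge])
  also have "?h 1 = (1 + ?c) * ?k ?y"
  proof -
    have "?h 1 = kf l (Suc j) ?g ?y" by (simp add: pre_cn kf_def letter_def)
    also have "\<dots> = ?k ?y + ?c * kf l (Suc j) ?k ?y"
      by (simp add: kf_def av_add av_cmult)
    finally show ?thesis using kf_idem [OF y] by (simp add: algebra_simps)
  qed
  also have "(\<Sum>u=2..d j. ?h u) = (\<Sum>u=2..d j. av (P (Suc j)) (\<lambda>\<tau>. ?g (snd (R (Suc j) \<tau>) ?y)))"
  proof (rule sum.cong [OF refl])
    fix u assume u: "u \<in> {2..d j}"
    then show "?h u = av (P (Suc j)) (\<lambda>\<tau>. ?g (snd (R (Suc j) \<tau>) ?y))"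
      using av_I_uniform [OF u, of "\<lambda>\<tau>. ?g (snd (R (Suc j) \<tau>) ?y)"] by (simp add: pre_cn letter_def)
  qed
  also have "\<dots> = (real (d j) - 1) * av (P (Suc j)) (\<lambda>\<tau>. ?g (snd (R (Suc j) \<tau>) ?y))"
    using d_pos by (simp add: of_nat_diff)
  also have "av (P (Suc j)) (\<lambda>\<tau>. ?g (snd (R (Suc j) \<tau>) ?y))
      = ?f ?y + ?c * av (P (Suc j)) (\<lambda>\<tau>. ?k (snd (R (Suc j) \<tau>) ?y))"
  proof -
    have "av (P (Suc j)) (\<lambda>\<tau>. ?f (snd (R (Suc j) \<tau>) ?y)) = av (P (Suc j)) (\<lambda>\<tau>. ?f ?y)"
      by (rule av_cong) (rule hf_R [OF _ y])
    then show ?thesis by (simp add: av_add av_cmult av_const)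
  qed
  also have "(1 + ?c) * ?k ?y / real (d j)
        + (real (d j) - 1) * (?f ?y + ?c * av (P (Suc j)) (\<lambda>\<tau>. ?k (snd (R (Suc j) \<tau>) ?y))) / real (d j)
      \<le> (1 + ?c) * ?k ?y / real (d j)
        + (real (d j) - 1) * (?f ?y + ?c * ((1 - ?\<eta>) * ?f ?y)) / real (d j)"
    using d cc_bounds [of l j] Suc.IH [OF y]
    by (intro add_left_mono divide_right_mono mult_left_mono) auto
  also have "\<dots> = ?q * (1 + ?c) * ?k ?y + (1 - ?q) * (1 + ?c * (1 - ?\<eta>)) * ?f ?y"
    using d by (simp add: field_simps)
  also have "\<dots> \<le> (1 - pp d j * ?\<eta>) * ?c * ?k ?y + (1 - pp d j * ?\<eta>) * ?f ?y"
  proof (intro add_mono mult_right_mono cc_ineqs)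
    have "1 \<le> ?f z" if "z \<in> bd (dl (Suc j))" for z using hf_bounds [OF that] by simp
    then show "0 \<le> ?k ?y" "0 \<le> ?f ?y" using y by (force intro!: kf_nonneg)+
  qed
  also have "\<dots> = (1 - eta (Suc l) j) * hf (Suc l) j x"
    by (simp add: algebra_simps)
  finally show ?case .
qed


section \<open>Upper bound for the return probability\<close>

text \<open>Letters without their lamp, which \<open>mk\<close> restores: a word over
  \<open>T\<close> fixes the motion in the tree and leaves the lamps free.\<close>

definition T :: "((nat \<Rightarrow> nat) \<times> (nat \<Rightarrow> nat \<Rightarrow> nat \<Rightarrow> nat) \<times> (nat \<Rightarrow> nat)) set" where
  "T = P 0 \<times> H \<times> P 0"

fun sact :: "(nat \<Rightarrow> nat) \<times> (nat \<Rightarrow> nat \<Rightarrow> nat \<Rightarrow> nat) \<times> (nat \<Rightarrow> nat) \<Rightarrow> (nat \<Rightarrow> nat) \<Rightarrow> (nat \<Rightarrow> nat)" where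
  "sact (s, \<pi>, s') x = rootact d s' (hact d \<pi> (rootact d s x))"

text \<open>The step writes its lamp at the point that its first rooted factor sends to
  1^\<infinity>.\<close>

definition hit :: "(nat \<Rightarrow> nat) \<times> (nat \<Rightarrow> nat \<Rightarrow> nat \<Rightarrow> nat) \<times> (nat \<Rightarrow> nat) \<Rightarrow> (nat \<Rightarrow> nat) \<Rightarrow> bool" where
  "hit a x \<longleftrightarrow> rootact d (fst a) x = ones"

definition mk :: "(nat \<Rightarrow> nat) \<times> (nat \<Rightarrow> nat \<Rightarrow> nat \<Rightarrow> nat) \<times> (nat \<Rightarrow> nat) \<Rightarrow> 'f
    \<Rightarrow> (nat \<Rightarrow> nat) \<times> ((nat \<Rightarrow> nat \<Rightarrow> nat \<Rightarrow> nat) \<times> 'f) \<times> (nat \<Rightarrow> nat)" where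
  "mk a f = (fst a, (fst (snd a), f), snd (snd a))"

text \<open>The inverted orbit of \<open>1^\<infinity>\<close>: the boundary points whose trajectory passes through \<open>1^\<infinity>\<close>.\<close>

primrec vis :: "((nat \<Rightarrow> nat) \<times> (nat \<Rightarrow> nat \<Rightarrow> nat \<Rightarrow> nat) \<times> (nat \<Rightarrow> nat)) list \<Rightarrow> (nat \<Rightarrow> nat) set" where
  "vis [] = {}"
| "vis (a # u) = {x. hit a x} \<union> sact a -` vis u"

text \<open>The position is tested between the first rooted factor and the directed one, the moment
  at which a lamp is written.\<close>

primrec unv :: "nat \<Rightarrow> ((nat \<Rightarrow> nat) \<times> (nat \<Rightarrow> nat \<Rightarrow> nat \<Rightarrow> nat) \<times> (nat \<Rightarrow> nat)) list \<Rightarrow> (nat \<Rightarrow> nat) \<Rightarrow> bool" where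
  "unv l [] x = True"
| "unv l (a # u) x = (\<not> pre l (rootact d (fst a) x) \<and> unv l u (sact a x))"

lemma T_finite [simp]: "finite T" and T_nonempty [simp]: "T \<noteq> {}"
  using H_fin by (simp_all add: T_def)

lemma mk_Q: "a \<in> T \<Longrightarrow> f \<in> carrier F \<Longrightarrow> mk a f \<in> Q"
  by (auto simp: T_def Q_def I_def mk_def)

lemma gen_mk:
  assumes "a \<in> T" "f \<in> carrier F"
  shows "snd (gen (mk a f)) = sact a" "fst (gen (mk a f)) x = (if hit a x then f else \<one>\<^bsub>F\<^esub>)"
proof -
  obtain s \<pi> s' where a: "a = (s, \<pi>, s')" by (cases a)
  have i: "(\<pi>, f) \<in> I" and \<pi>: "\<pi> \<in> H" using assms a by (auto simp: T_def I_def)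
  show "snd (gen (mk a f)) = sact a"
    by (rule ext) (simp add: a mk_def wmul_def R_eq K_eq [OF i] dl_zero sh_zero [OF \<pi>])
  show "fst (gen (mk a f)) x = (if hit a x then f else \<one>\<^bsub>F\<^esub>)"
    using assms(2) by (simp add: a mk_def wmul_def R_eq K_eq [OF i] dl_zero hit_def)
qed

lemma sact_bij:
  assumes "a \<in> T"
  shows "bij (sact a)"
  using gen_carrier [OF mk_Q [OF assms F.one_closed]] gen_mk(1) [OF assms F.one_closed] by simp

lemma hit_unique:
  assumes "a \<in> T"
  obtains x0 where "{x. hit a x} = {x0}"
proof -
  have bij: "bij (rootact d (fst a))"
    using assms by (intro rootact_bij) (auto simp: T_def P_def)
  obtain x0 where x0: "ones = rootact d (fst a) x0" using bij_is_surj [OF bij] by (rule surjE)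
  have "hit a x \<longleftrightarrow> x = x0" for x
    unfolding hit_def x0 by (rule inj_eq [OF bij_is_inj [OF bij]])
  then have "{x. hit a x} = {x0}" by simp
  then show ?thesis by (rule that)
qed

lemma vis_finite: "set u \<subseteq> T \<Longrightarrow> finite (vis u)"
proof (induction u)
  case (Cons a u)
  then have a: "a \<in> T" by simp
  obtain x0 where "{x. hit a x} = {x0}" using hit_unique [OF a] .
  then show ?case using Cons sact_bij [OF a] by (simp add: finite_vimageI bij_is_inj)
qed simp

definition lamp :: "((nat \<Rightarrow> nat) \<times> (nat \<Rightarrow> nat \<Rightarrow> nat \<Rightarrow> nat) \<times> (nat \<Rightarrow> nat)) list \<Rightarrow> 'f list \<Rightarrow> (nat \<Rightarrow> nat) \<Rightarrow> 'f" where
  "lamp u fs = fst (ev (map2 mk u fs))"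

lemma lamp_Cons:
  assumes "a \<in> T" "f \<in> carrier F"
  shows "lamp (a # u) (f # fs) x = (if hit a x then f else \<one>\<^bsub>F\<^esub>) \<otimes>\<^bsub>F\<^esub> lamp u fs (sact a x)"
  using gen_mk [OF assms] by (simp add: lamp_def wmul_def)

lemma lamp_carrier:
  assumes "set u \<subseteq> T" "set fs \<subseteq> carrier F"
  shows "lamp u fs x \<in> carrier F"
proof -
  have "set (map2 mk u fs) \<subseteq> Q"
  proof
    fix q assume "q \<in> set (map2 mk u fs)"
    then obtain a f where "(a, f) \<in> set (zip u fs)" "q = mk a f" by auto
    then show "q \<in> Q" using assms mk_Q [of a f] set_zip_leftD [of a f u fs] set_zip_rightD [of a f u fs] by blast
  qed
  then show ?thesis using ev_carrier [of "map2 mk u fs"] by (simp add: lamp_def)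
qed

lemma lamp_off:
  assumes "u \<in> words T n" "fs \<in> words (carrier F) n" "y \<notin> vis u"
  shows "lamp u fs y = \<one>\<^bsub>F\<^esub>"
  using assms
proof (induction n arbitrary: u fs y)
  case 0
  then show ?case by (simp add: words_def lamp_def wone_def)
next
  case (Suc n)
  then obtain a u' f fs' where *: "u = a # u'" "fs = f # fs'" "a \<in> T" "f \<in> carrier F"
    "u' \<in> words T n" "fs' \<in> words (carrier F) n"
    by (auto simp: words_def length_Suc_conv)
  then show ?case using Suc.IH [OF *(5,6), of "sact a y"] Suc.prems(3) by (simp add: lamp_Cons)
qed

text \<open>Given the tree part of the walk, the lamps at the visited points are independent and uniform.\<close>

lemma lamp_count:
  assumes "u \<in> words T n"
  shows "card {fs \<in> words (carrier F) n. lamp u fs = \<phi>} * card (carrier F) ^ card (vis u) \<le> card (carrier F) ^ n"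
  using assms
proof (induction n arbitrary: u \<phi>)
  case 0
  have "{fs \<in> words (carrier F) 0. lamp u fs = \<phi>} \<subseteq> {[]}" by (auto simp: words_def)
  then have "card {fs \<in> words (carrier F) 0. lamp u fs = \<phi>} \<le> card {[] :: 'f list}" by (intro card_mono) auto
  then show ?case using 0 by (simp add: words_def)
next
  case (Suc n)
  then obtain a v where u: "u = a # v" and a: "a \<in> T" and v: "v \<in> words T n"
    by (auto simp: words_def length_Suc_conv)
  obtain x0 where x0: "{x. hit a x} = {x0}" using hit_unique [OF a] .
  have vT: "set v \<subseteq> T" using v by (rule words_subset)
  define k where "k = card (carrier F)"
  \<comment> \<open>The configuration that the remaining steps must produce once the first lamp is
    \<open>f\<close>; this forces the induction to run over all \<open>\<phi>\<close>.\<close>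
  define \<psi> where "\<psi> f y = m_inv F (if hit a (inv_into UNIV (sact a) y) then f else \<one>\<^bsub>F\<^esub>) \<otimes>\<^bsub>F\<^esub> \<phi> (inv_into UNIV (sact a) y)" for f y
  define S where "S \<theta> = {fs \<in> words (carrier F) n. lamp v fs = \<theta>}" for \<theta>
  have finS: "finite (S \<theta>)" for \<theta> using words_finite [OF F_fin] by (simp add: S_def)
  have dec: "\<exists>f fs. w = f # fs \<and> f \<in> carrier F \<and> fs \<in> S (\<psi> f) \<and> (sact a x0 \<notin> vis v \<longrightarrow> f = \<phi> x0)"
    if "w \<in> {fs \<in> words (carrier F) (Suc n). lamp u fs = \<phi>}" for w
  proof -
    from that obtain f fs where w: "w = f # fs" "f \<in> carrier F" "fs \<in> words (carrier F) n" "lamp u (f # fs) = \<phi>"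
      by (auto simp: words_def length_Suc_conv)
    have fs: "set fs \<subseteq> carrier F" using w(3) by (rule words_subset)
    have eq: "\<phi> x = (if hit a x then f else \<one>\<^bsub>F\<^esub>) \<otimes>\<^bsub>F\<^esub> lamp v fs (sact a x)" for x
      unfolding w(4) [symmetric] u by (rule lamp_Cons [OF a w(2)])
    have "lamp v fs y = \<psi> f y" for y
    proof -
      have "sact a (inv_into UNIV (sact a) y) = y" using sact_bij [OF a] by (simp add: bij_is_surj surj_f_inv_f)
      moreover have "m_inv F h \<otimes>\<^bsub>F\<^esub> (h \<otimes>\<^bsub>F\<^esub> lamp v fs y) = lamp v fs y" if "h \<in> carrier F" for h
        unfolding F.m_assoc [OF F.inv_closed [OF that] that lamp_carrier [OF vT fs], symmetric] F.l_inv [OF that]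
        by (rule F.l_one [OF lamp_carrier [OF vT fs]])
      ultimately show ?thesis
        unfolding \<psi>_def eq using w(2) by (simp only: F.one_closed split: if_split) simp
    qed
    then have "fs \<in> S (\<psi> f)" using w(3) by (simp add: S_def fun_eq_iff)
    moreover have "f = \<phi> x0" if "sact a x0 \<notin> vis v"
    proof -
      have "hit a x0" using x0 by blast
      then show ?thesis using eq [of x0] lamp_off [OF v w(3) that] F.r_one [OF w(2)] by (simp only: if_True)
    qed
    ultimately show ?thesis using w by blast
  qed
  have vis: "vis u = insert x0 (sact a -` vis v)" using x0 by (simp add: u)
  have fin: "finite (sact a -` vis v)"
    using vis_finite [OF vT] sact_bij [OF a] by (simp add: finite_vimageI bij_is_inj)
  have cardv: "card (sact a -` vis v) = card (vis v)"
    using sact_bij [OF a] by (intro card_vimage_inj) (auto simp: bij_def)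
  \<comment> \<open>If the point hit first is hit again later, \<open>f\<close> is free and no
    visited point is added; otherwise \<open>f\<close> is forced and one is added. Both cases lose
    exactly one factor |F|.\<close>
  show ?case
  proof (cases "sact a x0 \<in> vis v")
    case True
    then have cu: "card (vis u) = card (vis v)" using vis cardv by (simp add: insert_absorb)
    have "card {fs \<in> words (carrier F) (Suc n). lamp u fs = \<phi>} \<le> (\<Sum>f\<in>carrier F. card (S (\<psi> f)))"
    proof -
      have "{fs \<in> words (carrier F) (Suc n). lamp u fs = \<phi>} \<subseteq> (\<Union>f\<in>carrier F. (#) f ` S (\<psi> f))"
        by (rule subsetI, drule dec, blast)
      then have "card {fs \<in> words (carrier F) (Suc n). lamp u fs = \<phi>} \<le> card (\<Union>f\<in>carrier F. (#) f ` S (\<psi> f))"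
        using F_fin finS by (intro card_mono) auto
      also have "\<dots> \<le> (\<Sum>f\<in>carrier F. card ((#) f ` S (\<psi> f)))" by (rule card_UN_le [OF F_fin])
      also have "\<dots> \<le> (\<Sum>f\<in>carrier F. card (S (\<psi> f)))" by (intro sum_mono card_image_le finS)
      finally show ?thesis .
    qed
    then have "card {fs \<in> words (carrier F) (Suc n). lamp u fs = \<phi>} * k ^ card (vis v)
        \<le> (\<Sum>f\<in>carrier F. card (S (\<psi> f)) * k ^ card (vis v))"
      by (simp add: sum_distrib_right [symmetric])
    also have "\<dots> \<le> (\<Sum>f\<in>carrier F. k ^ n)"
      unfolding S_def k_def by (intro sum_mono Suc.IH v)
    also have "\<dots> = k * k ^ n" by (simp add: k_def)
    finally show ?thesis unfolding cu k_def [symmetric] power_Suc .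
  next
    case False
    then have cu: "card (vis u) = Suc (card (vis v))" using vis cardv fin by simp
    have "card {fs \<in> words (carrier F) (Suc n). lamp u fs = \<phi>} \<le> card (S (\<psi> (\<phi> x0)))"
    proof -
      have "{fs \<in> words (carrier F) (Suc n). lamp u fs = \<phi>} \<subseteq> (#) (\<phi> x0) ` S (\<psi> (\<phi> x0))"
        using False by (intro subsetI) (drule dec, blast)
      then have "card {fs \<in> words (carrier F) (Suc n). lamp u fs = \<phi>} \<le> card ((#) (\<phi> x0) ` S (\<psi> (\<phi> x0)))"
        using finS by (intro card_mono) auto
      also have "\<dots> \<le> card (S (\<psi> (\<phi> x0)))" by (intro card_image_le finS)
      finally show ?thesis .
    qed
    then have "card {fs \<in> words (carrier F) (Suc n). lamp u fs = \<phi>} * k ^ card (vis v)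
        \<le> card (S (\<psi> (\<phi> x0))) * k ^ card (vis v)" by simp
    also have "\<dots> \<le> k ^ n" unfolding S_def k_def by (intro Suc.IH v)
    finally have "k * (card {fs \<in> words (carrier F) (Suc n). lamp u fs = \<phi>} * k ^ card (vis v)) \<le> k * k ^ n"
      by (rule mult_le_mono2)
    then show ?thesis unfolding cu k_def [symmetric] power_Suc by (simp only: mult.left_commute)
  qed
qed

section \<open>Separation of the tree motion from the lamps\<close>

lemma av_Q_mk: "av Q h = av T (\<lambda>a. av (carrier F) (\<lambda>f. h (mk a f)))"
proof -
  have "av Q h = av (P 0) (\<lambda>s. av H (\<lambda>\<pi>. av (carrier F) (\<lambda>f. av (P 0) (\<lambda>s'. h (mk (s, \<pi>, s') f)))))"
    by (simp add: Q_def I_def av_prod mk_def)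
  also have "\<dots> = av (P 0) (\<lambda>s. av H (\<lambda>\<pi>. av (P 0) (\<lambda>s'. av (carrier F) (\<lambda>f. h (mk (s, \<pi>, s') f)))))"
    by (intro av_cong av_swap)
  finally show ?thesis by (simp add: T_def av_prod)
qed

lemma av_words_mk:
  "av (words Q n) h = av (words T n) (\<lambda>u. av (words (carrier F) n) (\<lambda>fs. h (map2 mk u fs)))"
proof (induction n arbitrary: h)
  case 0
  show ?case by (simp add: av_words_0)
next
  case (Suc n)
  have "av (words Q (Suc n)) h = av T (\<lambda>a. av (carrier F) (\<lambda>f. av (words T n) (\<lambda>u.
      av (words (carrier F) n) (\<lambda>fs. h (mk a f # map2 mk u fs)))))"
    by (simp add: av_words_Cons av_Q_mk Suc)
  also have "\<dots> = av T (\<lambda>a. av (words T n) (\<lambda>u. av (carrier F) (\<lambda>f.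
      av (words (carrier F) n) (\<lambda>fs. h (mk a f # map2 mk u fs)))))"
    by (intro av_cong av_swap)
  finally show ?case by (simp add: av_words_Cons)
qed

lemma card_F: "2 \<le> card (carrier F)"
proof (rule ccontr)
  assume "\<not> 2 \<le> card (carrier F)"
  then have "card (carrier F) \<le> Suc 0" by simp
  then have "carrier F = {\<one>\<^bsub>F\<^esub>}" using card_le_Suc0_iff_eq [OF F_fin] by auto
  then show False using F_nontriv by simp
qed

text \<open>Of the return only the triviality of all lamps is used; \<open>lamp_count\<close> bounds
  its conditional probability by |F|^(-|vis|), and |F| >= 2.\<close>

lemma pr_le_vis: "pr n (wone F) \<le> av (words T n) (\<lambda>u. (1 / 2) ^ card (vis u))"
  unfolding pr_def av_words_mk
proof (rule av_mono)
  fix u assume u: "u \<in> words T n"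
  let ?k = "card (carrier F)" and ?W = "words (carrier F) n"
  let ?S = "{fs \<in> ?W. lamp u fs = fst (wone F)}"
  have W: "finite ?W" using words_finite [OF F_fin] .
  have cardW: "card ?W = ?k ^ n"
    unfolding words_def using F_fin by (rule card_lists_length_eq)
  have k: "0 < real ?k" using card_F by simp
  have "av ?W (\<lambda>fs. of_bool (ev (map2 mk u fs) = wone F)) \<le> av ?W (\<lambda>fs. of_bool (lamp u fs = fst (wone F)))"
    by (rule av_mono) (simp add: lamp_def)
  also have "\<dots> = real (card ?S) / real ?k ^ n"
    using W by (simp add: av_def cardW Int_def)
  also have "\<dots> \<le> (1 / real ?k) ^ card (vis u)"
  proof -
    have "real (card ?S) * real ?k ^ card (vis u) \<le> real ?k ^ n"
      using lamp_count [OF u, of "fst (wone F)"] by (simp flip: of_nat_power of_nat_mult)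
    then show ?thesis using k by (simp add: field_simps)
  qed
  also have "\<dots> \<le> (1 / 2) ^ card (vis u)"
    using card_F by (intro power_mono) (auto simp: field_simps)
  finally show "av ?W (\<lambda>fs. of_bool (ev (map2 mk u fs) = wone F)) \<le> (1 / 2) ^ card (vis u)" .
qed

text \<open>\<open>hf\<close> dominates the survival indicator and contracts in each step by
  \<open>hf_drift\<close>; the last rooted factor does not change \<open>hf\<close>, and the lamp
  component of \<open>I\<close> averages out.\<close>

lemma unvisited_le:
  assumes "x \<in> bd d"
  shows "av (words T n) (\<lambda>u. of_bool (unv l u x)) \<le> (1 - eta l 0) ^ n * hf l 0 x"
  using assms
proof (induction n arbitrary: x)
  case 0
  then show ?case using hf_bounds [of x 0 l] by (simp add: av_words_0 dl_zero)
next
  case (Suc n)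
  let ?\<Lambda> = "1 - eta l 0"
  have \<Lambda>: "0 \<le> ?\<Lambda>" using eta_bounds [of l 0] by simp
  have x: "x \<in> bd (dl 0)" using Suc.prems by (simp add: dl_zero)
  have "av (words T (Suc n)) (\<lambda>u. of_bool (unv l u x))
      \<le> av T (\<lambda>a. if pre l (rootact d (fst a) x) then 0
          else ?\<Lambda> ^ n * hf l 0 (hact d (fst (snd a)) (rootact d (fst a) x)))"
    unfolding av_words_Cons
  proof (rule av_mono)
    fix a assume "a \<in> T"
    then obtain s \<pi> s' where a: "a = (s, \<pi>, s')" "s \<in> P 0" "\<pi> \<in> H" "s' \<in> P 0" by (auto simp: T_def)
    let ?y = "hact d \<pi> (rootact d s x)"
    have y: "?y \<in> bd d"
      using a by (intro hact_bd H_sub rootact_bd Suc.prems) (auto simp: P_def)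
    then have z: "sact a x \<in> bd d" using a by (simp add: rootact_bd P_def)
    have "hf l 0 (sact a x) = hf l 0 ?y"
      using hf_R [OF a(4), of ?y l] y by (simp add: a(1) R_snd dl_zero)
    then show "av (words T n) (\<lambda>u. of_bool (unv l (a # u) x))
        \<le> (if pre l (rootact d (fst a) x) then 0
            else ?\<Lambda> ^ n * hf l 0 (hact d (fst (snd a)) (rootact d (fst a) x)))"
      using Suc.IH [OF z] a(1) by (simp add: av_def)
  qed
  also have "\<dots> = av (P 0) (\<lambda>s. av H (\<lambda>\<pi>. if pre l (rootact d s x) then 0
          else ?\<Lambda> ^ n * hf l 0 (hact d \<pi> (rootact d s x))))"
    by (simp add: T_def av_prod av_const cong: if_cong)
  also have "\<dots> = av (P 0) (\<lambda>s. ?\<Lambda> ^ n * kf l 0 (hf l 0) (snd (R 0 s) x))"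
  proof (rule av_cong)
    fix s
    have "av I (\<lambda>i. hf l 0 (snd (K 0 i) (rootact d s x))) = av I (\<lambda>i. hf l 0 (hact d (fst i) (rootact d s x)))"
      by (rule av_cong) (auto simp: K_snd dl_zero sh_zero I_def)
    also have "\<dots> = av H (\<lambda>\<pi>. hf l 0 (hact d \<pi> (rootact d s x)))" by (rule av_I_fst)
    finally show "av H (\<lambda>\<pi>. if pre l (rootact d s x) then 0 else ?\<Lambda> ^ n * hf l 0 (hact d \<pi> (rootact d s x)))
        = ?\<Lambda> ^ n * kf l 0 (hf l 0) (snd (R 0 s) x)"
      using H_fin by (simp add: kf_def R_snd dl_zero av_cmult av_const)
  qed
  also have "\<dots> \<le> ?\<Lambda> ^ n * (?\<Lambda> * hf l 0 x)"
    unfolding av_cmult using hf_drift [OF x, of l] \<Lambda> by (intro mult_left_mono) auto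
  finally show ?case by (simp add: mult_ac)
qed

section \<open>From visited subtrees to visited boundary points\<close>

lemma H_inverse:
  assumes "\<pi> \<in> H"
  obtains \<rho> where "\<rho> \<in> H" "\<And>x. hact d \<pi> (hact d \<rho> x) = x" "\<And>x. hact d \<rho> (hact d \<pi> x) = x"
proof -
  have i: "(\<pi>, \<one>\<^bsub>F\<^esub>) \<in> I" using assms by (simp add: I_def)
  let ?b = "iinv (\<pi>, \<one>\<^bsub>F\<^esub>)"
  have K: "snd (K 0 i) = hact d (fst i)" if "i \<in> I" for i
    using that by (auto simp: K_snd dl_zero sh_zero I_def)
  have b: "?b \<in> I" by (rule iinv(1) [OF i])
  have "snd (wmul F (K 0 (\<pi>, \<one>\<^bsub>F\<^esub>)) (K 0 ?b)) = id" "snd (wmul F (K 0 ?b) (K 0 (\<pi>, \<one>\<^bsub>F\<^esub>))) = id"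
    unfolding K_mult [OF i b] K_mult [OF b i] iinv(2,3) [OF i] K_one by (simp_all add: wone_def)
  then have "hact d (fst ?b) \<circ> hact d \<pi> = id" "hact d \<pi> \<circ> hact d (fst ?b) = id"
    by (simp_all add: wmul_def K [OF i] K [OF b])
  moreover have "fst ?b \<in> H" using b by (auto simp: I_def)
  ultimately show ?thesis using that [of "fst ?b"] by (simp add: fun_eq_iff)
qed

lemma root_inverse: "s \<in> P 0 \<Longrightarrow> rootact d s (rootact d (inv_into UNIV s) x) = x"
  "s \<in> P 0 \<Longrightarrow> rootact d (inv_into UNIV s) (rootact d s x) = x"
  by (simp_all add: P_def rootact_comp permutes_inv permutes_inv_o rootact_id)

lemma root_bd: "s \<in> P 0 \<Longrightarrow> x \<in> bd d \<Longrightarrow> rootact d s x \<in> bd d"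
  by (simp add: P_def rootact_bd)

text \<open>Entering the subtree below 1^l is weaker than reaching 1^\<infinity>. Pulling
  1^\<infinity> back from the moment of entry gives a point that is hit exactly, and the inverse
  steps keep it below the same vertex of level \<open>l\<close> as \<open>x\<close>.\<close>

lemma visited_agree:
  assumes "set u \<subseteq> T" "x \<in> bd d" "\<not> unv l u x"
  shows "\<exists>x'\<in>vis u. x' \<in> bd d \<and> agree l x' x"
  using assms
proof (induction u arbitrary: x)
  case (Cons a u)
  obtain s \<pi> s' where a: "a = (s, \<pi>, s')" "s \<in> P 0" "\<pi> \<in> H" "s' \<in> P 0"
    using Cons.prems(1) by (auto simp: T_def)
  let ?si = "inv_into UNIV s" and ?ti = "inv_into UNIV s'"
  have i: "?si \<in> P 0" "?ti \<in> P 0" using a P_inv(1) by auto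
  obtain \<rho> where \<rho>: "\<rho> \<in> H" "\<And>x. hact d \<pi> (hact d \<rho> x) = x" "\<And>x. hact d \<rho> (hact d \<pi> x) = x"
    by (rule H_inverse [OF a(3)], rule that)
  have bd1: "ones \<in> bd d" using ones_bd [of 0] by (simp add: dl_zero)
  have sx: "rootact d s x \<in> bd d" using root_bd [OF a(2) Cons.prems(2)] .
  show ?case
  proof (cases "pre l (rootact d s x)")
    case True
    then have "agree l ones (rootact d s x)" by (simp add: pre_def agree_def ones_def)
    then have "agree l (rootact d ?si ones) (rootact d ?si (rootact d s x))"
      by (rule agree_rootact [OF _ bd1 sx])
    moreover have "hit a (rootact d ?si ones)" by (simp add: hit_def a(1) root_inverse [OF a(2)])
    ultimately show ?thesis using root_bd [OF i(1) bd1] by (auto simp: root_inverse [OF a(2)])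
  next
    case False
    have px: "hact d \<pi> (rootact d s x) \<in> bd d" by (rule hact_bd [OF H_sub [OF a(3)] sx])
    then have z: "sact a x \<in> bd d" using root_bd [OF a(4)] by (simp add: a(1))
    have "\<not> unv l u (sact a x)" using False Cons.prems(3) by (simp add: a(1))
    then obtain y' where y': "y' \<in> vis u" "y' \<in> bd d" "agree l y' (sact a x)"
      using Cons.IH [OF _ z] Cons.prems(1) by auto
    let ?v = "rootact d ?ti y'"
    have v: "?v \<in> bd d" by (rule root_bd [OF i(2) y'(2)])
    have "agree l ?v (rootact d ?ti (sact a x))" by (rule agree_rootact [OF y'(3,2) z])
    then have 1: "agree l ?v (hact d \<pi> (rootact d s x))" by (simp add: a(1) root_inverse [OF a(4)])
    have "agree l (hact d \<rho> ?v) (hact d \<rho> (hact d \<pi> (rootact d s x)))" by (rule agree_hact [OF 1 v px])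
    then have 2: "agree l (hact d \<rho> ?v) (rootact d s x)" by (simp add: \<rho>)
    have w: "hact d \<rho> ?v \<in> bd d" by (rule hact_bd [OF H_sub [OF \<rho>(1)] v])
    have "agree l (rootact d ?si (hact d \<rho> ?v)) (rootact d ?si (rootact d s x))"
      by (rule agree_rootact [OF 2 w sx])
    moreover have "sact a (rootact d ?si (hact d \<rho> ?v)) = y'"
      by (simp add: a(1) root_inverse [OF a(2)] root_inverse [OF a(4)] \<rho>)
    ultimately show ?thesis
      using y'(1) root_bd [OF i(1) w] by (auto simp: root_inverse [OF a(2)])
  qed
qed simp

text \<open>One boundary point v 1^\<infinity> for each vertex v of level \<open>l\<close>.\<close>

definition V :: "nat \<Rightarrow> (nat \<Rightarrow> nat) set" where
  "V l = {x. (\<forall>i<l. x i \<in> {1..d i}) \<and> (\<forall>i\<ge>l. x i = 1)}"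

lemma V_bd: "V l \<subseteq> bd d"
proof
  fix x assume x: "x \<in> V l"
  have "1 \<le> x j \<and> x j \<le> d j" for j
    using x d_pos(2) [of j] by (cases "j < l") (auto simp: V_def)
  then show "x \<in> bd d" by (simp add: bd_def)
qed

lemma V_card: "card (V l) = (\<Prod>i<l. d i)" and V_finite: "finite (V l)"
proof -
  have "bij_betw (\<lambda>f i. if i < l then f i else 1) (PiE {..<l} (\<lambda>i. {1..d i})) (V l)"
    by (rule bij_betwI [where g = "\<lambda>x. \<lambda>i\<in>{..<l}. x i"])
      (auto simp: V_def PiE_def extensional_def fun_eq_iff Pi_iff)
  moreover have "card (PiE {..<l} (\<lambda>i. {1..d i})) = (\<Prod>i<l. d i)" by (simp add: card_PiE)
  moreover have "finite (PiE {..<l} (\<lambda>i. {1..d i}))" by (intro finite_PiE) auto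
  ultimately show "card (V l) = (\<Prod>i<l. d i)" "finite (V l)"
    using bij_betw_same_card bij_betw_finite by fastforce+
qed

text \<open>Truncation at depth \<open>l\<close> sends visited points onto a set containing all
  these representatives.\<close>

lemma vis_card:
  assumes "set u \<subseteq> T" "\<And>x. x \<in> V l \<Longrightarrow> \<not> unv l u x"
  shows "card (V l) \<le> card (vis u)"
proof -
  let ?tr = "\<lambda>x i. if i < l then x i else (1 :: nat)"
  have "V l \<subseteq> ?tr ` vis u"
  proof
    fix x assume x: "x \<in> V l"
    then obtain x' where x': "x' \<in> vis u" "agree l x' x"
      using visited_agree [OF assms(1) _ assms(2)] V_bd by blast
    then have "x = ?tr x'" using x by (auto simp: V_def agree_def fun_eq_iff)
    then show "x \<in> ?tr ` vis u" using x'(1) by blast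
  qed
  then have "card (V l) \<le> card (?tr ` vis u)" using vis_finite [OF assms(1)] by (intro card_mono) auto
  also have "\<dots> \<le> card (vis u)" using vis_finite [OF assms(1)] by (rule card_image_le)
  finally show ?thesis .
qed

lemma return_probability_le:
  "pr n (wone F) \<le> (1 / 2) ^ (\<Prod>i<l. d i) + real (\<Prod>i<l. d i) * 3 ^ l * (1 - (\<Prod>i<l. pp d i)) ^ n"
proof -
  let ?W = "words T n"
  have W: "finite ?W" "?W \<noteq> {}" by (simp_all add: words_finite words_nonempty)
  have "pr n (wone F) \<le> av ?W (\<lambda>u. (1 / 2) ^ card (vis u))" by (rule pr_le_vis)
  also have "\<dots> \<le> av ?W (\<lambda>u. (1 / 2) ^ card (V l) + (\<Sum>x\<in>V l. of_bool (unv l u x)))"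
  proof (rule av_mono)
    fix u assume "u \<in> ?W"
    then have u: "set u \<subseteq> T" by (rule words_subset)
    show "(1 / 2 :: real) ^ card (vis u) \<le> (1 / 2) ^ card (V l) + (\<Sum>x\<in>V l. of_bool (unv l u x))"
    proof (cases "\<exists>x\<in>V l. unv l u x")
      case True
      then obtain x where x: "x \<in> V l" "unv l u x" by blast
      have "(1 :: real) = of_bool (unv l u x)" using x by simp
      also have "\<dots> \<le> (\<Sum>x\<in>V l. of_bool (unv l u x))"
        by (rule member_le_sum [OF x(1)]) (auto simp: V_finite)
      moreover have "(1 / 2 :: real) ^ card (vis u) \<le> 1" by (rule power_le_one) auto
      moreover have "(0 :: real) \<le> (1 / 2) ^ card (V l)" by simp
      ultimately show ?thesis by linarith
    next
      case False
      then have "(1 / 2 :: real) ^ card (vis u) \<le> (1 / 2) ^ card (V l)"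
        by (intro power_decreasing vis_card [OF u]) auto
      moreover have "(0 :: real) \<le> (\<Sum>x\<in>V l. of_bool (unv l u x))" by (intro sum_nonneg) simp
      ultimately show ?thesis by linarith
    qed
  qed
  also have "\<dots> = (1 / 2) ^ card (V l) + (\<Sum>x\<in>V l. av ?W (\<lambda>u. of_bool (unv l u x)))"
    by (simp only: av_add av_sum av_const [OF W])
  also have "\<dots> \<le> (1 / 2) ^ card (V l) + (\<Sum>x\<in>V l. 3 ^ l * (1 - eta l 0) ^ n)"
  proof (intro add_left_mono sum_mono)
    fix x assume "x \<in> V l"
    then have x: "x \<in> bd d" using V_bd by blast
    have "av ?W (\<lambda>u. of_bool (unv l u x)) \<le> (1 - eta l 0) ^ n * hf l 0 x" by (rule unvisited_le [OF x])
    also have "\<dots> \<le> (1 - eta l 0) ^ n * 3 ^ l"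
      using hf_bounds [of x 0 l] x eta_bounds [of l 0] by (intro mult_left_mono) (auto simp: dl_zero)
    finally show "av ?W (\<lambda>u. of_bool (unv l u x)) \<le> 3 ^ l * (1 - eta l 0) ^ n" by (simp add: mult.commute)
  qed
  finally show ?thesis by (simp add: V_card eta_eq)
qed


section \<open>Exponents\<close>

lemma pr_pos: "0 < pr n (wone F)"
proof (induction n)
  case (Suc n)
  have "0 < real (card Q)" by (simp add: card_gt_0_iff)
  then have "0 < pr n (wone F) / real (card Q)" using Suc by simp
  then show ?case using pr_Suc by (rule less_le_trans)
qed (simp add: pr_def av_words_0)

lemma pr_le_one: "pr n g \<le> 1"
proof -
  have "pr n g \<le> av (words Q n) (\<lambda>_. 1)" unfolding pr_def by (rule av_mono) simp
  then show ?thesis by (simp add: av_const)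
qed

text \<open>The \<open>LEAST\<close> is attained because p_i <= 1/2 and n 2^(-n) <= 1. Its product
  includes the index k itself, hence the \<open>Suc\<close>.\<close>

lemma kk_le: "(\<Prod>i<Suc (kk d n). pp d i) * real n \<le> 1"
proof -
  have pw: "(\<Prod>i\<le>k. pp d i) \<le> (1 / 2) ^ k" for k
  proof -
    have "(\<Prod>i\<le>k. pp d i) \<le> (\<Prod>i\<le>k. 1 / 2)"
    proof (rule prod_mono)
      fix i show "0 \<le> pp d i \<and> pp d i \<le> 1 / 2" using pp_bounds [of i] by simp
    qed
    also have "\<dots> \<le> (1 / 2) ^ k" by simp
    finally show ?thesis .
  qed
  have "real n < 2 ^ n" by (rule of_nat_less_two_power)
  have "(\<Prod>i\<le>n. pp d i) * real n \<le> (1 / 2) ^ n * 2 ^ n"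
    using pw [of n] \<open>real n < 2 ^ n\<close> by (intro mult_mono) auto
  also have "\<dots> = 1" by (simp flip: power_mult_distrib)
  finally have "(\<Prod>i\<le>kk d n. pp d i) * real n \<le> 1" unfolding kk_def by (rule LeastI)
  then show ?thesis by (simp add: lessThan_Suc_atMost)
qed

lemma upper_exponent:
  assumes "0 < \<epsilon>"
  shows "\<forall>\<^sub>F n in sequentially. ln (- ln (pr n (wone F))) / ln (real n) \<le> beta d n + \<epsilon>"
proof -
  obtain C where C: "0 < C" "\<And>n m. (\<Prod>i<m. pp d i) * real n \<le> 1 \<Longrightarrow> exp (- C * D m 0) \<le> pr n (wone F)"
    using return_probability_ge by blast
  have "\<forall>\<^sub>F n in sequentially. \<bar>ln C\<bar> / ln (real n) \<le> \<epsilon>"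
    using assms by real_asymp
  with eventually_ge_at_top [of 2] show ?thesis
  proof eventually_elim
    case (elim n)
    let ?D = "real (\<Prod>i\<le>kk d n. d i)"
    let ?x = "- ln (pr n (wone F))"
    have ln: "0 < ln (real n)" using elim(1) by simp
    have D: "D (Suc (kk d n)) 0 = ?D" by (simp add: D_def lessThan_Suc_atMost)
    then have D1: "1 \<le> ?D" using D_ge [of "Suc (kk d n)" 0] by simp
    have "exp (- C * ?D) \<le> pr n (wone F)" using C(2) [OF kk_le [of n]] unfolding D .
    then have "ln (exp (- C * ?D)) \<le> ln (pr n (wone F))" using pr_pos by (subst ln_le_cancel_iff) auto
    then have x: "?x \<le> C * ?D" by simp
    have x0: "0 \<le> ?x" using pr_pos pr_le_one by simp
    have "ln ?x \<le> \<bar>ln C\<bar> + ln ?D"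
    proof (cases "?x = 0")
      \<comment> \<open>A return probability of 1 is not excluded at this point; then ln 0 = 0 in
        HOL and the bound still holds.\<close>
      case True
      then show ?thesis using D1 by simp
    next
      case False
      then have "ln ?x \<le> ln (C * ?D)" using x x0 by (subst ln_le_cancel_iff) auto
      also have "\<dots> = ln C + ln ?D" using C(1) D1 by (intro ln_mult_pos) linarith+
      finally show ?thesis by linarith
    qed
    then have "ln ?x / ln (real n) \<le> (\<bar>ln C\<bar> + ln ?D) / ln (real n)"
      using ln by (intro divide_right_mono) auto
    also have "\<dots> = \<bar>ln C\<bar> / ln (real n) + beta d n"
      by (simp only: beta_def add_divide_distrib)
    finally show ?case using elim(2) by linarith
  qed
qed

text \<open>\<open>GREATEST\<close> needs a witness, supplied by the hypothesis, and an upper bound,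
  which holds because every factor is at least 2.\<close>

lemma ll_greatest:
  assumes "(\<Prod>i\<le>k. real (d i) ^ 3 / (real (d i) - 1)) \<le> real n"
  shows "(\<Prod>i\<le>ll d n. real (d i) ^ 3 / (real (d i) - 1)) \<le> real n" "k \<le> ll d n"
proof -
  let ?c = "\<lambda>l. (\<Prod>i\<le>l. real (d i) ^ 3 / (real (d i) - 1))"
  have two: "2 \<le> real (d i) ^ 3 / (real (d i) - 1)" for i
  proof -
    let ?r = "real (d i)"
    have r: "2 \<le> ?r" using d_ge [of i] by simp
    have "2 * ?r \<le> ?r * ?r" using r by (intro mult_right_mono) auto
    then have "2 * (?r - 1) \<le> ?r * ?r" by simp
    also have "\<dots> * 1 \<le> ?r * ?r * ?r" using r by (intro mult_left_mono) auto
    finally show ?thesis using r by (simp add: pos_le_divide_eq power3_eq_cube)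
  qed
  have bound: "l \<le> n" if "?c l \<le> real n" for l
  proof -
    have "real l < 2 ^ l" by (rule of_nat_less_two_power)
    also have "\<dots> \<le> (\<Prod>i\<le>l. 2)" by simp
    also have "\<dots> \<le> ?c l" using two by (intro prod_mono) auto
    finally show ?thesis using that by simp
  qed
  show "?c (ll d n) \<le> real n"
    unfolding ll_def by (rule GreatestI_nat [where P = "\<lambda>l. ?c l \<le> real n", OF assms]) (rule bound)
  show "k \<le> ll d n"
    unfolding ll_def by (rule Greatest_le_nat [where P = "\<lambda>l. ?c l \<le> real n", OF assms]) (rule bound)
qed

lemma prod_d_ge: "2 ^ l \<le> (\<Prod>i<l. d i)"
proof -
  have "(\<Prod>i<l. 2) \<le> (\<Prod>i<l. d i)" by (rule prod_mono) (use d_ge in auto)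
  then show ?thesis by simp
qed

lemma lower_exponent:
  assumes "0 < \<epsilon>"
  shows "\<forall>\<^sub>F n in sequentially. beta' d n - \<epsilon> \<le> ln (- ln (pr n (wone F))) / ln (real n)"
proof -
  have "\<forall>\<^sub>F N in sequentially. exp (- (real N / 2)) + real N * (real N ^ 2) * exp (- real N) \<le> exp (- (real N / 4))"
    by real_asymp
  \<comment> \<open>To be applied with N = d_0 ... d_l: N counts the vertices and N^2 bounds
    3^(l+1). The 1/4 could be any positive number below 1/2.\<close>
  then obtain N0 where N0: "\<And>N. N0 \<le> N \<Longrightarrow> exp (- (real N / 2)) + real N * (real N ^ 2) * exp (- real N) \<le> exp (- (real N / 4))"
    by (auto simp: eventually_sequentially)
  have ev1: "\<forall>\<^sub>F n in sequentially. (\<Prod>i\<le>N0. real (d i) ^ 3 / (real (d i) - 1)) \<le> real n"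
    using filterlim_real_sequentially unfolding filterlim_at_top by blast
  have ev2: "\<forall>\<^sub>F n in sequentially. ln 4 / ln (real n) \<le> \<epsilon>"
    using assms by real_asymp
  from ev1 ev2 eventually_ge_at_top [of 2] show ?thesis
  proof eventually_elim
    case (elim n)
    let ?l = "Suc (ll d n)"
    define N where "N = (\<Prod>i<?l. d i)"
    define \<eta> where "\<eta> = (\<Prod>i<?l. pp d i)"
    let ?x = "- ln (pr n (wone F))"
    have ln: "0 < ln (real n)" using elim(3) by simp
    have "N0 \<le> ll d n" using ll_greatest(2) [OF elim(1)] .
    also have "\<dots> < 2 ^ ?l" by (rule less_trans [OF less_exp]) simp
    also have "\<dots> \<le> N" unfolding N_def by (rule prod_d_ge)
    finally have NN: "N0 \<le> N" by simp
    have "(1 :: nat) \<le> 2 ^ ?l" by (rule one_le_power) simp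
    also have "\<dots> \<le> N" unfolding N_def by (rule prod_d_ge)
    finally have "real 1 \<le> real N" by (rule of_nat_mono)
    then have N1: "1 \<le> real N" by (simp only: of_nat_1)
    have \<eta>01: "0 < \<eta>" "\<eta> \<le> 1" using eta_bounds [of ?l 0] by (simp_all only: eta_eq add_0 \<eta>_def)
    \<comment> \<open>The factors in \<open>ll\<close> are d / p, so its defining condition reads N
      <= n \<eta>, and (1 - \<eta>)^n becomes at most exp (- N).\<close>
    have "real N / \<eta> = (\<Prod>i<?l. real (d i) ^ 3 / (real (d i) - 1))"
    proof -
      have "real (d i) / pp d i = real (d i) ^ 3 / (real (d i) - 1)" for i
        using d_pos(1) [of i] by (simp add: pp_def power3_eq_cube power2_eq_square)
      then show ?thesis by (simp only: N_def \<eta>_def of_nat_prod prod_dividef [symmetric])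
    qed
    also have "\<dots> \<le> real n" using ll_greatest(1) [OF elim(1)] by (simp add: lessThan_Suc_atMost)
    finally have \<eta>n: "real N \<le> real n * \<eta>" using \<eta>01 by (simp add: pos_divide_le_eq)
    have "(1 / 2 :: real) ^ N \<le> exp (- (1 / 2)) ^ N"
      using exp_ge_add_one_self [of "- (1 / 2) :: real"] by (intro power_mono) auto
    also have "\<dots> = exp (- (real N / 2))" by (simp flip: exp_of_nat_mult)
    finally have 0: "(1 / 2 :: real) ^ N \<le> exp (- (real N / 2))" .
    have "(1 - \<eta>) ^ n \<le> exp (- \<eta>) ^ n"
      using \<eta>01 exp_ge_add_one_self [of "- \<eta>"] by (intro power_mono) auto
    also have "\<dots> = exp (- (real n * \<eta>))" by (simp flip: exp_of_nat_mult)
    also have "\<dots> \<le> exp (- real N)" using \<eta>n by simp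
    finally have 1: "(1 - \<eta>) ^ n \<le> exp (- real N)" .
    \<comment> \<open>Since 3 <= 2^2 and 2^(l+1) <= N, the loss from \<open>hf_bounds\<close> is
      polynomial in N.\<close>
    have "(3 :: real) ^ ?l \<le> (2 ^ 2) ^ ?l" by (intro power_mono) auto
    also have "\<dots> = (2 ^ ?l) ^ 2" by (simp only: power_mult [symmetric] mult.commute)
    also have "\<dots> \<le> real N ^ 2"
    proof (rule power_mono)
      have "2 ^ ?l \<le> N" unfolding N_def by (rule prod_d_ge)
      then have "real (2 ^ ?l) \<le> real N" by (rule of_nat_mono)
      then show "2 ^ ?l \<le> real N" by simp
    qed simp
    finally have 2: "(3 :: real) ^ ?l \<le> real N ^ 2" .
    have "pr n (wone F) \<le> (1 / 2) ^ N + real N * 3 ^ ?l * (1 - \<eta>) ^ n"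
      unfolding N_def \<eta>_def by (rule return_probability_le)
    also have "\<dots> \<le> exp (- (real N / 2)) + real N * (real N ^ 2) * exp (- real N)"
      using \<eta>01 by (intro add_mono mult_mono 0 1 2) auto
    also have "\<dots> \<le> exp (- (real N / 4))" by (rule N0 [OF NN])
    finally have "ln (pr n (wone F)) \<le> ln (exp (- (real N / 4)))"
      using pr_pos by (subst ln_le_cancel_iff) auto
    then have "real N / 4 \<le> ?x" by simp
    then have "ln (real N / 4) \<le> ln ?x" using N1 by (subst ln_le_cancel_iff) auto
    moreover have "ln (real N / 4) = ln (real N) - ln 4" using N1 by (subst ln_div) auto
    ultimately have "(ln (real N) - ln 4) / ln (real n) \<le> ln ?x / ln (real n)"
      using ln by (intro divide_right_mono) auto
    moreover have "(ln (real N) - ln 4) / ln (real n) = beta' d n - ln 4 / ln (real n)"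
      by (simp only: N_def beta'_def diff_divide_distrib lessThan_Suc_atMost)
    ultimately show ?case using elim(2) by linarith
  qed
qed

end

theorem mainTheorem12:
  fixes F :: "('f, 'z) monoid_scheme"
    and d :: "nat \<Rightarrow> nat"
    and H :: "(nat \<Rightarrow> nat \<Rightarrow> nat \<Rightarrow> nat) set"
  assumes d_ge: "\<And>j. 2 \<le> d j"
    and d_bdd: "\<exists>B. \<forall>j. d j \<le> B"
    and F_group: "group F"
    and F_fin: "finite (carrier F)"
    and F_nontriv: "carrier F \<noteq> {\<one>\<^bsub>F\<^esub>}"
    and H_sub: "\<And>\<pi>. \<pi> \<in> H \<Longrightarrow> Hfam d \<pi>"
    and H_fin: "finite H"
    and H_one: "(\<lambda>l t. id) \<in> H"
    and H_mult: "\<And>\<pi>1 \<pi>2. \<pi>1 \<in> H \<Longrightarrow> \<pi>2 \<in> H \<Longrightarrow>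
                   \<exists>\<pi>3\<in>H. \<forall>x. hact d \<pi>3 x = hact d \<pi>2 (hact d \<pi>1 x)"
    and H_unif: "\<And>l t. 1 \<le> l \<Longrightarrow> t \<in> {2..d (l - 1)} \<Longrightarrow>
                   map_pmf (\<lambda>\<pi>. \<pi> l t) (pmf_of_set H) = pmf_of_set {\<sigma>. \<sigma> permutes {1..d l}}"
  shows "\<forall>\<epsilon>>0. \<forall>\<^sub>F n in sequentially.
           beta' d n - \<epsilon> \<le> ln (- ln (pmf (walk F d H n) (wone F))) / ln (real n) \<and>
           ln (- ln (pmf (walk F d H n) (wone F))) / ln (real n) \<le> beta d n + \<epsilon>"
proof (intro allI impI)
  interpret directed F d H
    by (rule directed.intro; fact)
  fix \<epsilon> :: real assume "0 < \<epsilon>"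
  then show "\<forall>\<^sub>F n in sequentially.
           beta' d n - \<epsilon> \<le> ln (- ln (pmf (walk F d H n) (wone F))) / ln (real n) \<and>
           ln (- ln (pmf (walk F d H n) (wone F))) / ln (real n) \<le> beta d n + \<epsilon>"
    unfolding pmf_walk by (intro eventually_conj lower_exponent upper_exponent)
qed

end
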